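(* Let $\mathcal{I}=[0,1]$, let $\tilde{A}(t)$ be an $N\times N$ matrix-valued function analytic on $\mathcal{I}$ and let $\tilde{B}(t,s)$ be an $N\times N$ matrix-valued function analytic in both variables on $\mathcal{I}$. Let $\tilde U(t,s)$ be the solution of $$\partial_t \tilde U(t,s)=\tilde A(t)\tilde U(t,s)+\tilde B(t,s),\quad \tilde U(s,s)=I_N,\qquad t\ge s,\ t,s\in\mathcal{I},$$ and put $U(t,s)=\tilde U(t,s)\Theta(t-s)$, $A(t,s)=\tilde A(t)\Theta(t-s)$, $B(t,s)=\tilde B(t,s)\Theta(t-s)$. Then the series $\sum_{k\ge 1}A^{\star k}(t,s)$ converges uniformly, the $\star$-resolvent $$R_\star(A):=I_\star+\sum_{k\ge 1}A^{\star k}$$ is the $\star$-inverse of $I_\star-A$, i.e. $R_\star(A)=(I_\star-A)^{-\star}$, and $$U(t,s)=\Theta(t-s)\star (I_\star-A)^{-\star}(t,s)\star\left(I_\star(t,s)+B(t,s)\right).$$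
   Context: $\Theta$ is the Heaviside function, $\Theta(t-s)=1$ if $t\ge s$ and $0$ if $t<s$; $\delta$ is the Dirac delta and $\delta^{(i)}$ its $i$-th derivative. $\mathcal{A}(\mathcal{I})$ denotes the set of bivariate functions analytic in both $t$ and $s$ over $\mathcal{I}=[0,1]$. $\mathcal{D}(\mathcal{I})$ is the class of distributions of the form $d(t,s)=\tilde d(t,s)\Theta(t-s)+\sum_{i=0}^k\tilde d_i(t,s)\delta^{(i)}(t-s)$ with $\tilde d,\tilde d_i\in\mathcal{A}(\mathcal{I})$. The $\star$-product on $\mathcal{D}(\mathcal{I})$ is $(f_2\star f_1)(t,s)=\int_{\mathcal{I}}f_2(t,\tau)f_1(\tau,s)\,d\tau$ (in the distributional sense); it makes $\mathcal{D}(\mathcal{I})$ a non-commutative associative ring with identity $1_\star(t,s)=\delta(t-s)$. For $f_i=\tilde f_i(t,s)\Theta(t-s)$ it is $(f_2\star f_1)(t,s)=\Theta(t-s)\int_s^t\tilde f_2(t,\tau)\tilde f_1(\tau,s)\,d\tau$. For matrices with entries in $\mathcal{D}(\mathcal{I})$ the $\star$-product is defined by the same integral with the ordinary product in the integrand replaced by the matrix product; the $\star$-product of a scalar $g\in\mathcal{D}(\mathcal{I})$ with a matrix is taken entrywise. $I_\star(t,s)=I_N\,\delta(t-s)$ is the identity for the matrix $\star$-product, $A^{\star k}$ is the $k$-th $\star$-power of $A$, and $X^{-\star}$ denotes the inverse of $X$ with respect to the matrix $\star$-product. *)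

theory Defs
  imports "HOL-Analysis.Analysis" "HOL-Library.Function_Algebras"
begin

abbreviation I01 :: "real set" where
  "I01 \<equiv> {0..1}"

definition Heaviside :: "real \<Rightarrow> real" where
  "Heaviside x = (if x \<ge> 0 then 1 else 0)"

text \<open>Analyticity over the closed interval (respectively square): near every point, boundary points
  included, the function is given by a convergent power series (in the two variables jointly).
  Functions are total on the reals; their values off the interval are irrelevant.\<close>

definition analytic_I :: "(real \<Rightarrow> complex) \<Rightarrow> bool" where
  "analytic_I f \<longleftrightarrow> (\<forall>t0\<in>I01. \<exists>r>0. \<exists>c :: nat \<Rightarrow> complex. \<forall>t\<in>I01. \<bar>t - t0\<bar> < r \<longrightarrow>
     (\<lambda>n. c n * of_real ((t - t0) ^ n)) sums f t)"

definition analytic_II :: "(real \<Rightarrow> real \<Rightarrow> complex) \<Rightarrow> bool" where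
  "analytic_II f \<longleftrightarrow> (\<forall>t0\<in>I01. \<forall>s0\<in>I01. \<exists>r>0. \<exists>c :: nat \<Rightarrow> nat \<Rightarrow> complex.
     \<forall>t\<in>I01. \<forall>s\<in>I01. \<bar>t - t0\<bar> < r \<longrightarrow> \<bar>s - s0\<bar> < r \<longrightarrow>
       ((\<lambda>(m, n). c m n * of_real ((t - t0) ^ m * (s - s0) ^ n)) has_sum f t s) UNIV)"

text \<open>Iterated derivatives of a function on the interval (one-sided at the end points).\<close>

definition nderiv :: "nat \<Rightarrow> (real \<Rightarrow> complex) \<Rightarrow> real \<Rightarrow> complex" where
  "nderiv n f = ((\<lambda>g t. vector_derivative g (at t within I01)) ^^ n) f"

text \<open>Test functions: smooth on the interval and vanishing near 0 (and, as a normalisation, off the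
  interval). A distribution \<open>d(t,s)\<close> of the class considered here is, for every fixed \<open>t\<close>,
  a distribution in \<open>s\<close> supported in \<open>s \<le> t\<close>; it is represented by the map
  \<open>\<phi> \<mapsto> (t \<mapsto> \<integral> d(t,s) \<phi>(s) ds)\<close>. Being smooth in \<open>t\<close> and again vanishing near 0, the result is
  itself a test function. Test functions need not vanish near 1: because of the support property
  this makes no difference to which distributions are equal, and it is
  what makes iterated pairings meaningful. Vanishing near 0 means that no
  boundary terms at 0 occur, so that, e.g., the derivative of the delta distribution is a
  two-sided inverse of the Heaviside function. To make equality of distributions
  the equality of HOL, the map is set to 0 outside the test functions and for \<open>t\<close> off the interval.\<close>

definition test_fun :: "(real \<Rightarrow> complex) \<Rightarrow> bool" where
  "test_fun \<phi> \<longleftrightarrow> (\<forall>n. nderiv n \<phi> differentiable_on I01) \<and> (\<exists>\<epsilon>>0. \<forall>t. t \<notin> {\<epsilon>..1} \<longrightarrow> \<phi> t = 0)"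

type_synonym dist = "(real \<Rightarrow> complex) \<Rightarrow> real \<Rightarrow> complex"

text \<open>\<open>theta_dist f\<close> is \<open>f(t,s) \<Theta>(t-s)\<close>.\<close>

definition theta_dist :: "(real \<Rightarrow> real \<Rightarrow> complex) \<Rightarrow> dist" where
  "theta_dist f = (\<lambda>\<phi> t. if test_fun \<phi> \<and> t \<in> I01
     then integral I01 (\<lambda>s. f t s * of_real (Heaviside (t - s)) * \<phi> s) else 0)"

text \<open>\<open>delta_dist i f\<close> is \<open>f(t,s) \<delta>^(i)(t-s)\<close>. There is no sign: in the variable \<open>s\<close> the \<open>i\<close>-th
  derivative of \<open>\<delta>\<close>, taken at \<open>t-s\<close>, is \<open>(-\<partial>\<^sub>s)\<^sup>i \<delta>(t-s)\<close>, and the sign cancels against the one from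
  moving the derivatives to \<open>f(t,s) \<phi>(s)\<close>.\<close>

definition delta_dist :: "nat \<Rightarrow> (real \<Rightarrow> real \<Rightarrow> complex) \<Rightarrow> dist" where
  "delta_dist i f = (\<lambda>\<phi> t. if test_fun \<phi> \<and> t \<in> I01
     then nderiv i (\<lambda>s. f t s * \<phi> s) t else 0)"

definition DI :: "dist set" where
  "DI = {theta_dist f + (\<Sum>i\<le>k. delta_dist i (g i)) | f k g.
           analytic_II f \<and> (\<forall>i\<le>k. analytic_II (g i))}"

text \<open>The pairing of \<open>\<integral> f\<^sub>2(t,\<tau>) f\<^sub>1(\<tau>,s) d\<tau>\<close> with \<open>\<phi>(s)\<close> is \<open>\<integral> f\<^sub>2(t,\<tau>) (\<integral> f\<^sub>1(\<tau>,s) \<phi>(s) ds) d\<tau>\<close>.\<close>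

definition star :: "dist \<Rightarrow> dist \<Rightarrow> dist" where
  "star f2 f1 = (\<lambda>\<phi>. f2 (f1 \<phi>))"

definition one_star :: dist where
  "one_star = delta_dist 0 (\<lambda>t s. 1)"

definition mtheta :: "(real \<Rightarrow> real \<Rightarrow> complex^'n^'n) \<Rightarrow> dist^'n^'n" where
  "mtheta M = (\<chi> i j. theta_dist (\<lambda>t s. M t s $ i $ j))"

definition mone_star :: "dist^'n^'n" where
  "mone_star = (\<chi> i j. if i = j then one_star else 0)"

definition mstar :: "dist^'n^'n \<Rightarrow> dist^'n^'n \<Rightarrow> dist^'n^'n" (infixr "\<star>" 70) where
  "X \<star> Y = (\<chi> i j. \<Sum>k\<in>UNIV. star (X $ i $ k) (Y $ k $ j))"

definition smstar :: "dist \<Rightarrow> dist^'n^'n \<Rightarrow> dist^'n^'n" where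
  "smstar g X = (\<chi> i j. star g (X $ i $ j))"

primrec mstar_pow :: "dist^'n^'n \<Rightarrow> nat \<Rightarrow> dist^'n^'n" where
  "mstar_pow X 0 = mone_star"
| "mstar_pow X (Suc k) = X \<star> mstar_pow X k"

definition is_star_inverse :: "dist^'n^'n \<Rightarrow> dist^'n^'n \<Rightarrow> bool" where
  "is_star_inverse X Y \<longleftrightarrow> (\<forall>i j. Y $ i $ j \<in> DI) \<and> X \<star> Y = mone_star \<and> Y \<star> X = mone_star"

definition star_inv :: "dist^'n^'n \<Rightarrow> dist^'n^'n" where
  "star_inv X = (THE Y. is_star_inverse X Y)"

text \<open>The series in the definition of the resolvent is summed in the sense of distributions; uniform
  convergence of its terms as functions is a separate assertion.\<close>

definition star_resolvent :: "dist^'n^'n \<Rightarrow> dist^'n^'n" where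
  "star_resolvent X = mone_star + (\<chi> i j. (\<lambda>\<phi> t. \<Sum>k. (mstar_pow X (Suc k) $ i $ j) \<phi> t))"

end

theory Submission
  imports Defs
begin

text \<open>
  Write \<open>W(t,s)\<close> for the propagator of the homogeneous equation: the solution of
  \<open>\<partial>\<^sub>t W(t,s) = A(t) W(t,s)\<close> with \<open>W(s,s) = I\<close>. Convolving a kernel with \<open>A(t) \<Theta>(t-s)\<close> from the left
  means to integrate it in \<open>t\<close> from \<open>s\<close> and to multiply by \<open>A(t)\<close>. So if \<open>w\<^sub>0 = I\<close> and
  \<open>\<partial>\<^sub>t w\<^sub>k\<^sub>+\<^sub>1 = A w\<^sub>k\<close> with \<open>w\<^sub>k\<^sub>+\<^sub>1(s,s) = 0\<close>, the star-powers of \<open>A\<close> have the kernels \<open>A(t) w\<^sub>k(t,s)\<close>,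
  \<open>k \<ge> 0\<close> (\<open>star_power\<close>), and their sum has the kernel \<open>S = A(t) W(t,s)\<close>, the Picard series of \<open>W\<close>. The two
  equations \<open>A \<star> S = S - A\<close> and \<open>S \<star> A = S - A\<close> are the two differential equations
  \<open>\<partial>\<^sub>t W = A W\<close> and \<open>\<partial>\<^sub>s W = - W A\<close> in integrated form (\<open>star_kernel_left\<close>, \<open>star_kernel_right\<close>), and they say
  that \<open>I + S\<close> inverts \<open>I - A\<close>. Finally \<open>V = (I + S) \<star> (I + B)\<close> satisfies \<open>V = I + B + A \<star> V\<close>, and its
  primitive \<open>\<Theta> \<star> V\<close>, paired with a test function, satisfies the same linear initial value problem as the
  pairing with \<open>U\<close>; uniqueness gives \<open>U = \<Theta> \<star> V\<close> (\<open>solution_eq_star_product\<close>).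

  The analytic part is to show that the kernels built from \<open>A\<close> are analytic on the whole closed square. This
  is reduced to one variable: with \<open>\<Phi>' = A \<Phi>\<close>, \<open>\<Psi>' = - \<Psi> A\<close> and \<open>\<Phi>(0) = \<Psi>(0) = I\<close> one has
  \<open>\<Psi> = \<Phi>\<^sup>-\<^sup>1\<close> and \<open>W(t,s) = \<Phi>(t) \<Psi>(s)\<close>; and if \<open>p\<^sub>j\<close>, \<open>q\<^sub>j\<close> are the Picard iterates of \<open>\<Phi>\<close> and \<open>\<Psi>\<close>, then
  \<open>w\<^sub>k(t,s) = \<Sum>\<^sub>j p\<^sub>j(t) q\<^sub>k\<^sub>-\<^sub>j(s)\<close>. The iterates are analytic as repeated primitives of analytic
  functions, and their bounds \<open>C M\<^sup>j / j!\<close> make the series of kernels converge uniformly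
  (\<open>uniform_convergence\<close>). The limits \<open>\<Phi>\<close> and \<open>\<Psi>\<close> are analytic because a linear equation
  with analytic coefficients has a local power series solution, which agrees with the given one by uniqueness (\<open>analytic_solution\<close>).

  The star-product of distributions is composition of maps on test functions, so its algebra needs that
  kernels with analytic coefficients map test functions to test functions (\<open>test_fun_theta_dist\<close>); for
  this the derivative in \<open>t\<close> of an analytic function of two variables has to be analytic again
  (\<open>analytic_II_deriv\<close>).
\<close>

section \<open>Integrals with variable upper limit\<close>

text \<open>
  The chain rule along the diagonal needs continuity of only one of the two partial derivatives. Both the
  Leibniz rule and the smoothness of analytic kernels on the diagonal come from it.
\<close>

lemma diagonal_derivative:
  fixes h :: "real \<Rightarrow> real \<Rightarrow> 'a::real_normed_vector"
  assumes d: "((\<lambda>x. h x t) has_vector_derivative d) (at t within I01)"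
    and D: "\<And>x y. x \<in> I01 \<Longrightarrow> y \<in> I01 \<Longrightarrow> (h x has_vector_derivative D x y) (at y within I01)"
    and cont: "continuous_on (I01 \<times> I01) (\<lambda>(x, y). D x y)"
    and t: "t \<in> I01"
  shows "((\<lambda>x. h x x) has_vector_derivative (d + D t t)) (at t within I01)"
proof -
  have c: "continuous_on (I01 \<times> I01) (\<lambda>(x, y). blinfun_scaleR_left (D x y))"
    using cont by (auto simp: case_prod_unfold intro!: continuous_intros)
  have "((\<lambda>(x, y). h x y) has_derivative
      (\<lambda>(tx, ty). tx *\<^sub>R d + blinfun_apply (blinfun_scaleR_left (D t t)) ty)) (at (t, t) within I01 \<times> I01)"
    by (rule has_derivative_partialsI[where fy = "\<lambda>x y. blinfun_scaleR_left (D x y)"])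
       (use d D t c in \<open>auto simp: has_vector_derivative_def continuous_on_eq_continuous_within\<close>)
  then have "((\<lambda>(x, y). h x y) has_derivative
      (\<lambda>(tx, ty). tx *\<^sub>R d + blinfun_apply (blinfun_scaleR_left (D t t)) ty))
        (at (t, t) within (\<lambda>x. (x, x)) ` I01)"
    by (rule has_derivative_subset) auto
  from has_derivative_in_compose[OF _ this, of "\<lambda>x. (x, x)"]
  have "((\<lambda>x. (\<lambda>(x, y). h x y) (x, x)) has_derivative
     (\<lambda>x. (\<lambda>(tx, ty). tx *\<^sub>R d + blinfun_apply (blinfun_scaleR_left (D t t)) ty) (x, x))) (at t within I01)"
    by (simp add: has_derivative_Pair)
  then show ?thesis
    by (simp add: has_vector_derivative_def scaleR_add_right)
qed

lemma slice_continuous: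
  assumes "continuous_on (I01 \<times> I01) (\<lambda>(t, s). f t s)" "t \<in> I01"
  shows "continuous_on I01 (f t)"
proof -
  have "continuous_on I01 (\<lambda>s. (\<lambda>(t, s). f t s) (t, s))"
    by (rule continuous_on_compose2[OF assms(1)]) (use assms(2) in \<open>auto intro!: continuous_intros\<close>)
  then show ?thesis by simp
qed

text \<open>
  The integral is the diagonal of \<open>(x, y) \<mapsto> \<integral>\<^sub>0\<^sup>y F(x,s) ds\<close>, whose partial derivatives are known from
  the rule for a fixed interval and from the fundamental theorem.
\<close>

lemma leibniz_triangle:
  fixes F :: "real \<Rightarrow> real \<Rightarrow> 'a::banach"
  assumes der: "\<And>t s. t \<in> I01 \<Longrightarrow> s \<in> I01 \<Longrightarrow> ((\<lambda>x. F x s) has_vector_derivative F1 t s) (at t within I01)"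
    and cF: "continuous_on (I01 \<times> I01) (\<lambda>(t, s). F t s)"
    and cF1: "continuous_on (I01 \<times> I01) (\<lambda>(t, s). F1 t s)"
    and t: "t \<in> I01"
  shows "((\<lambda>t. integral {0..t} (F t)) has_vector_derivative
           (F t t + integral {0..t} (F1 t))) (at t within I01)"
proof -
  have slice: "continuous_on I01 (F x)" if "x \<in> I01" for x
    using slice_continuous[OF cF that] .
  have "((\<lambda>x. (\<lambda>x y. integral {0..y} (F x)) x x) has_vector_derivative
           (integral {0..t} (F1 t) + F t t)) (at t within I01)"
  proof (rule diagonal_derivative[where h = "\<lambda>x y. integral {0..y} (F x)" and D = F])
    have "((\<lambda>x. integral (cbox 0 t) (F x)) has_vector_derivative integral (cbox 0 t) (F1 t)) (at t within I01)"
    proof (rule leibniz_rule_vector_derivative)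
      show "continuous_on (I01 \<times> cbox 0 t) (\<lambda>(x, t). F1 x t)"
        using t by (auto intro: continuous_on_subset[OF cF1])
      show "F x integrable_on cbox 0 t" if "x \<in> I01" for x
        using t that slice[OF that]
        by (intro integrable_continuous) (auto elim: continuous_on_subset)
    qed (use t der in auto)
    then show "((\<lambda>x. integral {0..t} (F x)) has_vector_derivative integral {0..t} (F1 t)) (at t within I01)"
      by simp
    show "((\<lambda>y. integral {0..y} (F x)) has_vector_derivative F x y) (at y within I01)"
      if "x \<in> I01" "y \<in> I01" for x y
      using integral_has_vector_derivative[OF slice[OF that(1)] that(2)] .
  qed (use cF t in auto)
  then show ?thesis by (simp add: add.commute)
qed

lemma zero_derivative_constant:
  fixes f :: "real \<Rightarrow> 'a::real_normed_vector"
  assumes "\<And>x. x \<in> {a..b} \<Longrightarrow> (f has_vector_derivative 0) (at x within {a..b})"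
    and "x \<in> {a..b}" "y \<in> {a..b}"
  shows "f x = f y"
  using has_derivative_zero_constant[of "{a..b}" f] assms
  by (fastforce simp: has_vector_derivative_def)

lemma primitive_I01:
  fixes f :: "real \<Rightarrow> 'a::banach"
  assumes "\<And>t. t \<in> I01 \<Longrightarrow> (F has_vector_derivative f t) (at t within I01)" "t \<in> I01"
  shows "integral {0..t} f = F t - F 0"
proof -
  have "(f has_integral F t - F 0) {0..t}"
  proof (rule fundamental_theorem_of_calculus)
    show "(F has_vector_derivative f x) (at x within {0..t})" if "x \<in> {0..t}" for x
      using assms(1)[of x] assms(2) that by (auto elim: has_vector_derivative_within_subset)
  qed (use assms(2) in simp)
  then show ?thesis by (rule integral_unique)
qed

section \<open>Smoothness on the unit interval\<close>

text \<open>
  A derivative is exhibited at each stage; compared with iterating a chosen derivative this makes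
  inductions on \<open>k\<close> free of side conditions about points off the interval.
\<close>

primrec Ck :: "nat \<Rightarrow> (real \<Rightarrow> complex) \<Rightarrow> bool" where
  "Ck 0 f \<longleftrightarrow> True"
| "Ck (Suc k) f \<longleftrightarrow> (\<exists>f'. (\<forall>t\<in>I01. (f has_vector_derivative f' t) (at t within I01)) \<and> Ck k f')"

lemma Ck_SucI:
  assumes "\<And>t. t \<in> I01 \<Longrightarrow> (f has_vector_derivative f' t) (at t within I01)" "Ck k f'"
  shows "Ck (Suc k) f"
  using assms by (simp only: Ck.simps) blast

lemma Ck_cong:
  assumes *: "\<And>t. t \<in> I01 \<Longrightarrow> f t = g t" "Ck k f"
  shows "Ck k g"
proof (cases k)
  case (Suc n)
  with *(2) obtain f' where f': "\<And>t. t \<in> I01 \<Longrightarrow> (f has_vector_derivative f' t) (at t within I01)" "Ck n f'"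
    unfolding Suc Ck.simps by blast
  have "(g has_vector_derivative f' t) (at t within I01)" if "t \<in> I01" for t
    using has_vector_derivative_transform[OF that _ f'(1)[OF that], of g] *(1) by simp
  with f'(2) show ?thesis unfolding Suc by (blast intro: Ck_SucI)
qed simp

lemma Ck_Suc_imp: "Ck (Suc k) f \<Longrightarrow> Ck k f"
  by (induction k arbitrary: f) (simp, metis Ck.simps(2))

lemma Ck_add: "Ck k f \<Longrightarrow> Ck k g \<Longrightarrow> Ck k (\<lambda>t. f t + g t)"
proof (induction k arbitrary: f g)
  case (Suc k)
  then obtain f' g' where
    "\<forall>t\<in>I01. (f has_vector_derivative f' t) (at t within I01)" "Ck k f'"
    "\<forall>t\<in>I01. (g has_vector_derivative g' t) (at t within I01)" "Ck k g'"
    by auto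
  then show ?case
    by (intro Ck_SucI[where f' = "\<lambda>t. f' t + g' t"] Suc.IH) (auto intro!: derivative_intros)
qed simp

lemma Ck_mult: "Ck k f \<Longrightarrow> Ck k g \<Longrightarrow> Ck k (\<lambda>t. f t * g t)"
proof (induction k arbitrary: f g)
  case (Suc k)
  then obtain f' g' where *:
    "\<forall>t\<in>I01. (f has_vector_derivative f' t) (at t within I01)" "Ck k f'"
    "\<forall>t\<in>I01. (g has_vector_derivative g' t) (at t within I01)" "Ck k g'"
    by auto
  show ?case
    using * Suc.prems
    by (intro Ck_SucI[where f' = "\<lambda>t. f t * g' t + f' t * g t"] Ck_add Suc.IH)
       (auto intro!: has_vector_derivative_mult Ck_Suc_imp simp del: Ck.simps)
qed simp

lemma Ck_const: "Ck k (\<lambda>_. c)"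
proof (induction k arbitrary: c)
  case (Suc k)
  then show ?case by (intro Ck_SucI[where f' = "\<lambda>_. 0"]) (auto intro!: derivative_intros)
qed simp

definition smooth :: "(real \<Rightarrow> complex) \<Rightarrow> bool" where
  "smooth f \<longleftrightarrow> (\<forall>k. Ck k f)"

lemma smooth_add: "smooth f \<Longrightarrow> smooth g \<Longrightarrow> smooth (\<lambda>t. f t + g t)"
  and smooth_mult: "smooth f \<Longrightarrow> smooth g \<Longrightarrow> smooth (\<lambda>t. f t * g t)"
  and smooth_const: "smooth (\<lambda>_. c)"
  by (auto simp: smooth_def intro: Ck_add Ck_mult Ck_const)

definition deriv_I :: "(real \<Rightarrow> complex) \<Rightarrow> real \<Rightarrow> complex" where
  "deriv_I f t = vector_derivative f (at t within I01)"

lemma deriv_I_eq: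
  "(f has_vector_derivative f') (at t within I01) \<Longrightarrow> t \<in> I01 \<Longrightarrow> deriv_I f t = f'"
  unfolding deriv_I_def by (rule vector_derivative_within_closed_interval) auto

lemma nderiv_0: "nderiv 0 f = f"
  by (simp add: nderiv_def)

lemma nderiv_Suc: "nderiv (Suc n) f = nderiv n (deriv_I f)"
  unfolding nderiv_def deriv_I_def[abs_def] by (subst funpow_Suc_right) (simp add: o_def)

lemma smooth_deriv_I:
  assumes "smooth f"
  shows "t \<in> I01 \<Longrightarrow> (f has_vector_derivative deriv_I f t) (at t within I01)"
    and "smooth (deriv_I f)"
proof -
  have "Ck (Suc 0) f" using assms by (auto simp: smooth_def)
  then show D: "(f has_vector_derivative deriv_I f t) (at t within I01)" if "t \<in> I01" for t
    using that by (metis Ck.simps(2) deriv_I_eq)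
  have "Ck k (deriv_I f)" for k
  proof -
    have "Ck (Suc k) f" using assms by (simp add: smooth_def del: Ck.simps)
    then obtain f' where "\<forall>t\<in>I01. (f has_vector_derivative f' t) (at t within I01)" "Ck k f'"
      by auto
    then show ?thesis by (metis Ck_cong deriv_I_eq)
  qed
  then show "smooth (deriv_I f)" by (simp add: smooth_def)
qed

lemma smooth_continuous_on: "smooth f \<Longrightarrow> continuous_on I01 f"
  by (rule continuous_on_vector_derivative) (rule smooth_deriv_I)

lemma deriv_I_cong: "(\<And>t. t \<in> I01 \<Longrightarrow> f t = g t) \<Longrightarrow> t \<in> I01 \<Longrightarrow> deriv_I f t = deriv_I g t"
proof -
  assume *: "\<And>t. t \<in> I01 \<Longrightarrow> f t = g t" "t \<in> I01"
  then have "(f has_vector_derivative d) (at t within I01) \<longleftrightarrow> (g has_vector_derivative d) (at t within I01)" for d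
    by (metis has_vector_derivative_transform)
  then show ?thesis by (simp add: deriv_I_def vector_derivative_def)
qed

lemma nderiv_cong: "(\<And>t. t \<in> I01 \<Longrightarrow> f t = g t) \<Longrightarrow> t \<in> I01 \<Longrightarrow> nderiv n f t = nderiv n g t"
proof (induction n arbitrary: f g)
  case (Suc n)
  then show ?case by (metis nderiv_Suc deriv_I_cong)
qed (simp add: nderiv_0)

lemma nderiv_add:
  "smooth f \<Longrightarrow> smooth g \<Longrightarrow> t \<in> I01 \<Longrightarrow> nderiv n (\<lambda>t. f t + g t) t = nderiv n f t + nderiv n g t"
proof (induction n arbitrary: f g)
  case (Suc n)
  have "nderiv n (deriv_I (\<lambda>t. f t + g t)) t = nderiv n (\<lambda>t. deriv_I f t + deriv_I g t) t"
    using Suc.prems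
    by (intro nderiv_cong) (auto intro!: deriv_I_eq derivative_intros smooth_deriv_I)
  then show ?case
    using Suc smooth_deriv_I(2) by (simp add: nderiv_Suc)
qed (simp add: nderiv_0)

text \<open>
  This translates the smoothness required of test functions into \<open>Ck\<close>.
\<close>

lemma nderiv_differentiable_iff: "(\<forall>n. nderiv n f differentiable_on I01) \<longleftrightarrow> smooth f"
proof
  assume "smooth f"
  have "nderiv n f differentiable_on I01" for n
    using \<open>smooth f\<close>
  proof (induction n arbitrary: f)
    case 0
    then show ?case
      using smooth_deriv_I(1)
      by (fastforce simp: nderiv_0 differentiable_on_def has_vector_derivative_def differentiable_def)
  next
    case (Suc n)
    then show ?case by (simp add: nderiv_Suc smooth_deriv_I)
  qed
  then show "\<forall>n. nderiv n f differentiable_on I01" by simp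
next
  assume A: "\<forall>n. nderiv n f differentiable_on I01"
  have "Ck k f" if "\<forall>n. nderiv n f differentiable_on I01" for k f
    using that
  proof (induction k arbitrary: f)
    case (Suc k)
    have "f differentiable_on I01" using spec[OF Suc.prems, of 0] by (simp add: nderiv_0)
    then have "(f has_vector_derivative deriv_I f t) (at t within I01)" if "t \<in> I01" for t
      using that unfolding deriv_I_def
      by (metis differentiable_on_def vector_derivative_works)
    moreover have "Ck k (deriv_I f)"
      using Suc.prems by (intro Suc.IH) (metis nderiv_Suc)
    ultimately show ?case by (intro Ck_SucI[where f' = "deriv_I f"])
  qed simp
  with A show "smooth f" by (simp add: smooth_def)
qed

lemma test_fun_iff:
  "test_fun \<phi> \<longleftrightarrow> smooth \<phi> \<and> (\<exists>\<epsilon>>0. \<forall>t. t \<notin> {\<epsilon>..1} \<longrightarrow> \<phi> t = 0)"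
  by (simp add: test_fun_def nderiv_differentiable_iff)

lemma test_fun_add: "test_fun \<phi> \<Longrightarrow> test_fun \<psi> \<Longrightarrow> test_fun (\<phi> + \<psi>)"
proof -
  assume "test_fun \<phi>" "test_fun \<psi>"
  then obtain e1 e2 where e: "e1 > 0" "\<forall>t. t \<notin> {e1..1} \<longrightarrow> \<phi> t = 0" "e2 > 0" "\<forall>t. t \<notin> {e2..1} \<longrightarrow> \<psi> t = 0"
    and "smooth \<phi>" "smooth \<psi>"
    by (auto simp: test_fun_iff)
  then have "smooth (\<phi> + \<psi>)" unfolding plus_fun_def by (intro smooth_add)
  moreover have "\<forall>t. t \<notin> {min e1 e2..1} \<longrightarrow> (\<phi> + \<psi>) t = 0" using e by auto
  ultimately show ?thesis using e unfolding test_fun_iff by (metis min_less_iff_conj)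
qed

lemma test_fun_zero: "test_fun 0"
  using smooth_const[of 0] by (auto simp: test_fun_iff zero_fun_def intro: exI[of _ 1])

lemma test_fun_uminus: "test_fun \<phi> \<Longrightarrow> test_fun (- \<phi>)"
  using smooth_mult[OF smooth_const[of "-1"], of \<phi>] by (auto simp: test_fun_iff fun_Compl_def)

section \<open>Analytic functions of one and two variables\<close>

text \<open>
  Convergence at a single point at distance \<open>h\<close> from the centre already gives absolute convergence at all
  smaller distances; as the interval has length 1, such a point exists on one side of any centre whenever
  \<open>h \<le> 1/2\<close>. This is what handles the end points.
\<close>

lemma analytic_I_germ:
  assumes "analytic_I f" "t0 \<in> I01"
  obtains r c where "0 < r" "\<And>x::real. \<bar>x\<bar> \<le> r \<Longrightarrow> summable (\<lambda>n. norm (c n * of_real (x ^ n)))"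
    "\<And>t. t \<in> I01 \<Longrightarrow> \<bar>t - t0\<bar> \<le> r \<Longrightarrow> (\<lambda>n. c n * of_real ((t - t0) ^ n)) sums f t"
proof -
  obtain R c where R: "R > 0" and c:
    "\<And>t. t \<in> I01 \<Longrightarrow> \<bar>t - t0\<bar> < R \<Longrightarrow> (\<lambda>n. c n * of_real ((t - t0) ^ n)) sums f t"
    using assms unfolding analytic_I_def by meson
  define h where "h = min (R / 2) (1 / 2)"
  define t1 where "t1 = (if t0 \<le> 1/2 then t0 + h else t0 - h)"
  have t1: "t1 \<in> I01" "\<bar>t1 - t0\<bar> = h" "h < R" "h > 0"
    using R assms(2) by (auto simp: t1_def h_def)
  then have "summable (\<lambda>n. c n * of_real (t1 - t0) ^ n)"
    using c[of t1] by (auto simp: sums_iff of_real_power)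
  then have "summable (\<lambda>n. norm (c n * z ^ n))" if "norm z < h" for z
    using powser_insidea that t1 by (metis norm_of_real)
  from this[of "of_real x" for x :: real] have "summable (\<lambda>n. norm (c n * of_real (x ^ n)))" if "\<bar>x\<bar> \<le> h / 2" for x :: real
    using that t1 by simp
  then show thesis
    using t1 c by (intro that[of "h / 2" c]) auto
qed

text \<open>
  As in one variable, but a family indexed by pairs is summable only if it is absolutely summable, so no radius is lost.
\<close>

lemma analytic_II_germ:
  assumes "analytic_II f" "t0 \<in> I01" "s0 \<in> I01"
  obtains r c where "0 < r" "(\<lambda>(m, n). norm (c m n) * r ^ m * r ^ n) summable_on UNIV"
    "\<And>t s. t \<in> I01 \<Longrightarrow> s \<in> I01 \<Longrightarrow> \<bar>t - t0\<bar> \<le> r \<Longrightarrow> \<bar>s - s0\<bar> \<le> r \<Longrightarrow>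
       ((\<lambda>(m, n). c m n * of_real ((t - t0) ^ m * (s - s0) ^ n)) has_sum f t s) UNIV"
proof -
  obtain R c where R: "R > 0" and c:
    "\<And>t s. t \<in> I01 \<Longrightarrow> s \<in> I01 \<Longrightarrow> \<bar>t - t0\<bar> < R \<Longrightarrow> \<bar>s - s0\<bar> < R \<Longrightarrow>
      ((\<lambda>(m, n). c m n * of_real ((t - t0) ^ m * (s - s0) ^ n)) has_sum f t s) UNIV"
    using assms unfolding analytic_II_def by meson
  define h where "h = min (R / 2) (1 / 2)"
  define t1 where "t1 = (if t0 \<le> 1/2 then t0 + h else t0 - h)"
  define s1 where "s1 = (if s0 \<le> 1/2 then s0 + h else s0 - h)"
  have 1: "t1 \<in> I01" "\<bar>t1 - t0\<bar> = h" "s1 \<in> I01" "\<bar>s1 - s0\<bar> = h" "h < R" "h > 0"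
    using R assms(2,3) by (auto simp: t1_def s1_def h_def)
  then have "(\<lambda>(m, n). c m n * of_real ((t1 - t0) ^ m * (s1 - s0) ^ n)) summable_on UNIV"
    using c[of t1 s1] by (auto simp: summable_on_def)
  then have "(\<lambda>p. norm (case p of (m, n) \<Rightarrow> c m n * of_real ((t1 - t0) ^ m * (s1 - s0) ^ n))) summable_on UNIV"
    by (simp add: summable_on_iff_abs_summable_on_complex)
  also have "(\<lambda>p. norm (case p of (m, n) \<Rightarrow> c m n * of_real ((t1 - t0) ^ m * (s1 - s0) ^ n)))
      = (\<lambda>(m, n). norm (c m n) * h ^ m * h ^ n)"
    using 1 by (auto simp: fun_eq_iff norm_mult norm_power abs_mult power_abs simp flip: of_real_diff)
  finally show thesis
    using 1 c by (intro that[of h c]) auto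
qed

lemma analytic_II_swap: "analytic_II f \<Longrightarrow> analytic_II (\<lambda>s t. f t s)"
  unfolding analytic_II_def
proof (intro ballI)
  fix t0 s0 assume *: "\<forall>t0\<in>I01. \<forall>s0\<in>I01. \<exists>r>0. \<exists>c :: nat \<Rightarrow> nat \<Rightarrow> complex.
     \<forall>t\<in>I01. \<forall>s\<in>I01. \<bar>t - t0\<bar> < r \<longrightarrow> \<bar>s - s0\<bar> < r \<longrightarrow>
       ((\<lambda>(m, n). c m n * of_real ((t - t0) ^ m * (s - s0) ^ n)) has_sum f t s) UNIV"
    and "t0 \<in> I01" "s0 \<in> I01"
  then obtain r c where r: "r > 0" and c: "\<And>t s. t \<in> I01 \<Longrightarrow> s \<in> I01 \<Longrightarrow> \<bar>t - s0\<bar> < r \<Longrightarrow> \<bar>s - t0\<bar> < r \<Longrightarrow>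
       ((\<lambda>(m, n). c m n * of_real ((t - s0) ^ m * (s - t0) ^ n)) has_sum f t s) UNIV"
    by meson
  have "((\<lambda>(m, n). c n m * of_real ((s - t0) ^ m * (t - s0) ^ n)) has_sum f t s) UNIV"
    if "t \<in> I01" "s \<in> I01" "\<bar>t - s0\<bar> < r" "\<bar>s - t0\<bar> < r" for t s
    using has_sum_swap[of "\<lambda>(m, n). c m n * of_real ((t - s0) ^ m * (s - t0) ^ n)" UNIV UNIV "f t s"] c[OF that]
    by (simp add: mult.commute[of "(s - t0) ^ _"] case_prod_unfold)
  with r show "\<exists>r>0. \<exists>c :: nat \<Rightarrow> nat \<Rightarrow> complex.
     \<forall>t\<in>I01. \<forall>s\<in>I01. \<bar>t - t0\<bar> < r \<longrightarrow> \<bar>s - s0\<bar> < r \<longrightarrow>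
       ((\<lambda>(m, n). c m n * of_real ((t - t0) ^ m * (s - s0) ^ n)) has_sum f s t) UNIV"
    by (intro exI[of _ r] conjI exI[of _ "\<lambda>m n. c n m"]) auto
qed

lemma analytic_II_add:
  assumes "analytic_II f" "analytic_II g"
  shows "analytic_II (\<lambda>t s. f t s + g t s)"
  unfolding analytic_II_def
proof (intro ballI)
  fix t0 s0 assume 0: "t0 \<in> I01" "s0 \<in> I01"
  obtain r1 c1 where 1: "r1 > 0" "\<And>t s. t \<in> I01 \<Longrightarrow> s \<in> I01 \<Longrightarrow> \<bar>t - t0\<bar> < r1 \<Longrightarrow> \<bar>s - s0\<bar> < r1 \<Longrightarrow>
       ((\<lambda>(m, n). c1 m n * of_real ((t - t0) ^ m * (s - s0) ^ n)) has_sum f t s) UNIV"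
    using assms(1) 0 unfolding analytic_II_def by meson
  obtain r2 c2 where 2: "r2 > 0" "\<And>t s. t \<in> I01 \<Longrightarrow> s \<in> I01 \<Longrightarrow> \<bar>t - t0\<bar> < r2 \<Longrightarrow> \<bar>s - s0\<bar> < r2 \<Longrightarrow>
       ((\<lambda>(m, n). c2 m n * of_real ((t - t0) ^ m * (s - s0) ^ n)) has_sum g t s) UNIV"
    using assms(2) 0 unfolding analytic_II_def by meson
  have "((\<lambda>(m, n). (c1 m n + c2 m n) * of_real ((t - t0) ^ m * (s - s0) ^ n)) has_sum (f t s + g t s)) UNIV"
    if "t \<in> I01" "s \<in> I01" "\<bar>t - t0\<bar> < min r1 r2" "\<bar>s - s0\<bar> < min r1 r2" for t s
    using has_sum_add[OF 1(2)[of t s] 2(2)[of t s]] that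
    by (simp add: case_prod_unfold distrib_right)
  with 1(1) 2(1) show "\<exists>r>0. \<exists>c. \<forall>t\<in>I01. \<forall>s\<in>I01. \<bar>t - t0\<bar> < r \<longrightarrow> \<bar>s - s0\<bar> < r \<longrightarrow>
       ((\<lambda>(m, n). c m n * of_real ((t - t0) ^ m * (s - s0) ^ n)) has_sum f t s + g t s) UNIV"
    by (intro exI[of _ "min r1 r2"] conjI exI[of _ "\<lambda>m n. c1 m n + c2 m n"]) auto
qed

text \<open>
  All kernels arising from \<open>A\<close> below are finite sums of such products, so that analyticity in two
  variables has to be checked by hand only for these.
\<close>

lemma analytic_II_tensor:
  assumes "analytic_I f" "analytic_I g"
  shows "analytic_II (\<lambda>t s. f t * g s)"
  unfolding analytic_II_def
proof (intro ballI)
  fix t0 s0 assume 0: "t0 \<in> I01" "s0 \<in> I01"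
  obtain r1 c1 where 1: "0 < r1" "\<And>x::real. \<bar>x\<bar> \<le> r1 \<Longrightarrow> summable (\<lambda>n. norm (c1 n * of_real (x ^ n)))"
    "\<And>t. t \<in> I01 \<Longrightarrow> \<bar>t - t0\<bar> \<le> r1 \<Longrightarrow> (\<lambda>n. c1 n * of_real ((t - t0) ^ n)) sums f t"
    by (rule analytic_I_germ[OF assms(1) 0(1)]; rule that; assumption)
  obtain r2 c2 where 2: "0 < r2" "\<And>x::real. \<bar>x\<bar> \<le> r2 \<Longrightarrow> summable (\<lambda>n. norm (c2 n * of_real (x ^ n)))"
    "\<And>t. t \<in> I01 \<Longrightarrow> \<bar>t - s0\<bar> \<le> r2 \<Longrightarrow> (\<lambda>n. c2 n * of_real ((t - s0) ^ n)) sums g t"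
    by (rule analytic_I_germ[OF assms(2) 0(2)]; rule that; assumption)
  have "((\<lambda>(m, n). (c1 m * c2 n) * of_real ((t - t0) ^ m * (s - s0) ^ n)) has_sum (f t * g s)) UNIV"
    if "t \<in> I01" "s \<in> I01" "\<bar>t - t0\<bar> < min r1 r2" "\<bar>s - s0\<bar> < min r1 r2" for t s
  proof -
    let ?u = "\<lambda>m. c1 m * of_real ((t - t0) ^ m)" and ?v = "\<lambda>n. c2 n * of_real ((s - s0) ^ n)"
    have "summable (\<lambda>n. norm (?u n))" "summable (\<lambda>n. norm (?v n))" "?u sums f t" "?v sums g s"
      using that by (auto intro!: 1(2,3) 2(2,3) simp del: of_real_power of_real_diff)
    then have u: "(?u has_sum f t) UNIV" "(\<lambda>n. norm (?u n)) summable_on UNIV"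
      and v: "(?v has_sum g s) UNIV" "(\<lambda>n. norm (?v n)) summable_on UNIV"
      by (auto intro: norm_summable_imp_has_sum norm_summable_imp_summable_on simp del: of_real_power of_real_diff)
    have "(\<lambda>p. norm (case p of (m, n) \<Rightarrow> ?u m * ?v n)) summable_on UNIV \<times> UNIV"
    proof (rule summable_on_SigmaI)
      show "((\<lambda>n. norm (case (m, n) of (m, n) \<Rightarrow> ?u m * ?v n)) has_sum norm (?u m) * (\<Sum>\<^sub>\<infinity>n. norm (?v n))) UNIV" for m
        using has_sum_cmult_right[OF has_sum_infsum[OF v(2)], of "norm (?u m)"]
        by (simp only: prod.case norm_mult)
    qed (use u in \<open>auto intro: summable_on_cmult_left simp del: of_real_power of_real_diff\<close>)
    then have "(\<lambda>(m, n). ?u m * ?v n) summable_on UNIV \<times> UNIV"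
      by (rule abs_summable_summable)
    then have "((\<lambda>(m, n). ?u m * ?v n) has_sum (f t * g s)) (UNIV \<times> UNIV)"
      by (intro has_sum_SigmaI[where g = "\<lambda>m. ?u m * g s"])
         (auto intro!: has_sum_cmult_right has_sum_cmult_left u v simp del: of_real_power of_real_diff)
    then show ?thesis by (simp add: mult_ac)
  qed
  with 1(1) 2(1) show "\<exists>r>0. \<exists>c. \<forall>t\<in>I01. \<forall>s\<in>I01. \<bar>t - t0\<bar> < r \<longrightarrow> \<bar>s - s0\<bar> < r \<longrightarrow>
       ((\<lambda>(m, n). c m n * of_real ((t - t0) ^ m * (s - s0) ^ n)) has_sum f t * g s) UNIV"
    by (intro exI[of _ "min r1 r2"] conjI exI[of _ "\<lambda>m n. c1 m * c2 n"]) auto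
qed

lemma analytic_I_const: "analytic_I (\<lambda>_. z)"
  unfolding analytic_I_def
proof (intro ballI)
  fix t0 :: real
  have "(\<lambda>n. (if n = 0 then z else 0) * of_real ((t - t0) ^ n)) sums z" for t
    using sums_single[of 0 "\<lambda>_. z"] by (simp add: if_distrib[of "\<lambda>x. x * _"] cong: if_cong)
  then show "\<exists>r>0. \<exists>c. \<forall>t\<in>I01. \<bar>t - t0\<bar> < r \<longrightarrow> (\<lambda>n. c n * of_real ((t - t0) ^ n)) sums z"
    by (intro exI[of _ "1::real"] conjI exI[of _ "\<lambda>n. if n = 0 then z else 0"]) auto
qed

lemma analytic_I_add:
  assumes "analytic_I f" "analytic_I g"
  shows "analytic_I (\<lambda>t. f t + g t)"
  unfolding analytic_I_def
proof (intro ballI)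
  fix t0 assume 0: "t0 \<in> I01"
  obtain r1 c1 where 1: "r1 > 0" "\<And>t. t \<in> I01 \<Longrightarrow> \<bar>t - t0\<bar> < r1 \<Longrightarrow>
       (\<lambda>n. c1 n * of_real ((t - t0) ^ n)) sums f t"
    using assms(1) 0 unfolding analytic_I_def by meson
  obtain r2 c2 where 2: "r2 > 0" "\<And>t. t \<in> I01 \<Longrightarrow> \<bar>t - t0\<bar> < r2 \<Longrightarrow>
       (\<lambda>n. c2 n * of_real ((t - t0) ^ n)) sums g t"
    using assms(2) 0 unfolding analytic_I_def by meson
  have "(\<lambda>n. (c1 n + c2 n) * of_real ((t - t0) ^ n)) sums (f t + g t)"
    if "t \<in> I01" "\<bar>t - t0\<bar> < min r1 r2" for t
    using sums_add[OF 1(2)[of t] 2(2)[of t]] that by (simp add: distrib_right)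
  with 1(1) 2(1) show "\<exists>r>0. \<exists>c. \<forall>t\<in>I01. \<bar>t - t0\<bar> < r \<longrightarrow>
      (\<lambda>n. c n * of_real ((t - t0) ^ n)) sums (f t + g t)"
    by (intro exI[of _ "min r1 r2"] conjI exI[of _ "\<lambda>n. c1 n + c2 n"]) auto
qed

lemma analytic_I_mult:
  assumes "analytic_I f" "analytic_I g"
  shows "analytic_I (\<lambda>t. f t * g t)"
  unfolding analytic_I_def
proof (intro ballI)
  fix t0 assume 0: "t0 \<in> I01"
  obtain r1 c1 where 1: "0 < r1" "\<And>x::real. \<bar>x\<bar> \<le> r1 \<Longrightarrow> summable (\<lambda>n. norm (c1 n * of_real (x ^ n)))"
    "\<And>t. t \<in> I01 \<Longrightarrow> \<bar>t - t0\<bar> \<le> r1 \<Longrightarrow> (\<lambda>n. c1 n * of_real ((t - t0) ^ n)) sums f t"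
    by (rule analytic_I_germ[OF assms(1) 0]; rule that; assumption)
  obtain r2 c2 where 2: "0 < r2" "\<And>x::real. \<bar>x\<bar> \<le> r2 \<Longrightarrow> summable (\<lambda>n. norm (c2 n * of_real (x ^ n)))"
    "\<And>t. t \<in> I01 \<Longrightarrow> \<bar>t - t0\<bar> \<le> r2 \<Longrightarrow> (\<lambda>n. c2 n * of_real ((t - t0) ^ n)) sums g t"
    by (rule analytic_I_germ[OF assms(2) 0]; rule that; assumption)
  have "(\<lambda>n. (\<Sum>i\<le>n. c1 i * c2 (n - i)) * of_real ((t - t0) ^ n)) sums (f t * g t)"
    if t: "t \<in> I01" "\<bar>t - t0\<bar> < min r1 r2" for t
  proof -
    have "(\<lambda>n. \<Sum>i\<le>n. (c1 i * of_real ((t - t0) ^ i)) * (c2 (n - i) * of_real ((t - t0) ^ (n - i)))) sums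
       ((\<Sum>n. c1 n * of_real ((t - t0) ^ n)) * (\<Sum>n. c2 n * of_real ((t - t0) ^ n)))"
      using t by (intro Cauchy_product_sums 1 2) auto
    moreover have "(\<Sum>i\<le>n. (c1 i * of_real ((t - t0) ^ i)) * (c2 (n - i) * of_real ((t - t0) ^ (n - i))))
        = (\<Sum>i\<le>n. c1 i * c2 (n - i)) * of_real ((t - t0) ^ n)" for n
      unfolding sum_distrib_right
    proof (rule sum.cong)
      fix i assume "i \<in> {..n}"
      then have "(t - t0) ^ n = (t - t0) ^ i * (t - t0) ^ (n - i)"
        by (simp flip: power_add)
      then show "(c1 i * of_real ((t - t0) ^ i)) * (c2 (n - i) * of_real ((t - t0) ^ (n - i)))
        = c1 i * c2 (n - i) * of_real ((t - t0) ^ n)" by (simp add: mult_ac)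
    qed simp
    ultimately show ?thesis using 1(3)[of t] 2(3)[of t] t by (simp add: sums_iff)
  qed
  with 1(1) 2(1) show "\<exists>r>0. \<exists>c. \<forall>t\<in>I01. \<bar>t - t0\<bar> < r \<longrightarrow>
      (\<lambda>n. c n * of_real ((t - t0) ^ n)) sums (f t * g t)"
    by (intro exI[of _ "min r1 r2"] conjI exI[of _ "\<lambda>n. \<Sum>i\<le>n. c1 i * c2 (n - i)"]) auto
qed

lemma analytic_I_sum: "(\<And>i. i \<in> I \<Longrightarrow> analytic_I (f i)) \<Longrightarrow> analytic_I (\<lambda>t. \<Sum>i\<in>I. f i t)"
  by (induction I rule: infinite_finite_induct) (auto intro: analytic_I_add analytic_I_const)

lemma analytic_II_const: "analytic_II (\<lambda>_ _. z)"
  using analytic_II_tensor[OF analytic_I_const[of z] analytic_I_const[of 1]] by simp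

lemma analytic_II_sum: "(\<And>i. i \<in> I \<Longrightarrow> analytic_II (f i)) \<Longrightarrow> analytic_II (\<lambda>t s. \<Sum>i\<in>I. f i t s)"
  by (induction I rule: infinite_finite_induct) (auto intro: analytic_II_add analytic_II_const)

lemma has_vector_derivative_translate:
  fixes a t :: real
  assumes "(P has_vector_derivative d) (at (t - a) within (\<lambda>t. t - a) ` S)"
  shows "((\<lambda>t. P (t - a)) has_vector_derivative d) (at t within S)"
proof -
  have "((\<lambda>t. t - a) has_vector_derivative 1) (at t within S)"
    by (auto intro!: derivative_eq_intros)
  from vector_diff_chain_within[OF this assms] show ?thesis by (simp add: o_def)
qed

lemma powser_has_vector_derivative:
  fixes c :: "nat \<Rightarrow> complex" and x :: real
  assumes "summable (\<lambda>n. norm (c n) * r ^ n)" "\<bar>x\<bar> < r"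
  shows "((\<lambda>x. \<Sum>n. c n * of_real (x ^ n)) has_vector_derivative
          (\<Sum>n. diffs c n * of_real (x ^ n))) (at x within S)"
proof -
  have "summable (\<lambda>n. norm (c n * of_real r ^ n))"
    using assms by (simp add: norm_mult norm_power)
  then have "summable (\<lambda>n. c n * of_real r ^ n)" by (rule summable_norm_cancel)
  from termdiffs_strong[OF this, of "of_real x"] assms(2)
  have "((\<lambda>z. \<Sum>n. c n * z ^ n) has_field_derivative (\<Sum>n. diffs c n * of_real x ^ n)) (at (of_real x))"
    by simp
  from has_vector_derivative_real_field[OF this]
  show ?thesis by (simp add: o_def has_vector_derivative_at_within)
qed

text \<open>
  The termwise primitive of the local series has the same derivative as \<open>F\<close>, so the two differ by a
  constant, which goes into the coefficient of index 0.
\<close>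

lemma analytic_I_primitive:
  assumes f: "analytic_I f"
    and F: "\<And>t. t \<in> I01 \<Longrightarrow> (F has_vector_derivative f t) (at t within I01)"
  shows "analytic_I F"
  unfolding analytic_I_def
proof (intro ballI)
  fix t0 assume 0: "t0 \<in> I01"
  obtain r c where r: "0 < r" and sm: "\<And>x::real. \<bar>x\<bar> \<le> r \<Longrightarrow> summable (\<lambda>n. norm (c n * of_real (x ^ n)))"
    and c: "\<And>t. t \<in> I01 \<Longrightarrow> \<bar>t - t0\<bar> \<le> r \<Longrightarrow> (\<lambda>n. c n * of_real ((t - t0) ^ n)) sums f t"
    by (rule analytic_I_germ[OF f 0]; rule that; assumption)
  define C where "C n = (if n = 0 then F t0 else c (n - 1) / of_nat n)" for n
  have dC: "diffs C = c"
    by (auto simp: diffs_def C_def fun_eq_iff simp del: of_nat_Suc)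
  have smC: "summable (\<lambda>n. norm (C n) * r ^ n)"
  proof -
    have le: "norm (C (Suc n)) * r ^ Suc n \<le> r * norm (c n * of_real (r ^ n))" for n
    proof -
      have "norm (c n) / real (Suc n) \<le> norm (c n) / 1"
        by (intro divide_left_mono) auto
      then have "norm (C (Suc n)) \<le> norm (c n)"
        by (simp add: C_def norm_divide del: of_nat_Suc)
      then show ?thesis using r by (auto simp: norm_mult norm_power mult_ac intro!: mult_left_mono)
    qed
    have sm2: "summable (\<lambda>n. r * norm (c n * of_real (r ^ n)))"
      using sm[of r] r by (intro summable_mult) simp
    have "norm (norm (C (Suc n)) * r ^ Suc n) \<le> r * norm (c n * of_real (r ^ n))" for n
      using le[of n] r by (simp only: real_norm_def abs_of_nonneg mult_nonneg_nonneg norm_ge_zero zero_le_power less_imp_le)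
    then have "summable (\<lambda>n. norm (C (Suc n)) * r ^ Suc n)"
      by (rule summable_comparison_test'[OF sm2])
    then show ?thesis by (subst (asm) summable_Suc_iff)
  qed
  define P where "P x = (\<Sum>n. C n * of_real (x ^ n))" for x :: real
  have dP: "((\<lambda>t. P (t - t0)) has_vector_derivative f t) (at t within S)"
    if "t \<in> I01" "\<bar>t - t0\<bar> < r" for t S
  proof -
    have "(P has_vector_derivative f t) (at (t - t0) within ((\<lambda>t. t - t0) ` S))"
      using powser_has_vector_derivative[OF smC that(2)] c[of t] that
      unfolding P_def[abs_def] dC by (auto simp: sums_iff)
    then show ?thesis by (rule has_vector_derivative_translate)
  qed
  have P0: "P 0 = F t0"
    unfolding P_def by (subst suminf_finite[of "{0}"]) (auto simp: C_def)
  have eq: "F t = P (t - t0)" if t: "t \<in> I01" "\<bar>t - t0\<bar> < r" for t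
  proof -
    let ?J = "{min t0 t..max t0 t}"
    have "F t - P (t - t0) = F t0 - P (t0 - t0)"
    proof (rule zero_derivative_constant[of "min t0 t" "max t0 t" "\<lambda>t. F t - P (t - t0)"])
      fix x assume x: "x \<in> ?J"
      then have x': "x \<in> I01" "\<bar>x - t0\<bar> < r" "?J \<subseteq> I01" using t 0 by auto
      show "((\<lambda>t. F t - P (t - t0)) has_vector_derivative 0) (at x within ?J)"
        using has_vector_derivative_diff[OF has_vector_derivative_within_subset[OF F[OF x'(1)] x'(3)]
            dP[OF x'(1,2), of ?J]] by simp
    qed auto
    then show ?thesis using P0 by simp
  qed
  have "(\<lambda>n. C n * of_real ((t - t0) ^ n)) sums F t" if t: "t \<in> I01" "\<bar>t - t0\<bar> < r" for t
  proof -
    have "summable (\<lambda>n. norm (C n * of_real ((t - t0) ^ n)))"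
      using t r by (intro summable_comparison_test'[OF smC, of 0])
        (auto simp: norm_mult power_abs simp del: of_real_diff of_real_power intro!: mult_left_mono power_mono)
    then show ?thesis
      using eq[OF t] unfolding P_def by (auto simp: sums_iff dest: summable_norm_cancel)
  qed
  with r show "\<exists>r>0. \<exists>c. \<forall>t\<in>I01. \<bar>t - t0\<bar> < r \<longrightarrow>
      (\<lambda>n. c n * of_real ((t - t0) ^ n)) sums F t"
    by blast
qed

text \<open>
  Summing over \<open>n\<close> first turns the double series into a power series in \<open>x\<close> alone, which may be
  differentiated termwise. On half the radius the factor \<open>Suc m \<le> 2 ^ m\<close> produced by the derivative
  is absorbed, which keeps the differentiated double series absolutely convergent.
\<close>

lemma double_powser_derivative:
  fixes c :: "nat \<Rightarrow> nat \<Rightarrow> complex"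
  assumes r: "r > 0" and sm: "(\<lambda>(m, n). norm (c m n) * r ^ m * r ^ n) summable_on UNIV"
  obtains d where
    "\<And>x y::real. \<bar>x\<bar> \<le> r / 2 \<Longrightarrow> \<bar>y\<bar> \<le> r / 2 \<Longrightarrow>
      ((\<lambda>(m, n). of_nat (Suc m) * c (Suc m) n * of_real (x ^ m * y ^ n)) has_sum d x y) UNIV"
    "\<And>x y S. \<bar>x\<bar> \<le> r / 2 \<Longrightarrow> \<bar>y\<bar> \<le> r / 2 \<Longrightarrow>
      ((\<lambda>x. \<Sum>\<^sub>\<infinity>(m, n). c m n * of_real (x ^ m * y ^ n)) has_vector_derivative d x y) (at x within S)"
proof -
  define D where "D x y = (\<Sum>\<^sub>\<infinity>(m, n). of_nat (Suc m) * c (Suc m) n * of_real (x ^ m * y ^ n))" for x y :: real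
  have sm': "(\<lambda>p. norm (case p of (m, n) \<Rightarrow> c m n * of_real (x ^ m * y ^ n))) summable_on UNIV"
    if "\<bar>x\<bar> \<le> r" "\<bar>y\<bar> \<le> r" for x y :: real
  proof (rule summable_on_comparison_test[OF sm])
    fix p :: "nat \<times> nat"
    obtain m n where p: "p = (m, n)" by fastforce
    show "norm (case p of (m, n) \<Rightarrow> c m n * of_real (x ^ m * y ^ n)) \<le> (case p of (m, n) \<Rightarrow> norm (c m n) * r ^ m * r ^ n)"
      using that r by (auto simp: p norm_mult norm_power mult.assoc intro!: mult_left_mono mult_mono power_mono)
  qed auto
  have smD: "(\<lambda>p. norm (case p of (m, n) \<Rightarrow> of_nat (Suc m) * c (Suc m) n * of_real (x ^ m * y ^ n))) summable_on UNIV"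
    if "\<bar>x\<bar> \<le> r / 2" "\<bar>y\<bar> \<le> r / 2" for x y :: real
  proof -
    have "(\<lambda>(m, n). norm (c m n) * r ^ m * r ^ n) summable_on (\<lambda>(m, n). (Suc m, n)) ` UNIV"
      using summable_on_subset_banach[OF sm] by blast
    then have "((\<lambda>(m, n). norm (c m n) * r ^ m * r ^ n) \<circ> (\<lambda>(m, n). (Suc m, n))) summable_on UNIV"
      by (subst (asm) summable_on_reindex) (auto simp: inj_on_def)
    then have "(\<lambda>p. 1 / r * (case p of (m, n) \<Rightarrow> norm (c (Suc m) n) * r ^ Suc m * r ^ n)) summable_on UNIV"
      by (intro summable_on_cmult_right) (simp add: o_def case_prod_unfold)
    then show ?thesis
    proof (rule summable_on_comparison_test)
      fix p :: "nat \<times> nat"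
      obtain m n where p: "p = (m, n)" by fastforce
      have "real (Suc m) \<le> 2 ^ m" by (induction m) auto
      moreover have "\<bar>x\<bar> ^ m \<le> (r / 2) ^ m" using that by (intro power_mono) auto
      ultimately have "real (Suc m) * \<bar>x\<bar> ^ m \<le> 2 ^ m * (r / 2) ^ m"
        by (intro mult_mono) auto
      also have "\<dots> = r ^ m" by (simp add: power_divide)
      finally have "real (Suc m) * \<bar>x\<bar> ^ m * \<bar>y\<bar> ^ n \<le> r ^ m * r ^ n"
        using that r by (intro mult_mono power_mono) auto
      then have "norm (c (Suc m) n) * (real (Suc m) * \<bar>x\<bar> ^ m * \<bar>y\<bar> ^ n) \<le> norm (c (Suc m) n) * (r ^ m * r ^ n)"
        by (intro mult_left_mono) auto
      then show "norm (case p of (m, n) \<Rightarrow> of_nat (Suc m) * c (Suc m) n * of_real (x ^ m * y ^ n))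
          \<le> 1 / r * (case p of (m, n) \<Rightarrow> norm (c (Suc m) n) * r ^ Suc m * r ^ n)"
        using r by (simp add: p norm_mult norm_power mult_ac del: of_nat_Suc)
    qed auto
  qed
  have hsD: "((\<lambda>(m, n). of_nat (Suc m) * c (Suc m) n * of_real (x ^ m * y ^ n)) has_sum D x y) UNIV"
    if "\<bar>x\<bar> \<le> r / 2" "\<bar>y\<bar> \<le> r / 2" for x y :: real
    unfolding D_def by (rule has_sum_infsum[OF abs_summable_summable[OF smD[OF that]]])
  have der: "((\<lambda>x. \<Sum>\<^sub>\<infinity>(m, n). c m n * of_real (x ^ m * y ^ n)) has_vector_derivative D x y) (at x within S)"
    if x: "\<bar>x\<bar> \<le> r / 2" and y: "\<bar>y\<bar> \<le> r / 2" for x y S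
  proof -
    define b where "b m = (\<Sum>\<^sub>\<infinity>n. c m n * of_real (y ^ n))" for m
    have rows: "(\<lambda>n. c m n * of_real (y ^ n)) summable_on UNIV" for m
    proof -
      have "(\<lambda>(m, n). c m n * of_real (r ^ m * y ^ n)) summable_on UNIV \<times> UNIV"
        using abs_summable_summable[OF sm'[of r y]] r y by auto
      from summable_on_SigmaD1[OF this, of m]
      have "(\<lambda>n. c m n * of_real (r ^ m * y ^ n)) summable_on UNIV" by simp
      from summable_on_cmult_right[OF this, of "1 / of_real (r ^ m)"]
      show ?thesis using r by (simp add: field_simps)
    qed
    then have b: "((\<lambda>n. c m n * of_real (y ^ n)) has_sum b m) UNIV" for m
      unfolding b_def by (rule has_sum_infsum)
    have hs: "((\<lambda>m. b m * of_real (z ^ m)) has_sum (\<Sum>\<^sub>\<infinity>(m, n). c m n * of_real (z ^ m * y ^ n))) UNIV"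
      if "\<bar>z\<bar> \<le> r" for z :: real
    proof (rule has_sum_SigmaD)
      show "((\<lambda>(m, n). c m n * of_real (z ^ m * y ^ n)) has_sum (\<Sum>\<^sub>\<infinity>(m, n). c m n * of_real (z ^ m * y ^ n)))
          (SIGMA m:UNIV. UNIV)"
        using abs_summable_summable[OF sm'[OF that, of y]] r y by simp
      show "((\<lambda>n. (case (m, n) of (m, n) \<Rightarrow> c m n * of_real (z ^ m * y ^ n))) has_sum b m * of_real (z ^ m)) UNIV" for m
        using has_sum_cmult_left[OF b[of m], of "of_real (z ^ m)"] by (simp add: mult_ac)
    qed
    have sums: "(\<lambda>m. b m * of_real (z ^ m)) sums (\<Sum>\<^sub>\<infinity>(m, n). c m n * of_real (z ^ m * y ^ n))"
      if "\<bar>z\<bar> \<le> r" for z :: real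
      using has_sum_imp_sums[OF hs[OF that]] .
    have "summable (\<lambda>m. norm (b m * of_real (r ^ m)))"
      using has_sum_imp_summable[OF hs[of r]] r
      by (auto simp: summable_on_iff_abs_summable_on_complex intro: summable_on_imp_summable)
    then have "summable (\<lambda>m. norm (b m) * r ^ m)" using r by (simp add: norm_mult norm_power)
    then have "((\<lambda>x. \<Sum>m. b m * of_real (x ^ m)) has_vector_derivative
        (\<Sum>m. diffs b m * of_real (x ^ m))) (at x within UNIV)"
      using x r by (intro powser_has_vector_derivative) auto
    moreover have "(\<Sum>m. diffs b m * of_real (x ^ m)) = D x y"
    proof -
      have "((\<lambda>m. diffs b m * of_real (x ^ m)) has_sum D x y) UNIV"
      proof (rule has_sum_SigmaD)
        show "((\<lambda>(m, n). of_nat (Suc m) * c (Suc m) n * of_real (x ^ m * y ^ n)) has_sum D x y) (SIGMA m:UNIV. UNIV)"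
          using hsD[OF x y] by simp
        show "((\<lambda>n. (case (m, n) of (m, n) \<Rightarrow> of_nat (Suc m) * c (Suc m) n * of_real (x ^ m * y ^ n)))
            has_sum diffs b m * of_real (x ^ m)) UNIV" for m
          using has_sum_cmult_right[OF b[of "Suc m"], of "of_nat (Suc m) * of_real (x ^ m)"]
          by (simp add: diffs_def mult_ac del: of_nat_Suc)
      qed
      then show ?thesis using has_sum_imp_sums sums_unique by metis
    qed
    ultimately have "((\<lambda>x. \<Sum>m. b m * of_real (x ^ m)) has_vector_derivative D x y) (at x)"
      by simp
    then have "((\<lambda>x. \<Sum>\<^sub>\<infinity>(m, n). c m n * of_real (x ^ m * y ^ n)) has_vector_derivative D x y) (at x)"
    proof (rule has_vector_derivative_transform_within_open[where S = "{-r<..<r}"])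
      fix z assume "z \<in> {-r<..<r}"
      then show "(\<Sum>m. b m * of_real (z ^ m)) = (\<Sum>\<^sub>\<infinity>(m, n). c m n * of_real (z ^ m * y ^ n))"
        using sums[of z] by (simp add: sums_iff abs_le_iff)
    qed (use x r in auto)
    then show ?thesis by (rule has_vector_derivative_at_within)
  qed
  show thesis by (rule that[OF hsD der])
qed

text \<open>
  The local series of the derivative exist around every point by \<open>double_powser_derivative\<close>; they fit
  together to one function since one-sided derivatives on the interval are unique.
\<close>

lemma analytic_II_deriv:
  assumes f: "analytic_II f"
  obtains f1 where "analytic_II f1"
    "\<And>t s. t \<in> I01 \<Longrightarrow> s \<in> I01 \<Longrightarrow> ((\<lambda>t. f t s) has_vector_derivative f1 t s) (at t within I01)"
proof -
  define f1 where "f1 t s = vector_derivative (\<lambda>t. f t s) (at t within I01)" for t s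
  have local: "\<exists>r>0. \<exists>c. \<forall>t\<in>I01. \<forall>s\<in>I01. \<bar>t - t0\<bar> < r \<longrightarrow> \<bar>s - s0\<bar> < r \<longrightarrow>
       ((\<lambda>(m, n). c m n * of_real ((t - t0) ^ m * (s - s0) ^ n)) has_sum f1 t s) UNIV \<and>
       ((\<lambda>t. f t s) has_vector_derivative f1 t s) (at t within I01)"
    if 0: "t0 \<in> I01" "s0 \<in> I01" for t0 s0
  proof -
    obtain r c where r: "0 < r" and sm: "(\<lambda>(m, n). norm (c m n) * r ^ m * r ^ n) summable_on UNIV"
      and c: "\<And>t s. t \<in> I01 \<Longrightarrow> s \<in> I01 \<Longrightarrow> \<bar>t - t0\<bar> \<le> r \<Longrightarrow> \<bar>s - s0\<bar> \<le> r \<Longrightarrow>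
       ((\<lambda>(m, n). c m n * of_real ((t - t0) ^ m * (s - s0) ^ n)) has_sum f t s) UNIV"
      by (rule analytic_II_germ[OF f 0]; rule that; assumption)
    obtain d where d1: "\<And>x y::real. \<bar>x\<bar> \<le> r / 2 \<Longrightarrow> \<bar>y\<bar> \<le> r / 2 \<Longrightarrow>
      ((\<lambda>(m, n). of_nat (Suc m) * c (Suc m) n * of_real (x ^ m * y ^ n)) has_sum d x y) UNIV"
      and d2: "\<And>x y S. \<bar>x\<bar> \<le> r / 2 \<Longrightarrow> \<bar>y\<bar> \<le> r / 2 \<Longrightarrow>
      ((\<lambda>x. \<Sum>\<^sub>\<infinity>(m, n). c m n * of_real (x ^ m * y ^ n)) has_vector_derivative d x y) (at x within S)"
      by (rule double_powser_derivative[OF r sm]; rule that; assumption)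
    have der: "((\<lambda>t. f t s) has_vector_derivative d (t - t0) (s - s0)) (at t within I01)"
      if ts: "t \<in> I01" "s \<in> I01" "\<bar>t - t0\<bar> < r / 2" "\<bar>s - s0\<bar> < r / 2" for t s
    proof -
      let ?P = "\<lambda>x. \<Sum>\<^sub>\<infinity>(m, n). c m n * of_real (x ^ m * (s - s0) ^ n)"
      have "(?P has_vector_derivative d (t - t0) (s - s0)) (at (t - t0) within ((\<lambda>t. t - t0) ` I01))"
        using ts by (intro d2) auto
      from has_vector_derivative_translate[OF this]
      show ?thesis
      proof (rule has_vector_derivative_transform_within)
        show "r / 2 > 0" using r by simp
        fix t' assume t': "t' \<in> I01" "dist t' t < r / 2"
        have "\<bar>t' - t0\<bar> \<le> r" using ts(3) t'(2) unfolding dist_real_def by linarith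
        then show "?P (t' - t0) = f t' s"
          using ts(2,3,4) t' r by (intro infsumI c) (auto simp: dist_real_def)
      qed (use ts in auto)
    qed
    have "f1 t s = d (t - t0) (s - s0)"
      if ts: "t \<in> I01" "s \<in> I01" "\<bar>t - t0\<bar> < r / 2" "\<bar>s - s0\<bar> < r / 2" for t s
      unfolding f1_def using der[OF ts] ts(1) by (intro vector_derivative_within_closed_interval) auto
    with der d1 r show ?thesis
      by (intro exI[of _ "r / 2"] conjI exI[of _ "\<lambda>m n. of_nat (Suc m) * c (Suc m) n"]) (auto simp del: of_nat_Suc of_real_diff of_real_power of_real_mult)
  qed
  have "analytic_II f1"
    unfolding analytic_II_def
  proof (intro ballI)
    fix t0 s0 :: real assume 0: "t0 \<in> I01" "s0 \<in> I01"
    from local[OF this] show "\<exists>r>0. \<exists>c. \<forall>t\<in>I01. \<forall>s\<in>I01. \<bar>t - t0\<bar> < r \<longrightarrow> \<bar>s - s0\<bar> < r \<longrightarrow>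
       ((\<lambda>(m, n). c m n * of_real ((t - t0) ^ m * (s - s0) ^ n)) has_sum f1 t s) UNIV"
      by meson
  qed
  moreover have "((\<lambda>t. f t s) has_vector_derivative f1 t s) (at t within I01)" if "t \<in> I01" "s \<in> I01" for t s
    using local[OF that] that by (metis abs_zero cancel_comm_monoid_add_class.diff_cancel)
  ultimately show thesis by (rule that)
qed

lemma analytic_II_continuous:
  assumes f: "analytic_II f"
  shows "continuous_on (I01 \<times> I01) (\<lambda>(t, s). f t s)"
proof -
  have "continuous (at (t0, s0) within I01 \<times> I01) (\<lambda>(t, s). f t s)" if 0: "t0 \<in> I01" "s0 \<in> I01" for t0 s0
  proof -
    obtain r c where r: "0 < r" and sm: "(\<lambda>(m, n). norm (c m n) * r ^ m * r ^ n) summable_on UNIV"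
      and c: "\<And>t s. t \<in> I01 \<Longrightarrow> s \<in> I01 \<Longrightarrow> \<bar>t - t0\<bar> \<le> r \<Longrightarrow> \<bar>s - s0\<bar> \<le> r \<Longrightarrow>
       ((\<lambda>(m, n). c m n * of_real ((t - t0) ^ m * (s - s0) ^ n)) has_sum f t s) UNIV"
      by (rule analytic_II_germ[OF f 0]; rule that; assumption)
    let ?Q = "{t0-r..t0+r} \<times> {s0-r..s0+r}"
    let ?g = "\<lambda>p::nat\<times>nat. \<lambda>z::real\<times>real. (case p of (m, n) \<Rightarrow> c m n * of_real ((fst z - t0) ^ m * (snd z - s0) ^ n))"
    have "uniform_limit ?Q (\<lambda>X z. \<Sum>p\<in>X. ?g p z) (\<lambda>z. \<Sum>\<^sub>\<infinity>p. ?g p z) (finite_subsets_at_top UNIV)"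
    proof (rule Weierstrass_m_test_general[OF _ sm])
      fix p :: "nat \<times> nat" and z assume z: "z \<in> ?Q"
      obtain m n where p: "p = (m, n)" by fastforce
      show "norm (?g p z) \<le> (case p of (m, n) \<Rightarrow> norm (c m n) * r ^ m * r ^ n)"
      proof -
        have "\<bar>fst z - t0\<bar> \<le> r" "\<bar>snd z - s0\<bar> \<le> r" using z by (auto simp: abs_le_iff)
        then show ?thesis
          unfolding p by (auto simp: norm_mult power_abs abs_mult mult.assoc simp del: of_real_diff of_real_power
              intro!: mult_left_mono mult_mono power_mono)
      qed
    qed
    then have cont: "continuous_on ?Q (\<lambda>z. \<Sum>\<^sub>\<infinity>p. ?g p z)"
      by (rule uniform_limit_theorem[rotated])
         (auto intro!: always_eventually continuous_intros simp: case_prod_unfold)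
    have "continuous_on (?Q \<inter> I01 \<times> I01) (\<lambda>(t, s). f t s)"
    proof (rule continuous_on_eq[OF continuous_on_subset[OF cont]])
      fix z assume "z \<in> ?Q \<inter> I01 \<times> I01"
      then show "(\<Sum>\<^sub>\<infinity>p. ?g p z) = (\<lambda>(t, s). f t s) z"
        using c[of "fst z" "snd z"] by (intro infsumI) (auto simp: abs_le_iff simp del: of_real_diff of_real_power of_real_mult)
    qed auto
    then have "continuous (at (t0, s0) within ?Q \<inter> I01 \<times> I01) (\<lambda>(t, s). f t s)"
      using 0 r by (auto simp: continuous_on_eq_continuous_within)
    moreover have "at (t0, s0) within (I01 \<times> I01) \<inter> ?Q = at (t0, s0) within (I01 \<times> I01)"
      using r by (intro at_within_nhd[of _ "{t0-r<..<t0+r} \<times> {s0-r<..<s0+r}"]) (auto intro!: open_Times)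
    ultimately show ?thesis by (simp add: Int_commute continuous_within)
  qed
  then show ?thesis by (auto simp: continuous_on_eq_continuous_within)
qed

section \<open>Kernels with analytic coefficients act on test functions\<close>

lemma analytic_II_smooth_left:
  assumes "analytic_II f" "s \<in> I01"
  shows "smooth (\<lambda>t. f t s)"
proof -
  have "Ck k (\<lambda>t. f t s)" if "analytic_II f" for k f
    using that
  proof (induction k arbitrary: f)
    case (Suc k)
    obtain f1 where f1: "analytic_II f1"
      "\<And>t s. t \<in> I01 \<Longrightarrow> s \<in> I01 \<Longrightarrow> ((\<lambda>t. f t s) has_vector_derivative f1 t s) (at t within I01)"
      by (rule analytic_II_deriv[OF Suc.prems]; rule that; assumption)
    show ?case
      by (rule Ck_SucI[where f' = "\<lambda>t. f1 t s"]) (use f1 assms(2) Suc.IH in blast)+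
  qed simp
  with assms(1) show ?thesis by (simp add: smooth_def)
qed

lemma analytic_II_smooth_right: "analytic_II f \<Longrightarrow> t \<in> I01 \<Longrightarrow> smooth (f t)"
  using analytic_II_smooth_left[OF analytic_II_swap] .

text \<open>
  The derivative of the diagonal is the diagonal of \<open>\<partial>\<^sub>t f + \<partial>\<^sub>s f\<close>, which is analytic again.
\<close>

lemma analytic_II_smooth_diagonal:
  assumes "analytic_II f"
  shows "smooth (\<lambda>t. f t t)"
proof -
  have "Ck k (\<lambda>t. f t t)" if "analytic_II f" for k f
    using that
  proof (induction k arbitrary: f)
    case (Suc k)
    obtain f1 where f1: "analytic_II f1"
      "\<And>t s. t \<in> I01 \<Longrightarrow> s \<in> I01 \<Longrightarrow> ((\<lambda>t. f t s) has_vector_derivative f1 t s) (at t within I01)"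
      by (rule analytic_II_deriv[OF Suc.prems]; rule that; assumption)
    obtain f2 where f2: "analytic_II f2"
      "\<And>s t. s \<in> I01 \<Longrightarrow> t \<in> I01 \<Longrightarrow> ((\<lambda>s. f t s) has_vector_derivative f2 s t) (at s within I01)"
      by (rule analytic_II_deriv[OF analytic_II_swap[OF Suc.prems]]; rule that; assumption)
    have f2': "analytic_II (\<lambda>t s. f2 s t)" by (rule analytic_II_swap[OF f2(1)])
    show ?case
    proof (rule Ck_SucI[where f' = "\<lambda>t. f1 t t + f2 t t"])
      show "((\<lambda>t. f t t) has_vector_derivative f1 t t + f2 t t) (at t within I01)" if "t \<in> I01" for t
        by (rule diagonal_derivative[where D = "\<lambda>t s. f2 s t"])
           (use f1(2) f2(2) analytic_II_continuous[OF f2'] that in blast)+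
      show "Ck k (\<lambda>t. f1 t t + f2 t t)"
        using Suc.IH[OF analytic_II_add[OF f1(1) f2']] .
    qed
  qed simp
  with assms show ?thesis by (simp add: smooth_def)
qed

text \<open>
  The Heaviside factor cuts the integral off at \<open>t\<close>.
\<close>

lemma theta_dist_apply:
  assumes "test_fun \<phi>" "t \<in> I01"
  shows "theta_dist f \<phi> t = integral {0..t} (\<lambda>s. f t s * \<phi> s)"
proof -
  have "(\<lambda>s. f t s * of_real (Heaviside (t - s)) * \<phi> s) = (\<lambda>s. if s \<in> {..t} then f t s * \<phi> s else 0)"
    by (auto simp: Heaviside_def fun_eq_iff)
  then have "theta_dist f \<phi> t = integral ({..t} \<inter> I01) (\<lambda>s. f t s * \<phi> s)"
    using assms by (simp only: theta_dist_def integral_restrict_Int) (simp add: Int_commute)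
  also have "{..t} \<inter> I01 = {0..t}" using assms(2) by auto
  finally show ?thesis .
qed

lemma theta_dist_outside:
  "\<not> test_fun \<phi> \<Longrightarrow> theta_dist f \<phi> = 0"
  "t \<notin> I01 \<Longrightarrow> theta_dist f \<phi> t = 0"
  by (auto simp: theta_dist_def fun_eq_iff)

lemma test_fun_smooth: "test_fun \<phi> \<Longrightarrow> smooth \<phi>"
  by (simp add: test_fun_iff)

lemma test_fun_continuous: "test_fun \<phi> \<Longrightarrow> continuous_on I01 \<phi>"
  by (intro smooth_continuous_on test_fun_smooth)

lemma test_fun_outside: "test_fun \<phi> \<Longrightarrow> t \<notin> I01 \<Longrightarrow> \<phi> t = 0"
  by (auto simp: test_fun_iff)

lemma theta_integrand_continuous:
  assumes "continuous_on (I01 \<times> I01) (\<lambda>(t, s). f t s)" "test_fun \<phi>"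
  shows "continuous_on (I01 \<times> I01) (\<lambda>(t, s). f t s * \<phi> s)"
proof -
  have "continuous_on (I01 \<times> I01) (\<lambda>z. \<phi> (snd z))"
    by (rule continuous_on_compose2[OF test_fun_continuous[OF assms(2)]]) (auto intro!: continuous_intros)
  with assms(1) show ?thesis by (auto simp: case_prod_unfold intro!: continuous_intros)
qed

lemma theta_integrand_integrable:
  assumes "continuous_on (I01 \<times> I01) (\<lambda>(t, s). f t s)" "test_fun \<phi>" "t \<in> I01"
  shows "(\<lambda>s. f t s * \<phi> s) integrable_on {0..t}"
proof (rule integrable_continuous_real)
  show "continuous_on {0..t} (\<lambda>s. f t s * \<phi> s)"
    using slice_continuous[OF theta_integrand_continuous[OF assms(1,2)] assms(3)]
    by (rule continuous_on_subset) (use assms(3) in auto)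
qed

text \<open>
  Differentiating a kernel in \<open>t\<close> produces a delta term from the jump of \<open>\<Theta>\<close> and the kernel of the
  partial derivative. All later computations of star-products with \<open>\<Theta>\<close> rest on this rule.
\<close>

lemma theta_dist_derivative:
  assumes der: "\<And>t s. t \<in> I01 \<Longrightarrow> s \<in> I01 \<Longrightarrow> ((\<lambda>t. F t s) has_vector_derivative F1 t s) (at t within I01)"
    and F: "continuous_on (I01 \<times> I01) (\<lambda>(t, s). F t s)"
    and F1: "continuous_on (I01 \<times> I01) (\<lambda>(t, s). F1 t s)"
    and \<phi>: "test_fun \<phi>" and t: "t \<in> I01"
  shows "(theta_dist F \<phi> has_vector_derivative (F t t * \<phi> t + theta_dist F1 \<phi> t)) (at t within I01)"
proof -
  have "((\<lambda>t. integral {0..t} (\<lambda>s. F t s * \<phi> s)) has_vector_derivative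
      (F t t * \<phi> t + integral {0..t} (\<lambda>s. F1 t s * \<phi> s))) (at t within I01)"
    by (rule leibniz_triangle)
       (use assms in \<open>auto intro!: theta_integrand_continuous has_vector_derivative_mult_left\<close>)
  then show ?thesis
    unfolding theta_dist_apply[OF \<phi> t, symmetric]
    by (rule has_vector_derivative_transform[OF t, rotated]) (simp add: theta_dist_apply[OF \<phi>])
qed

lemma theta_dist_vanishes_near_0:
  assumes "test_fun \<phi>"
  shows "\<exists>\<epsilon>>0. \<forall>t. t \<notin> {\<epsilon>..1} \<longrightarrow> theta_dist f \<phi> t = 0"
proof -
  obtain e where e: "e > 0" "\<forall>t. t \<notin> {e..1} \<longrightarrow> \<phi> t = 0"
    using assms by (auto simp: test_fun_iff)
  have "theta_dist f \<phi> t = 0" if "t \<notin> {e..1}" for t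
  proof (cases "t \<in> I01")
    case True
    then have "\<phi> s = 0" if "s \<in> {0..t}" for s
      using e that \<open>t \<notin> {e..1}\<close> by auto
    then have "integral {0..t} (\<lambda>s. f t s * \<phi> s) = integral {0..t} (\<lambda>s. 0)"
      by (intro integral_cong) simp
    then show ?thesis by (simp add: theta_dist_apply[OF assms True])
  qed (simp add: theta_dist_outside)
  with e(1) show ?thesis by blast
qed

text \<open>
  The derivative of the result consists of a product of smooth functions and of the same expression for the
  analytic kernel \<open>\<partial>\<^sub>t f\<close>, so induction on the order of differentiability works for all analytic kernels
  at once.
\<close>

lemma test_fun_theta_dist:
  assumes f: "analytic_II f" and \<phi>: "test_fun \<phi>"
  shows "test_fun (theta_dist f \<phi>)"
proof -
  have "Ck k (theta_dist f \<phi>)" if "analytic_II f" for k f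
    using that
  proof (induction k arbitrary: f)
    case (Suc k)
    obtain f1 where f1: "analytic_II f1"
      "\<And>t s. t \<in> I01 \<Longrightarrow> s \<in> I01 \<Longrightarrow> ((\<lambda>t. f t s) has_vector_derivative f1 t s) (at t within I01)"
      by (rule analytic_II_deriv[OF Suc.prems]; rule that; assumption)
    show ?case
    proof (rule Ck_SucI[where f' = "\<lambda>t. f t t * \<phi> t + theta_dist f1 \<phi> t"])
      show "(theta_dist f \<phi> has_vector_derivative f t t * \<phi> t + theta_dist f1 \<phi> t) (at t within I01)"
        if "t \<in> I01" for t
        using f1 that Suc.prems \<phi> by (intro theta_dist_derivative analytic_II_continuous)
      show "Ck k (\<lambda>t. f t t * \<phi> t + theta_dist f1 \<phi> t)"
        using analytic_II_smooth_diagonal[OF Suc.prems] test_fun_smooth[OF \<phi>] Suc.IH[OF f1(1)]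
        by (intro Ck_add Ck_mult) (auto simp: smooth_def)
    qed
  qed simp
  with f have "smooth (theta_dist f \<phi>)" by (simp add: smooth_def)
  then show ?thesis
    using theta_dist_vanishes_near_0[OF \<phi>] by (simp add: test_fun_iff)
qed

section \<open>The algebra of distributions\<close>

text \<open>
  Composition of maps is associative and distributes from the right for trivial reasons. Distributivity from
  the left needs additivity of the outer map on test functions, and the inner maps must not leave the test
  functions. Arbitrary elements of \<open>DI\<close> enter only as a competing inverse, where additivity suffices;
  \<open>regular_dist\<close> collects what holds for the kernels that are composed explicitly.
\<close>

definition additive_dist :: "dist \<Rightarrow> bool" where
  "additive_dist d \<longleftrightarrow> (\<forall>\<phi>. \<not> test_fun \<phi> \<longrightarrow> d \<phi> = 0) \<and>
     (\<forall>\<phi> \<psi>. test_fun \<phi> \<longrightarrow> test_fun \<psi> \<longrightarrow> d (\<phi> + \<psi>) = d \<phi> + d \<psi>)"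

definition regular_dist :: "dist \<Rightarrow> bool" where
  "regular_dist d \<longleftrightarrow> additive_dist d \<and> (\<forall>\<phi>. test_fun (d \<phi>))"

lemma additive_dist_0: "additive_dist d \<Longrightarrow> d 0 = 0"
  using test_fun_zero unfolding additive_dist_def by (metis add_0 add_cancel_right_left)

lemma additive_dist_sum:
  assumes "additive_dist d" "\<And>i. i \<in> I \<Longrightarrow> test_fun (f i)"
  shows "d (\<Sum>i\<in>I. f i) = (\<Sum>i\<in>I. d (f i))" and "test_fun (\<Sum>i\<in>I. f i)"
proof -
  have "d (\<Sum>i\<in>I. f i) = (\<Sum>i\<in>I. d (f i)) \<and> test_fun (\<Sum>i\<in>I. f i)"
    using assms(2)
  proof (induction I rule: infinite_finite_induct)
    case (insert i I)
    then have "test_fun (f i)" "test_fun (\<Sum>i\<in>I. f i)" "d (\<Sum>i\<in>I. f i) = (\<Sum>i\<in>I. d (f i))" by auto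
    moreover from this have "d (f i + (\<Sum>i\<in>I. f i)) = d (f i) + d (\<Sum>i\<in>I. f i)"
      using assms(1) unfolding additive_dist_def by blast
    ultimately show ?case
      unfolding sum.insert[OF insert(1,2)] by (simp only: test_fun_add simp_thms)
  qed (simp_all add: additive_dist_0[OF assms(1)] test_fun_zero)
  then show "d (\<Sum>i\<in>I. f i) = (\<Sum>i\<in>I. d (f i))" "test_fun (\<Sum>i\<in>I. f i)" by blast+
qed

lemma sum_fun_apply: "(\<Sum>i\<in>I. f i) x = (\<Sum>i\<in>I. f i x)"
  by (induction I rule: infinite_finite_induct) simp_all

lemma additive_dist_add: "additive_dist d \<Longrightarrow> additive_dist e \<Longrightarrow> additive_dist (d + e)"
  by (simp add: additive_dist_def algebra_simps)

lemma additive_dist_zero: "additive_dist 0"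
  by (simp add: additive_dist_def)

lemma additive_dist_Sum: "(\<And>i. i \<in> I \<Longrightarrow> additive_dist (d i)) \<Longrightarrow> additive_dist (\<Sum>i\<in>I. d i)"
  by (induction I rule: infinite_finite_induct) (auto intro: additive_dist_add additive_dist_zero)

lemma regular_dist_add: "regular_dist d \<Longrightarrow> regular_dist e \<Longrightarrow> regular_dist (d + e)"
  by (simp add: regular_dist_def additive_dist_add test_fun_add)

lemma regular_dist_uminus: "regular_dist d \<Longrightarrow> regular_dist (- d)"
  by (auto simp: regular_dist_def additive_dist_def test_fun_uminus)

lemma regular_dist_zero: "regular_dist 0"
  by (simp add: regular_dist_def additive_dist_zero test_fun_zero)

lemma regular_dist_Sum: "(\<And>i. i \<in> I \<Longrightarrow> regular_dist (d i)) \<Longrightarrow> regular_dist (\<Sum>i\<in>I. d i)"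
  by (induction I rule: infinite_finite_induct) (auto intro: regular_dist_add regular_dist_zero)

lemma regular_dist_star: "regular_dist d \<Longrightarrow> regular_dist e \<Longrightarrow> regular_dist (star d e)"
  using additive_dist_0[of d] by (auto simp: regular_dist_def star_def additive_dist_def)

lemma one_star_apply: "one_star \<phi> = (if test_fun \<phi> then \<phi> else 0)"
  using test_fun_outside by (auto simp: one_star_def delta_dist_def nderiv_0 fun_eq_iff)

lemma regular_dist_one: "regular_dist one_star"
  by (auto simp: regular_dist_def additive_dist_def one_star_apply test_fun_add test_fun_zero)

lemma additive_theta_dist:
  assumes "continuous_on (I01 \<times> I01) (\<lambda>(t, s). f t s)"
  shows "additive_dist (theta_dist f)"
  unfolding additive_dist_def
proof (intro conjI allI impI)
  fix \<phi> \<psi> assume \<phi>: "test_fun \<phi>" and \<psi>: "test_fun \<psi>"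
  show "theta_dist f (\<phi> + \<psi>) = theta_dist f \<phi> + theta_dist f \<psi>"
  proof
    fix t
    show "theta_dist f (\<phi> + \<psi>) t = (theta_dist f \<phi> + theta_dist f \<psi>) t"
    proof (cases "t \<in> I01")
      case True
      then show ?thesis
        using theta_integrand_integrable[OF assms \<phi> True] theta_integrand_integrable[OF assms \<psi> True]
        by (simp add: theta_dist_apply \<phi> \<psi> test_fun_add distrib_left integral_add del: atLeastAtMost_iff)
    qed (simp add: theta_dist_outside)
  qed
qed (simp add: theta_dist_outside)

lemma regular_theta_dist:
  assumes "analytic_II f"
  shows "regular_dist (theta_dist f)"
proof -
  have "test_fun (theta_dist f \<phi>)" for \<phi>
    by (cases "test_fun \<phi>") (simp_all add: test_fun_theta_dist assms theta_dist_outside test_fun_zero)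
  then show ?thesis
    by (simp add: regular_dist_def additive_theta_dist analytic_II_continuous assms)
qed

lemma additive_delta_dist:
  assumes "analytic_II f"
  shows "additive_dist (delta_dist i f)"
proof -
  have "nderiv i (\<lambda>s. f t s * (\<phi> s + \<psi> s)) t = nderiv i (\<lambda>s. f t s * \<phi> s) t + nderiv i (\<lambda>s. f t s * \<psi> s) t"
    if "test_fun \<phi>" "test_fun \<psi>" "t \<in> I01" for \<phi> \<psi> t
    using that unfolding distrib_left
    by (intro nderiv_add smooth_mult analytic_II_smooth_right[OF assms] test_fun_smooth)
  then show ?thesis
    by (auto simp: additive_dist_def delta_dist_def test_fun_add fun_eq_iff)
qed

lemma additive_dist_DI: "d \<in> DI \<Longrightarrow> additive_dist d"
  unfolding DI_def
  by (auto intro!: additive_dist_add additive_dist_Sum additive_theta_dist additive_delta_dist analytic_II_continuous)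

section \<open>The algebra of matrices of distributions\<close>

definition regular_mat :: "dist^'n^'n \<Rightarrow> bool" where
  "regular_mat X \<longleftrightarrow> (\<forall>i j. regular_dist (X $ i $ j))"

definition additive_mat :: "dist^'n^'n \<Rightarrow> bool" where
  "additive_mat X \<longleftrightarrow> (\<forall>i j. additive_dist (X $ i $ j))"

lemma regular_imp_additive: "regular_mat X \<Longrightarrow> additive_mat X"
  by (simp add: regular_mat_def additive_mat_def regular_dist_def)

lemma mstar_nth: "(X \<star> Y) $ i $ j = (\<lambda>\<phi>. \<Sum>k\<in>UNIV. (X $ i $ k) ((Y $ k $ j) \<phi>))"
  by (simp add: mstar_def fun_eq_iff sum_fun_apply star_def)

lemma regular_mat_add: "regular_mat X \<Longrightarrow> regular_mat Y \<Longrightarrow> regular_mat (X + Y)"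
  by (simp add: regular_mat_def regular_dist_add)

lemma regular_mat_diff: "regular_mat X \<Longrightarrow> regular_mat Y \<Longrightarrow> regular_mat (X - Y)"
  using regular_dist_add[OF _ regular_dist_uminus] by (simp add: regular_mat_def)

lemma regular_mat_mstar: "regular_mat X \<Longrightarrow> regular_mat Y \<Longrightarrow> regular_mat (X \<star> Y)"
  unfolding regular_mat_def mstar_def by (auto intro!: regular_dist_Sum regular_dist_star)

lemma regular_mat_one: "regular_mat mone_star"
  by (simp add: regular_mat_def mone_star_def regular_dist_one regular_dist_zero)

lemma regular_mtheta: "(\<And>i j. analytic_II (\<lambda>t s. M t s $ i $ j)) \<Longrightarrow> regular_mat (mtheta M)"
  by (simp add: regular_mat_def mtheta_def regular_theta_dist)

lemma mstar_assoc:
  assumes X: "additive_mat X" and Y: "regular_mat Y" and Z: "regular_mat Z"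
  shows "(X \<star> Y) \<star> Z = X \<star> (Y \<star> Z)"
proof -
  have "(\<Sum>l\<in>UNIV. \<Sum>k\<in>UNIV. (X $ i $ k) ((Y $ k $ l) ((Z $ l $ j) \<phi>))) =
        (\<Sum>k\<in>UNIV. (X $ i $ k) (\<Sum>l\<in>UNIV. (Y $ k $ l) ((Z $ l $ j) \<phi>)))" for i j \<phi>
  proof -
    have "(X $ i $ k) (\<Sum>l\<in>UNIV. (Y $ k $ l) ((Z $ l $ j) \<phi>)) = (\<Sum>l\<in>UNIV. (X $ i $ k) ((Y $ k $ l) ((Z $ l $ j) \<phi>)))" for k
      using assms by (intro additive_dist_sum) (auto simp: additive_mat_def regular_mat_def regular_dist_def)
    then show ?thesis by (simp only:) (rule sum.swap)
  qed
  then show ?thesis by (simp add: vec_eq_iff mstar_nth)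
qed

lemma mstar_add_left: "(X + Y) \<star> Z = X \<star> Z + Y \<star> Z"
  by (simp add: vec_eq_iff mstar_nth fun_eq_iff sum.distrib sum_fun_apply)

lemma mstar_diff_left: "(X - Y) \<star> Z = X \<star> Z - Y \<star> Z"
  using mstar_add_left[of "X - Y" Y Z] by (simp add: algebra_simps)

lemma mstar_add_right:
  assumes "additive_mat X" "regular_mat Y" "regular_mat Z"
  shows "X \<star> (Y + Z) = X \<star> Y + X \<star> Z"
proof -
  have "(X $ i $ k) ((Y $ k $ j) \<phi> + (Z $ k $ j) \<phi>) = (X $ i $ k) ((Y $ k $ j) \<phi>) + (X $ i $ k) ((Z $ k $ j) \<phi>)"
    for i j k \<phi>
    using assms by (auto simp: additive_mat_def additive_dist_def regular_mat_def regular_dist_def)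
  then show ?thesis
    by (simp add: vec_eq_iff mstar_nth fun_eq_iff sum.distrib sum_fun_apply)
qed

lemma mstar_diff_right:
  assumes "additive_mat X" "regular_mat Y" "regular_mat Z"
  shows "X \<star> (Y - Z) = X \<star> Y - X \<star> Z"
  using mstar_add_right[OF assms(1) regular_mat_diff[OF assms(2,3)] assms(3)] by (simp add: algebra_simps)

lemma mstar_one_left:
  assumes "regular_mat X"
  shows "mone_star \<star> X = X"
proof -
  have "(\<Sum>k\<in>UNIV. (mone_star $ i $ k) ((X $ k $ j) \<phi>)) = (X $ i $ j) \<phi>" for i j \<phi>
  proof -
    have "(\<Sum>k\<in>UNIV. (mone_star $ i $ k) ((X $ k $ j) \<phi>)) = (\<Sum>k\<in>UNIV. if k = i then (X $ k $ j) \<phi> else 0)"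
      using assms
      by (intro sum.cong refl) (auto simp: mone_star_def one_star_apply regular_mat_def regular_dist_def)
    then show ?thesis by simp
  qed
  then show ?thesis by (simp add: vec_eq_iff mstar_nth)
qed

lemma mstar_one_right:
  assumes "additive_mat X"
  shows "X \<star> mone_star = X"
proof -
  have "(\<Sum>k\<in>UNIV. (X $ i $ k) ((mone_star $ k $ j) \<phi>)) = (X $ i $ j) \<phi>" for i j \<phi>
  proof -
    have "(X $ i $ k) (if test_fun \<phi> then \<phi> else 0) = (X $ i $ k) \<phi>" "(X $ i $ k) 0 = 0" for k
      using assms additive_dist_0[of "X $ i $ k"] by (auto simp: additive_mat_def additive_dist_def)
    then have "(\<Sum>k\<in>UNIV. (X $ i $ k) ((mone_star $ k $ j) \<phi>)) = (\<Sum>k\<in>UNIV. if k = j then (X $ i $ k) \<phi> else 0)"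
      by (intro sum.cong refl) (auto simp: mone_star_def one_star_apply)
    then show ?thesis by simp
  qed
  then show ?thesis by (simp add: vec_eq_iff mstar_nth)
qed

text \<open>
  The usual computation \<open>Z = Z \<star> (X \<star> Y) = (Z \<star> X) \<star> Y = Y\<close>. Only \<open>Z\<close> is an arbitrary
  matrix over \<open>DI\<close>, and it occurs only as the outermost factor, where additivity is enough.
\<close>

lemma star_inv_eqI:
  assumes X: "regular_mat X" and Y: "is_star_inverse X Y" "regular_mat Y"
  shows "star_inv X = Y"
  unfolding star_inv_def
proof (rule the_equality)
  fix Z assume Z: "is_star_inverse X Z"
  then have add: "additive_mat Z"
    by (simp add: is_star_inverse_def additive_mat_def additive_dist_DI)
  have "Z = Z \<star> (X \<star> Y)" using Y add by (simp add: is_star_inverse_def mstar_one_right)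
  also have "\<dots> = (Z \<star> X) \<star> Y" using add X Y by (simp add: mstar_assoc)
  also have "\<dots> = Y" using Z Y by (simp add: is_star_inverse_def mstar_one_left)
  finally show "Z = Y" .
qed (rule Y)

section \<open>Linear differential equations with analytic coefficients\<close>

lemma bounded_bilinear_matrix_mult:
  "bounded_bilinear ((**) :: complex^'n^'n \<Rightarrow> complex^'n^'n \<Rightarrow> complex^'n^'n)"
proof -
  have "bilinear ((**) :: complex^'n^'n \<Rightarrow> complex^'n^'n \<Rightarrow> complex^'n^'n)"
    unfolding bilinear_def
    by (auto intro!: linearI simp: matrix_add_ldistrib vec_eq_iff matrix_matrix_mult_def
        sum.distrib distrib_right distrib_left scaleR_right.sum)
  then show ?thesis by (simp add: bilinear_conv_bounded_bilinear)
qed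

lemma bounded_bilinear_uminus_flip:
  assumes "bounded_bilinear mul"
  shows "bounded_bilinear (\<lambda>x y. - mul y x)"
proof -
  interpret bounded_bilinear mul by (rule assms)
  show ?thesis
  proof
    show "\<exists>K. \<forall>a b. norm (- mul b a) \<le> norm a * norm b * K"
      using bounded by (auto simp: mult_ac)
  qed (simp_all add: add_left add_right scaleR_left scaleR_right)
qed

lemma has_vector_derivative_series:
  fixes f :: "nat \<Rightarrow> real \<Rightarrow> 'a::banach"
  assumes S: "convex S" "x \<in> S"
    and der: "\<And>n x. x \<in> S \<Longrightarrow> (f n has_vector_derivative f' n x) (at x within S)"
    and lim: "\<And>n x. x \<in> S \<Longrightarrow> norm (f' n x) \<le> B n" "summable B"
    and sm: "\<And>x. x \<in> S \<Longrightarrow> summable (\<lambda>n. f n x)"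
  shows "((\<lambda>x. \<Sum>n. f n x) has_vector_derivative (\<Sum>n. f' n x)) (at x within S)"
proof -
  have ul: "uniform_limit S (\<lambda>n x. \<Sum>i<n. f' i x) (\<lambda>x. \<Sum>i. f' i x) sequentially"
    by (rule Weierstrass_m_test[OF lim])
  have "\<exists>g. \<forall>x\<in>S. (\<lambda>n. f n x) sums g x \<and> (g has_derivative (\<lambda>h::real. h *\<^sub>R (\<Sum>n. f' n x))) (at x within S)"
  proof (rule has_derivative_series[where f' = "\<lambda>n x (h::real). h *\<^sub>R f' n x"])
    fix e :: real assume "e > 0"
    from uniform_limitD[OF ul this]
    show "\<forall>\<^sub>F n in sequentially. \<forall>x\<in>S. \<forall>h::real. norm ((\<Sum>i<n. h *\<^sub>R f' i x) - h *\<^sub>R (\<Sum>n. f' n x)) \<le> e * norm h"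
    proof eventually_elim
      case (elim n)
      show ?case
      proof (intro ballI allI)
        fix x h :: real assume "x \<in> S"
        then have "norm h * norm ((\<Sum>i<n. f' i x) - (\<Sum>n. f' n x)) \<le> norm h * e"
          using elim by (intro mult_left_mono) (auto simp: dist_norm less_imp_le)
        then show "norm ((\<Sum>i<n. h *\<^sub>R f' i x) - h *\<^sub>R (\<Sum>n. f' n x)) \<le> e * norm h"
          by (simp add: mult.commute flip: scaleR_sum_right scaleR_diff_right)
      qed
    qed
  qed (use S der sm in \<open>auto simp: has_vector_derivative_def intro: summable_sums\<close>)
  then obtain g where g: "\<And>x. x \<in> S \<Longrightarrow> (\<lambda>n. f n x) sums g x"
    "\<And>x. x \<in> S \<Longrightarrow> (g has_vector_derivative (\<Sum>n. f' n x)) (at x within S)"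
    by (auto simp: has_vector_derivative_def)
  show ?thesis
    by (rule has_vector_derivative_transform[OF S(2) _ g(2)[OF S(2)]]) (use g(1) in \<open>auto simp: sums_iff\<close>)
qed

text \<open>
  The sum over all pairs converges absolutely, and grouping the pairs by their total degree gives the Cauchy
  product. It is applied to the matrix product and to its reversal, hence the general bilinear map.
\<close>

lemma Cauchy_product_bilinear:
  fixes mul :: "'a::banach \<Rightarrow> 'b::banach \<Rightarrow> 'c::banach"
  assumes mul: "bounded_bilinear mul"
    and a: "summable (\<lambda>n. norm (a n))" and b: "summable (\<lambda>n. norm (b n))"
  shows "(\<lambda>k. \<Sum>i\<le>k. mul (a i) (b (k - i))) sums mul (\<Sum>n. a n) (\<Sum>n. b n)"
proof -
  interpret mul: bounded_bilinear mul by (rule mul)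
  obtain K where K: "K > 0" "\<And>x y. norm (mul x y) \<le> norm x * norm y * K"
    using mul.pos_bounded by blast
  have A: "(a has_sum (\<Sum>n. a n)) UNIV" "(\<lambda>n. norm (a n)) summable_on UNIV"
    and B: "(b has_sum (\<Sum>n. b n)) UNIV" "(\<lambda>n. norm (b n)) summable_on UNIV"
    using a b by (auto intro!: norm_summable_imp_has_sum summable_sums norm_summable_imp_summable_on
        intro: summable_norm_cancel)
  have "(\<lambda>p. norm (a (fst p)) * norm (b (snd p)) * K) summable_on (UNIV \<times> UNIV)"
  proof (rule summable_on_SigmaI)
    show "((\<lambda>n. norm (a (fst (m, n))) * norm (b (snd (m, n))) * K) has_sum
        norm (a m) * (\<Sum>\<^sub>\<infinity>n. norm (b n)) * K) UNIV" for m
      using has_sum_cmult_left[OF has_sum_cmult_right[OF has_sum_infsum[OF B(2)], of "norm (a m)"], of K]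
      by simp
    show "(\<lambda>m. norm (a m) * (\<Sum>\<^sub>\<infinity>n. norm (b n)) * K) summable_on UNIV"
      by (intro summable_on_cmult_left A)
  qed (use K in auto)
  then have "(\<lambda>p. norm (case p of (m, n) \<Rightarrow> mul (a m) (b n))) summable_on (UNIV \<times> UNIV)"
    by (rule summable_on_comparison_test) (use K in auto)
  then have "(\<lambda>(m, n). mul (a m) (b n)) summable_on (UNIV \<times> UNIV)"
    by (rule abs_summable_summable)
  then have "((\<lambda>(m, n). mul (a m) (b n)) has_sum mul (\<Sum>n. a n) (\<Sum>n. b n)) (UNIV \<times> UNIV)"
    by (intro has_sum_SigmaI[where g = "\<lambda>m. mul (a m) (\<Sum>n. b n)"])
       (auto intro!: has_sum_bounded_linear[OF mul.bounded_linear_right B(1)]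
          has_sum_bounded_linear[OF mul.bounded_linear_left A(1)])
  also have "?this \<longleftrightarrow> ((\<lambda>(k, i). mul (a i) (b (k - i))) has_sum mul (\<Sum>n. a n) (\<Sum>n. b n)) (SIGMA k:UNIV. {..k})"
    by (rule has_sum_reindex_bij_witness[where i = "\<lambda>(k, i). (i, k - i)" and j = "\<lambda>(m, n). (m + n, m)"]) auto
  finally have "((\<lambda>k. \<Sum>i\<le>k. mul (a i) (b (k - i))) has_sum mul (\<Sum>n. a n) (\<Sum>n. b n)) UNIV"
    by (rule has_sum_SigmaD) (auto intro!: has_sum_finiteI)
  then show ?thesis by (rule has_sum_imp_sums)
qed

section \<open>Picard iteration\<close>

text \<open>
  The map \<open>mul\<close> is a parameter so that the equations \<open>Y' = A Y\<close> and \<open>Y' = - Y A\<close> are covered together.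
\<close>

primrec picard :: "('a \<Rightarrow> 'a \<Rightarrow> 'a) \<Rightarrow> (real \<Rightarrow> 'a) \<Rightarrow> 'a \<Rightarrow> nat \<Rightarrow> real \<Rightarrow> 'a::banach" where
  "picard mul A y 0 = (\<lambda>t. y)"
| "picard mul A y (Suc k) = (\<lambda>t. integral {0..t} (\<lambda>s. mul (A s) (picard mul A y k s)))"

context
  fixes mul :: "'a::banach \<Rightarrow> 'a \<Rightarrow> 'a" and A :: "real \<Rightarrow> 'a" and y :: 'a
  assumes mul: "bounded_bilinear mul" and A: "continuous_on I01 A"
begin

lemma picard_continuous: "continuous_on I01 (picard mul A y k)"
proof (induction k)
  case (Suc k)
  have "continuous_on I01 (\<lambda>s. mul (A s) (picard mul A y k s))"
    by (rule bounded_bilinear.continuous_on[OF mul A Suc])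
  from integral_has_vector_derivative[OF this]
  show ?case unfolding picard.simps by (rule continuous_on_vector_derivative)
qed simp

lemma picard_derivative:
  assumes "t \<in> I01"
  shows "(picard mul A y 0 has_vector_derivative 0) (at t within I01)"
    and "(picard mul A y (Suc k) has_vector_derivative mul (A t) (picard mul A y k t)) (at t within I01)"
  using integral_has_vector_derivative[OF bounded_bilinear.continuous_on[OF mul A picard_continuous[of k]] assms]
  by simp_all

lemma picard_bound:
  obtains M where "M \<ge> 0" "\<And>k t. t \<in> I01 \<Longrightarrow> norm (picard mul A y k t) \<le> norm y * M ^ k / fact k"
proof -
  obtain K where K: "K > 0" "\<And>x y. norm (mul x y) \<le> norm x * norm y * K"
    using bounded_bilinear.pos_bounded[OF mul] by blast
  obtain a where a: "a > 0" "\<And>t. t \<in> I01 \<Longrightarrow> norm (A t) \<le> a"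
    using compact_imp_bounded[OF compact_continuous_image[OF A]] by (auto simp: bounded_pos)
  define M where "M = K * a"
  have M: "norm (mul (A t) x) \<le> M * norm x" if "t \<in> I01" for t x
  proof -
    have "norm (A t) * (norm x * K) \<le> a * (norm x * K)"
      using K a that by (intro mult_right_mono) auto
    then show ?thesis using K(2)[of "A t" x] by (simp add: M_def mult_ac)
  qed
  have M0: "M \<ge> 0" using K a by (simp add: M_def)
  have bound: "norm (picard mul A y k t) \<le> norm y * (M * t) ^ k / fact k" if "t \<in> I01" for k t
    using that
  proof (induction k arbitrary: t)
    case (Suc k)
    let ?g = "\<lambda>s. M * (norm y * (M * s) ^ k / fact k)"
    have c: "continuous_on {0..t} (\<lambda>s. mul (A s) (picard mul A y k s))"
      using Suc.prems by (intro continuous_on_subset[OF bounded_bilinear.continuous_on[OF mul A picard_continuous]]) auto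
    have "((\<lambda>s. norm y * (M * s) ^ Suc k / fact (Suc k)) has_vector_derivative ?g s) (at s within {0..t})" for s
    proof -
      have "((\<lambda>s. (M * s) ^ Suc k) has_real_derivative (1 + real k) * (M * (M * s) ^ k)) (at s within {0..t})"
        by (rule DERIV_power_Suc) (auto intro!: derivative_eq_intros)
      from DERIV_cmult[OF this, of "norm y / fact (Suc k)"]
      moreover have "norm y / fact (Suc k) * ((1 + real k) * (M * (M * s) ^ k)) = ?g s"
        by (simp add: divide_simps add_pos_nonneg)
      ultimately show ?thesis
        by (simp add: has_real_derivative_iff_has_vector_derivative[symmetric] mult_ac)
    qed
    from fundamental_theorem_of_calculus[OF _ this] Suc.prems
    have "(?g has_integral norm y * (M * t) ^ Suc k / fact (Suc k)) {0..t}" by simp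
    moreover have "norm (mul (A s) (picard mul A y k s)) \<le> ?g s" if "s \<in> {0..t}" for s
    proof -
      have s: "s \<in> I01" using that Suc.prems by auto
      have "M * norm (picard mul A y k s) \<le> ?g s"
        by (rule mult_left_mono[OF Suc.IH[OF s] M0])
      then show ?thesis using M[OF s, of "picard mul A y k s"] by linarith
    qed
    ultimately show ?case
      using integral_norm_bound_integral[OF integrable_continuous_real[OF c], of ?g]
      by (auto simp: has_integral_iff)
  qed simp
  have "norm (picard mul A y k t) \<le> norm y * M ^ k / fact k" if "t \<in> I01" for k t
  proof -
    have "(M * t) ^ k \<le> M ^ k" using that M0 by (intro power_mono) (auto simp: mult_left_le)
    then have "norm y * (M * t) ^ k / fact k \<le> norm y * M ^ k / fact k"
      by (intro divide_right_mono mult_left_mono) auto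
    then show ?thesis using bound[OF that, of k] by linarith
  qed
  with M0 show thesis by (rule that)
qed

text \<open>
  Termwise differentiation shifts the index of the series by one and pulls out the factor \<open>A\<close>; the shifted
  series is majorised by a multiple of the same bound.
\<close>

lemma series_solution:
  assumes S: "convex S" "t \<in> S" "S \<subseteq> I01"
    and u0: "\<And>t. t \<in> S \<Longrightarrow> (u 0 has_vector_derivative 0) (at t within S)"
    and uS: "\<And>k t. t \<in> S \<Longrightarrow> (u (Suc k) has_vector_derivative mul (A t) (u k t)) (at t within S)"
    and B: "\<And>k t. t \<in> S \<Longrightarrow> norm (u k t) \<le> B k" "summable B"
  shows "((\<lambda>t. \<Sum>k. u k t) has_vector_derivative mul (A t) (\<Sum>k. u k t)) (at t within S)"
proof -
  obtain K where K: "K > 0" "\<And>x y. norm (mul x y) \<le> norm x * norm y * K"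
    using bounded_bilinear.pos_bounded[OF mul] by blast
  obtain a where a: "a > 0" "\<And>t. t \<in> I01 \<Longrightarrow> norm (A t) \<le> a"
    using compact_imp_bounded[OF compact_continuous_image[OF A]] by (auto simp: bounded_pos)
  have B0: "B k \<ge> 0" for k using B(1)[OF S(2), of k] norm_ge_zero by (rule order_trans[rotated])
  define v where "v k t = (case k of 0 \<Rightarrow> 0 | Suc k \<Rightarrow> mul (A t) (u k t))" for k t
  define C where "C k = (case k of 0 \<Rightarrow> 0 | Suc k \<Rightarrow> a * K * B k)" for k
  have sm: "summable (\<lambda>k. u k t)" if "t \<in> S" for t
    by (rule summable_comparison_test'[OF B(2), of 0]) (use B(1) that in auto)
  have "((\<lambda>t. \<Sum>k. u k t) has_vector_derivative (\<Sum>k. v k t)) (at t within S)"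
  proof (rule has_vector_derivative_series[OF S(1,2)])
    show "(u k has_vector_derivative v k t) (at t within S)" if "t \<in> S" for k t
      using u0 uS that by (cases k) (auto simp: v_def)
    show "norm (v k t) \<le> C k" if t: "t \<in> S" for k t
    proof (cases k)
      case (Suc n)
      have "norm (A t) * norm (u n t) * K \<le> a * B n * K"
        using K(1) B0 a B(1) t S(3) by (intro mult_mono mult_right_mono) auto
      then show ?thesis using K(2)[of "A t" "u n t"] Suc by (simp add: v_def C_def mult_ac)
    qed (simp add: v_def C_def)
    have "summable (\<lambda>k. C (Suc k))" by (simp add: C_def summable_mult B)
    then show "summable C" by (simp only: summable_Suc_iff)
  qed (rule sm)
  moreover have "(\<Sum>k. v k t) = mul (A t) (\<Sum>k. u k t)"
  proof -
    have "(\<lambda>k. mul (A t) (u k t)) sums mul (A t) (\<Sum>k. u k t)"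
      by (intro bounded_linear.sums[OF bounded_bilinear.bounded_linear_right[OF mul]] summable_sums sm S)
    then have "(\<lambda>k. v (Suc k) t) sums mul (A t) (\<Sum>k. u k t)" by (simp add: v_def)
    then have "(\<lambda>k. v k t) sums (mul (A t) (\<Sum>k. u k t) + v 0 t)" by (rule sums_Suc)
    then show ?thesis by (simp add: v_def sums_iff)
  qed
  ultimately show ?thesis by simp
qed

end

lemma summable_power_div_fact: "summable (\<lambda>k. c * M ^ k / fact k :: real)"
  using summable_mult[OF summable_exp[of M], of c] by (simp add: field_simps)

section \<open>Local power series solutions\<close>

text \<open>
  The coefficients of a solution of \<open>Y' = A Y\<close> with \<open>Y(0) = y\<close>, found by comparing coefficients, when \<open>A\<close>
  has the coefficients \<open>\<alpha>\<close>.
\<close>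

fun powser_solution :: "('a::real_normed_vector \<Rightarrow> 'a \<Rightarrow> 'a) \<Rightarrow> (nat \<Rightarrow> 'a) \<Rightarrow> 'a \<Rightarrow> nat \<Rightarrow> 'a" where
  "powser_solution mul \<alpha> y 0 = y"
| "powser_solution mul \<alpha> y (Suc n) =
     (1 / real (Suc n)) *\<^sub>R (\<Sum>k\<le>n. mul (\<alpha> k) (powser_solution mul \<alpha> y (n - k)))"

text \<open>
  If \<open>\<alpha>\<close> grows at most like \<open>M L\<^sup>n\<close>, each of the \<open>n + 1\<close> summands of the recursion is bounded by
  \<open>K M L\<^sup>n\<close>, where \<open>K\<close> is the norm of the bilinear map. The factor \<open>1 / (n + 1)\<close> cancels their number,
  so any \<open>L \<ge> K M\<close> is a bound for the growth of the solution, too.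
\<close>

lemma powser_solution_bound:
  assumes mul: "bounded_bilinear mul" and r: "r > 0"
    and \<alpha>: "summable (\<lambda>n. norm (\<alpha> n) * r ^ n)"
  obtains L where "L > 0" "\<And>n. norm (powser_solution mul \<alpha> y n) \<le> norm y * L ^ n"
    "\<And>x. \<bar>x\<bar> * L < 1 \<Longrightarrow> summable (\<lambda>n. norm (x ^ n *\<^sub>R \<alpha> n))"
proof -
  obtain K where K: "K > 0" "\<And>x y. norm (mul x y) \<le> norm x * norm y * K"
    using bounded_bilinear.pos_bounded[OF mul] by blast
  \<comment> \<open>\<open>M\<close> bounds every single term \<open>norm (\<alpha> n) * r ^ n\<close>\<close>
  define M where "M = (\<Sum>n. norm (\<alpha> n) * r ^ n)"
  have \<alpha>M: "norm (\<alpha> n) * r ^ n \<le> M" for n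
    unfolding M_def using sum_le_suminf[OF \<alpha>, of "{n}"] r by simp
  have M0: "M \<ge> 0" using order_trans[OF norm_ge_zero, of "\<alpha> 0"] \<alpha>M[of 0] by simp
  define L where "L = max (1 / r) (K * M)"
  have "1 / r \<le> L" and "K * M \<le> L" by (auto simp: L_def)
  moreover from this(1) have "1 \<le> L * r" using r by (simp add: pos_divide_le_eq)
  ultimately have L: "L > 0" "1 \<le> L * r" "K * M \<le> L"
    using r by (auto intro: less_le_trans[of 0 "1 / r"])
  have \<alpha>L: "norm (\<alpha> n) \<le> M * L ^ n" for n
  proof -
    have "norm (\<alpha> n) * 1 \<le> norm (\<alpha> n) * (L * r) ^ n"
      by (intro mult_left_mono one_le_power L) simp
    also have "\<dots> = norm (\<alpha> n) * r ^ n * L ^ n" by (simp add: power_mult_distrib)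
    also have "\<dots> \<le> M * L ^ n" using L by (intro mult_right_mono \<alpha>M) simp
    finally show ?thesis by simp
  qed
  have "norm (powser_solution mul \<alpha> y n) \<le> norm y * L ^ n" for n
  proof (induction n rule: less_induct)
    case (less n)
    show ?case
    proof (cases n)
      case (Suc m)
      have "norm (\<Sum>k\<le>m. mul (\<alpha> k) (powser_solution mul \<alpha> y (m - k))) \<le> (\<Sum>k\<le>m. norm y * L ^ n)"
      proof (rule sum_norm_le)
        fix k assume k: "k \<in> {..m}"
        have "norm (mul (\<alpha> k) (powser_solution mul \<alpha> y (m - k))) \<le> (M * L ^ k) * (norm y * L ^ (m - k)) * K"
          using K(1) M0 L(1) less.IH[of "m - k"] Suc
          by (intro order_trans[OF K(2)] mult_right_mono mult_mono \<alpha>L) auto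
        also have "\<dots> = (K * M) * (norm y * (L ^ k * L ^ (m - k)))" by (simp add: mult_ac)
        also have "L ^ k * L ^ (m - k) = L ^ m" using k by (simp flip: power_add)
        also have "(K * M) * (norm y * L ^ m) \<le> L * (norm y * L ^ m)"
          using L by (intro mult_right_mono) auto
        also have "\<dots> = norm y * L ^ n" by (simp add: Suc)
        finally show "norm (mul (\<alpha> k) (powser_solution mul \<alpha> y (m - k))) \<le> norm y * L ^ n" .
      qed
      then show ?thesis by (simp add: Suc field_simps del: of_nat_Suc)
    qed simp
  qed
  moreover have "summable (\<lambda>n. norm (x ^ n *\<^sub>R \<alpha> n))" if x: "\<bar>x\<bar> * L < 1" for x
  proof (rule summable_comparison_test')
    show "summable (\<lambda>n. M * (\<bar>x\<bar> * L) ^ n)" using x L by (intro summable_mult summable_geometric) auto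
    show "norm (norm (x ^ n *\<^sub>R \<alpha> n)) \<le> M * (\<bar>x\<bar> * L) ^ n" for n
      using mult_left_mono[OF \<alpha>L[of n], of "\<bar>x\<bar> ^ n"] by (simp add: power_mult_distrib power_abs mult_ac)
  qed
  ultimately show thesis using L(1) by (intro that)
qed

lemma powser_solution:
  fixes \<alpha> :: "nat \<Rightarrow> 'a::banach"
  assumes mul: "bounded_bilinear mul" and r: "r > 0"
    and \<alpha>: "summable (\<lambda>n. norm (\<alpha> n) * r ^ n)"
  obtains \<rho> P where "\<rho> > 0" "P 0 = y"
    "\<And>x. \<bar>x\<bar> < \<rho> \<Longrightarrow> (\<lambda>n. x ^ n *\<^sub>R powser_solution mul \<alpha> y n) sums P x"
    "\<And>x S. \<bar>x\<bar> < \<rho> \<Longrightarrow> (P has_vector_derivative mul (\<Sum>n. x ^ n *\<^sub>R \<alpha> n) (P x)) (at x within S)"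
proof -
  let ?c = "powser_solution mul \<alpha> y"
  obtain L where L: "L > 0" "\<And>n. norm (?c n) \<le> norm y * L ^ n"
    "\<And>x. \<bar>x\<bar> * L < 1 \<Longrightarrow> summable (\<lambda>n. norm (x ^ n *\<^sub>R \<alpha> n))"
    by (rule powser_solution_bound[OF mul r \<alpha>, of y]; rule that; assumption)
  \<comment> \<open>half the radius \<open>1 / L\<close>, for summability of the differentiated majorant\<close>
  define \<rho> where "\<rho> = 1 / (2 * L)"
  have \<rho>: "\<rho> > 0" "\<rho> * L = 1 / 2" using L by (auto simp: \<rho>_def)
  define P where "P x = (\<Sum>n. x ^ n *\<^sub>R ?c n)" for x
  have xL: "\<bar>x\<bar> * L < 1" if "\<bar>x\<bar> < \<rho>" for x
    using mult_strict_right_mono[OF that L(1)] \<rho> by simp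
  have sm: "summable (\<lambda>n. norm (x ^ n *\<^sub>R ?c n))" if "\<bar>x\<bar> < \<rho>" for x
  proof (rule summable_comparison_test')
    show "summable (\<lambda>n. norm y * (\<bar>x\<bar> * L) ^ n)"
      using xL[OF that] L by (intro summable_mult summable_geometric) auto
    show "norm (norm (x ^ n *\<^sub>R ?c n)) \<le> norm y * (\<bar>x\<bar> * L) ^ n" for n
      using mult_left_mono[OF L(2)[of n], of "\<bar>x\<bar> ^ n"] by (simp add: power_mult_distrib power_abs mult_ac)
  qed
  have P: "(\<lambda>n. x ^ n *\<^sub>R ?c n) sums P x" if "\<bar>x\<bar> < \<rho>" for x
    unfolding P_def using summable_norm_cancel[OF sm[OF that]] by (rule summable_sums)
  have P0: "P 0 = y"
    unfolding P_def by (subst suminf_finite[of "{0}"]) auto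
  have der: "(P has_vector_derivative mul (\<Sum>n. x ^ n *\<^sub>R \<alpha> n) (P x)) (at x within S)"
    if x: "\<bar>x\<bar> < \<rho>" for x S
  proof -
    have "(P has_vector_derivative (\<Sum>n. (real n * x ^ (n - 1)) *\<^sub>R ?c n)) (at x within {-\<rho><..<\<rho>})"
      unfolding P_def[abs_def]
    proof (rule has_vector_derivative_series)
      show "((\<lambda>x. x ^ n *\<^sub>R ?c n) has_vector_derivative (real n * x ^ (n - 1)) *\<^sub>R ?c n) (at x within {-\<rho><..<\<rho>})" for n x
        by (auto intro!: derivative_eq_intros simp: has_vector_derivative_def scaleR_scaleR mult_ac)
      show "norm ((real n * x ^ (n - 1)) *\<^sub>R ?c n) \<le> norm y * L * (real n * (1/2) ^ (n - 1))"
        if "x \<in> {-\<rho><..<\<rho>}" for n x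
      proof (cases n)
        case (Suc m)
        have "\<bar>x\<bar> ^ m * norm (?c n) \<le> \<rho> ^ m * (norm y * L ^ n)"
          using that L by (intro mult_mono power_mono) auto
        also have "\<dots> = norm y * L * (\<rho> * L) ^ m" by (simp add: Suc power_mult_distrib)
        finally have "\<bar>x\<bar> ^ m * norm (?c n) \<le> norm y * L * (1/2) ^ m" unfolding \<rho>(2) .
        from mult_left_mono[OF this, of "real n"] show ?thesis
          by (simp add: Suc power_abs mult_ac abs_mult del: of_nat_Suc powser_solution.simps)
      qed simp
      have "(\<lambda>n. real (Suc n) * (1/2) ^ n) sums (1 / (1 - 1/2)^2)"
        by (rule geometric_deriv_sums) simp
      then have "summable (\<lambda>n. real (Suc n) * (1/2) ^ (Suc n - 1))"
        by (auto simp: sums_iff)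
      then have "summable (\<lambda>n. real n * (1/2) ^ (n - 1))"
        by (subst (asm) summable_Suc_iff)
      then show "summable (\<lambda>n. norm y * L * (real n * (1/2) ^ (n - 1)))"
        by (rule summable_mult)
      show "summable (\<lambda>n. x ^ n *\<^sub>R ?c n)" if "x \<in> {-\<rho><..<\<rho>}" for x
        using that by (intro summable_norm_cancel[OF sm]) auto
    qed (use x in auto)
    moreover have "at x within {-\<rho><..<\<rho>} = at x"
      by (rule at_within_open) (use x in auto)
    ultimately have D: "(P has_vector_derivative (\<Sum>n. (real n * x ^ (n - 1)) *\<^sub>R ?c n)) (at x)"
      by simp
    have "(\<lambda>k. \<Sum>i\<le>k. mul (x ^ i *\<^sub>R \<alpha> i) (x ^ (k - i) *\<^sub>R ?c (k - i))) sums
        mul (\<Sum>n. x ^ n *\<^sub>R \<alpha> n) (P x)"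
      unfolding P_def using L(3)[OF xL[OF x]] sm[OF x] by (rule Cauchy_product_bilinear[OF mul])
    moreover have "(\<Sum>i\<le>k. mul (x ^ i *\<^sub>R \<alpha> i) (x ^ (k - i) *\<^sub>R ?c (k - i))) = (real (Suc k) * x ^ k) *\<^sub>R ?c (Suc k)" for k
    proof -
      have "mul (x ^ i *\<^sub>R \<alpha> i) (x ^ (k - i) *\<^sub>R ?c (k - i)) = x ^ k *\<^sub>R mul (\<alpha> i) (?c (k - i))" if "i \<le> k" for i
        using that by (simp add: bounded_bilinear.scaleR_left[OF mul] bounded_bilinear.scaleR_right[OF mul]
            mult.commute flip: power_add)
      then have "(\<Sum>i\<le>k. mul (x ^ i *\<^sub>R \<alpha> i) (x ^ (k - i) *\<^sub>R ?c (k - i))) = x ^ k *\<^sub>R (\<Sum>i\<le>k. mul (\<alpha> i) (?c (k - i)))"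
        by (simp add: scaleR_sum_right)
      then show ?thesis by (simp add: scaleR_scaleR del: of_nat_Suc)
    qed
    ultimately have "(\<lambda>k. (real (Suc k) * x ^ (Suc k - 1)) *\<^sub>R ?c (Suc k)) sums mul (\<Sum>n. x ^ n *\<^sub>R \<alpha> n) (P x)"
      by simp
    then have "(\<lambda>k. (real k * x ^ (k - 1)) *\<^sub>R ?c k) sums mul (\<Sum>n. x ^ n *\<^sub>R \<alpha> n) (P x)"
      by (subst (asm) sums_Suc_iff) simp
    with D show ?thesis by (simp add: sums_iff has_vector_derivative_at_within del: powser_solution.simps)
  qed
  show thesis by (rule that[OF \<rho>(1) P0 P der])
qed

section \<open>Matrix-valued functions\<close>

interpretation matrix_mult: bounded_bilinear "(**) :: complex^'n^'n \<Rightarrow> complex^'n^'n \<Rightarrow> complex^'n^'n"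
  by (rule bounded_bilinear_matrix_mult)

lemma bounded_linear_entry: "bounded_linear (\<lambda>M :: complex^'n^'m. M $ i $ j)"
  using bounded_linear_compose[OF bounded_linear_vec_nth bounded_linear_vec_nth] .

lemma scaleR_entry: "(x *\<^sub>R (M :: complex^'n^'m)) $ i $ j = M $ i $ j * of_real x"
  unfolding vector_scaleR_component by (simp add: scaleR_conv_of_real mult.commute)

lemma has_vector_derivative_entry:
  fixes f :: "real \<Rightarrow> complex^'n^'m"
  shows "(f has_vector_derivative f') F \<Longrightarrow> ((\<lambda>t. f t $ i $ j) has_vector_derivative f' $ i $ j) F"
  by (rule bounded_linear.has_vector_derivative[OF bounded_linear_entry])

lemma has_vector_derivative_matrixI:
  fixes f :: "real \<Rightarrow> complex^'n^'m"
  assumes "\<And>i j. ((\<lambda>t. f t $ i $ j) has_vector_derivative f' $ i $ j) (at t within S)"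
  shows "(f has_vector_derivative f') (at t within S)"
  unfolding has_vector_derivative_def has_derivative_within
proof (intro conjI vec_tendstoI)
  fix i j
  show "((\<lambda>y. ((1 / norm (y - t)) *\<^sub>R (f y - (f t + (y - t) *\<^sub>R f'))) $ i $ j) \<longlongrightarrow> 0 $ i $ j) (at t within S)"
    using assms[of i j] unfolding has_vector_derivative_def has_derivative_within by simp
qed (rule bounded_linear_scaleR_left)

lemma continuous_on_matrixI:
  fixes f :: "'a::topological_space \<Rightarrow> complex^'n^'m"
  assumes "\<And>i j. continuous_on S (\<lambda>x. f x $ i $ j)"
  shows "continuous_on S f"
proof -
  have "continuous_on S (\<lambda>x. \<chi> i j. f x $ i $ j)"
    by (intro continuous_on_vec_lambda assms)
  then show ?thesis by simp
qed

lemma continuous_on_entry: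
  fixes f :: "'a::topological_space \<Rightarrow> complex^'n^'m"
  shows "continuous_on S f \<Longrightarrow> continuous_on S (\<lambda>x. f x $ i $ j)"
  by (intro continuous_intros)

lemma norm_matrix_le_sum: "norm (M :: complex^'n^'m) \<le> (\<Sum>i\<in>UNIV. \<Sum>j\<in>UNIV. norm (M $ i $ j))"
proof -
  have "norm M \<le> (\<Sum>i\<in>UNIV. norm (M $ i))" unfolding norm_vec_def by (rule L2_set_le_sum) simp
  also have "\<dots> \<le> (\<Sum>i\<in>UNIV. \<Sum>j\<in>UNIV. norm (M $ i $ j))"
    by (intro sum_mono, subst (1) norm_vec_def, rule L2_set_le_sum) simp
  finally show ?thesis .
qed

lemma sums_matrixI:
  fixes f :: "nat \<Rightarrow> complex^'n^'m"
  assumes "\<And>i j. (\<lambda>n. f n $ i $ j) sums (a $ i $ j)"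
  shows "f sums a"
  using assms unfolding sums_def by (intro vec_tendstoI) (simp add: sum_component)

lemma analytic_I_continuous: "analytic_I f \<Longrightarrow> continuous_on I01 f"
  using smooth_continuous_on[OF analytic_II_smooth_left[OF analytic_II_tensor[OF _ analytic_I_const[of 1]], of f 0]]
  by simp

lemma matrix_germ:
  fixes M :: "real \<Rightarrow> complex^'n^'m"
  assumes M: "\<And>i j. analytic_I (\<lambda>t. M t $ i $ j)" and t0: "t0 \<in> I01"
  obtains r \<alpha> where "r > 0" "summable (\<lambda>n. norm (\<alpha> n) * r ^ n)"
    "\<And>t. t \<in> I01 \<Longrightarrow> \<bar>t - t0\<bar> \<le> r \<Longrightarrow> (\<lambda>n. (t - t0) ^ n *\<^sub>R \<alpha> n) sums M t"
proof -
  define Q where "Q i j r c \<longleftrightarrow> 0 < r \<and>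
    (\<forall>x::real. \<bar>x\<bar> \<le> r \<longrightarrow> summable (\<lambda>n. norm (c n * of_real (x ^ n)))) \<and>
    (\<forall>t\<in>I01. \<bar>t - t0\<bar> \<le> r \<longrightarrow> (\<lambda>n. c n * of_real ((t - t0) ^ n)) sums (M t $ i $ j))" for i j r c
  have "\<exists>r c. Q i j r c" for i j
  proof (rule analytic_I_germ[OF M[of i j] t0])
    fix r c
    assume h: "0 < r" "\<And>x::real. \<bar>x\<bar> \<le> r \<Longrightarrow> summable (\<lambda>n. norm (c n * of_real (x ^ n)))"
      "\<And>t. t \<in> I01 \<Longrightarrow> \<bar>t - t0\<bar> \<le> r \<Longrightarrow> (\<lambda>n. c n * of_real ((t - t0) ^ n)) sums (M t $ i $ j)"
    show ?thesis
      unfolding Q_def by (intro exI[of _ r] exI[of _ c] conjI allI ballI impI h)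
  qed
  then obtain R C where "\<And>i j. Q i j (R i j) (C i j)" by metis
  then have R: "\<And>i j. 0 < R i j"
    and sm: "\<And>i j x::real. \<bar>x\<bar> \<le> R i j \<Longrightarrow> summable (\<lambda>n. norm (C i j n * of_real (x ^ n)))"
    and C: "\<And>i j t. t \<in> I01 \<Longrightarrow> \<bar>t - t0\<bar> \<le> R i j \<Longrightarrow> (\<lambda>n. C i j n * of_real ((t - t0) ^ n)) sums (M t $ i $ j)"
    unfolding Q_def by blast+
  define r where "r = Min (range (\<lambda>(i, j). R i j))"
  have r: "r > 0" "r \<le> R i j" for i j
    using R Min_le[OF _ rangeI[of "\<lambda>(i, j). R i j" "(i, j)"]] by (auto simp: r_def)
  define \<alpha> :: "nat \<Rightarrow> complex^'n^'m" where "\<alpha> n = (\<chi> i j. C i j n)" for n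
  have "summable (\<lambda>n. \<Sum>i\<in>UNIV. \<Sum>j\<in>UNIV. norm (C i j n * of_real (r ^ n)))"
    using r by (intro summable_sum sm) auto
  then have "summable (\<lambda>n. norm (\<alpha> n) * r ^ n)"
  proof (rule summable_comparison_test'[where N = 0])
    fix n :: nat
    have "norm (\<alpha> n) * r ^ n \<le> (\<Sum>i\<in>UNIV. \<Sum>j\<in>UNIV. norm (\<alpha> n $ i $ j)) * r ^ n"
      using r by (intro mult_right_mono norm_matrix_le_sum) simp
    then show "norm (norm (\<alpha> n) * r ^ n) \<le> (\<Sum>i\<in>UNIV. \<Sum>j\<in>UNIV. norm (C i j n * of_real (r ^ n)))"
      using r(1) by (simp add: \<alpha>_def norm_mult norm_power sum_distrib_right)
  qed
  moreover have "(\<lambda>n. (t - t0) ^ n *\<^sub>R \<alpha> n) sums M t" if t: "t \<in> I01" "\<bar>t - t0\<bar> \<le> r" for t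
  proof (rule sums_matrixI)
    fix i j
    have "\<bar>t - t0\<bar> \<le> R i j" using t(2) r(2) by (rule order_trans)
    from C[OF t(1) this] show "(\<lambda>n. ((t - t0) ^ n *\<^sub>R \<alpha> n) $ i $ j) sums (M t $ i $ j)"
      unfolding scaleR_entry by (simp only: \<alpha>_def vec_lambda_beta)
  qed
  ultimately show thesis using r(1) by (intro that)
qed

text \<open>
  Around any point the solution agrees with the power series solution having the same value there, because
  their difference solves the homogeneous equation and vanishes at the centre.
\<close>

lemma analytic_solution:
  fixes A Y :: "real \<Rightarrow> complex^'n^'n"
  assumes mul: "bounded_bilinear mul"
    and A: "\<And>i j. analytic_I (\<lambda>t. A t $ i $ j)"
    and Y: "\<And>t. t \<in> I01 \<Longrightarrow> (Y has_vector_derivative mul (A t) (Y t)) (at t within I01)"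
    and unique: "\<And>a b Z c t. {a..b} \<subseteq> I01 \<Longrightarrow> c \<in> {a..b} \<Longrightarrow> Z c = 0 \<Longrightarrow>
      (\<And>t. t \<in> {a..b} \<Longrightarrow> (Z has_vector_derivative mul (A t) (Z t)) (at t within {a..b})) \<Longrightarrow>
      t \<in> {a..b} \<Longrightarrow> Z t = 0"
  shows "analytic_I (\<lambda>t. Y t $ i $ j)"
  unfolding analytic_I_def
proof (intro ballI)
  fix t0 assume t0: "t0 \<in> I01"
  obtain r \<alpha> where r: "r > 0" and \<alpha>: "summable (\<lambda>n. norm (\<alpha> n) * r ^ n)"
    "\<And>t. t \<in> I01 \<Longrightarrow> \<bar>t - t0\<bar> \<le> r \<Longrightarrow> (\<lambda>n. (t - t0) ^ n *\<^sub>R \<alpha> n) sums A t"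
    by (rule matrix_germ[OF A t0]; rule that; assumption)
  let ?c = "powser_solution mul \<alpha> (Y t0)"
  obtain \<rho> P where \<rho>: "\<rho> > 0" and P0: "P 0 = Y t0"
    and Ps: "\<And>x. \<bar>x\<bar> < \<rho> \<Longrightarrow> (\<lambda>n. x ^ n *\<^sub>R ?c n) sums P x"
    and Pd: "\<And>x S. \<bar>x\<bar> < \<rho> \<Longrightarrow> (P has_vector_derivative mul (\<Sum>n. x ^ n *\<^sub>R \<alpha> n) (P x)) (at x within S)"
    by (rule powser_solution[OF mul r \<alpha>(1), of "Y t0"]; rule that; assumption)
  define \<sigma> where "\<sigma> = min \<rho> r"
  have eq: "Y t = P (t - t0)" if t: "t \<in> I01" "\<bar>t - t0\<bar> < \<sigma>" for t
  proof -
    let ?J = "{min t0 t..max t0 t}"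
    have "Y t - P (t - t0) = 0"
    proof (rule unique[of "min t0 t" "max t0 t" t0 "\<lambda>t. Y t - P (t - t0)"])
      fix x assume x: "x \<in> ?J"
      then have x': "x \<in> I01" "\<bar>x - t0\<bar> < \<rho>" "\<bar>x - t0\<bar> \<le> r" and J: "?J \<subseteq> I01"
        using t t0 by (auto simp: \<sigma>_def)
      have "(P has_vector_derivative mul (A x) (P (x - t0))) (at (x - t0) within ((\<lambda>t. t - t0) ` ?J))"
        using Pd[OF x'(2)] \<alpha>(2)[OF x'(1,3)] by (simp add: sums_iff)
      from has_vector_derivative_diff[OF has_vector_derivative_within_subset[OF Y[OF x'(1)] J]
          has_vector_derivative_translate[OF this]]
      show "((\<lambda>t. Y t - P (t - t0)) has_vector_derivative mul (A x) (Y x - P (x - t0))) (at x within ?J)"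
        by (simp add: bounded_bilinear.diff_right[OF mul])
    qed (use t t0 P0 in auto)
    then show ?thesis by simp
  qed
  have entry: "(\<lambda>n. ?c n $ i $ j * of_real ((t - t0) ^ n)) sums (Y t $ i $ j)"
    if t: "t \<in> I01" "\<bar>t - t0\<bar> < \<sigma>" for t
  proof -
    have "\<bar>t - t0\<bar> < \<rho>" using t(2) by (simp add: \<sigma>_def)
    from bounded_linear.sums[OF bounded_linear_entry[of i j] Ps[OF this]]
    show ?thesis unfolding scaleR_entry eq[OF t] .
  qed
  have "\<sigma> > 0" using \<rho> r by (simp add: \<sigma>_def)
  then show "\<exists>r>0. \<exists>c. \<forall>t\<in>I01. \<bar>t - t0\<bar> < r \<longrightarrow>
      (\<lambda>n. c n * of_real ((t - t0) ^ n)) sums (Y t $ i $ j)"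
    by (intro exI[of _ \<sigma>] conjI exI[of _ "\<lambda>n. ?c n $ i $ j"] ballI impI entry)
qed

section \<open>The fundamental solution\<close>

text \<open>
  \<open>fund\<close> is the solution of \<open>\<Phi>' = A \<Phi>\<close> and \<open>inv_fund\<close> the solution of \<open>\<Psi>' = - \<Psi> A\<close>, both with value
  \<open>I\<close> at 0; the terms are their Picard iterates.
\<close>

definition fund_term :: "(real \<Rightarrow> complex^'n^'n) \<Rightarrow> nat \<Rightarrow> real \<Rightarrow> complex^'n^'n" where
  "fund_term A = picard (**) A (mat 1)"

definition inv_fund_term :: "(real \<Rightarrow> complex^'n^'n) \<Rightarrow> nat \<Rightarrow> real \<Rightarrow> complex^'n^'n" where
  "inv_fund_term A = picard (\<lambda>X Y. - (Y ** X)) A (mat 1)"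

definition fund :: "(real \<Rightarrow> complex^'n^'n) \<Rightarrow> real \<Rightarrow> complex^'n^'n" where
  "fund A t = (\<Sum>k. fund_term A k t)"

definition inv_fund :: "(real \<Rightarrow> complex^'n^'n) \<Rightarrow> real \<Rightarrow> complex^'n^'n" where
  "inv_fund A t = (\<Sum>k. inv_fund_term A k t)"

text \<open>
  The part of degree \<open>k\<close> in \<open>A\<close> of the propagator, that is, the coefficient of \<open>\<lambda>\<^sup>k\<close> in the propagator
  of \<open>\<lambda> A\<close>. Writing it as a sum of products of functions of one variable makes its analyticity
  immediate.
\<close>

definition propagator_term :: "(real \<Rightarrow> complex^'n^'n) \<Rightarrow> nat \<Rightarrow> real \<Rightarrow> real \<Rightarrow> complex^'n^'n" where
  "propagator_term A k t s = (\<Sum>j\<le>k. fund_term A j t ** inv_fund_term A (k - j) s)"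

definition propagator :: "(real \<Rightarrow> complex^'n^'n) \<Rightarrow> real \<Rightarrow> real \<Rightarrow> complex^'n^'n" where
  "propagator A t s = fund A t ** inv_fund A s"

lemmas bounded_bilinear_rev = bounded_bilinear_uminus_flip[OF bounded_bilinear_matrix_mult]

lemma exponential_series_convergent:
  fixes u :: "nat \<Rightarrow> real \<Rightarrow> complex^'n^'n"
  assumes "\<And>k t. t \<in> I01 \<Longrightarrow> norm (u k t) \<le> norm y * M ^ k / fact k" "t \<in> I01"
  shows "summable (\<lambda>k. norm (u k t))"
  by (rule summable_comparison_test'[OF summable_power_div_fact]) (use assms in auto)

context
  fixes A :: "real \<Rightarrow> complex^'n^'n"
  assumes A: "continuous_on I01 A"
begin

lemma fund_term_bound:
  obtains M where "M \<ge> 0" "\<And>k t. t \<in> I01 \<Longrightarrow> norm (fund_term A k t) \<le> norm (mat 1 :: complex^'n^'n) * M ^ k / fact k"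
  by (rule picard_bound[OF bounded_bilinear_matrix_mult A, of "mat 1", folded fund_term_def]; rule that; assumption)

lemma inv_fund_term_bound:
  obtains M where "M \<ge> 0" "\<And>k t. t \<in> I01 \<Longrightarrow> norm (inv_fund_term A k t) \<le> norm (mat 1 :: complex^'n^'n) * M ^ k / fact k"
  by (rule picard_bound[OF bounded_bilinear_rev A, of "mat 1", folded inv_fund_term_def]; rule that; assumption)

lemma fund_term_derivative:
  assumes "t \<in> I01"
  shows "(fund_term A 0 has_vector_derivative 0) (at t within I01)"
    and "(fund_term A (Suc k) has_vector_derivative A t ** fund_term A k t) (at t within I01)"
  unfolding fund_term_def using picard_derivative[OF bounded_bilinear_matrix_mult A assms] by blast+

lemma inv_fund_term_derivative:
  assumes "t \<in> I01"
  shows "(inv_fund_term A 0 has_vector_derivative 0) (at t within I01)"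
    and "(inv_fund_term A (Suc k) has_vector_derivative - (inv_fund_term A k t ** A t)) (at t within I01)"
  unfolding inv_fund_term_def using picard_derivative[OF bounded_bilinear_rev A assms] by blast+

lemma fund_derivative:
  assumes "t \<in> I01"
  shows "(fund A has_vector_derivative A t ** fund A t) (at t within I01)"
proof -
  obtain M where M: "\<And>k t. t \<in> I01 \<Longrightarrow> norm (fund_term A k t) \<le> norm (mat 1 :: complex^'n^'n) * M ^ k / fact k"
    by (rule fund_term_bound; rule that; assumption)
  show ?thesis
    unfolding fund_def[abs_def]
    by (rule series_solution[OF bounded_bilinear_matrix_mult A _ assms _ _ _ M summable_power_div_fact])
       (auto intro: fund_term_derivative simp del: atLeastAtMost_iff)
qed

lemma inv_fund_derivative:
  assumes "t \<in> I01"
  shows "(inv_fund A has_vector_derivative - (inv_fund A t ** A t)) (at t within I01)"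
proof -
  obtain M where M: "\<And>k t. t \<in> I01 \<Longrightarrow> norm (inv_fund_term A k t) \<le> norm (mat 1 :: complex^'n^'n) * M ^ k / fact k"
    by (rule inv_fund_term_bound; rule that; assumption)
  show ?thesis
    unfolding inv_fund_def[abs_def]
    by (rule series_solution[OF bounded_bilinear_rev A _ assms _ _ _ M summable_power_div_fact])
       (auto intro: inv_fund_term_derivative simp del: atLeastAtMost_iff)
qed

lemma fund_term_at_0: "fund_term A k 0 = (if k = 0 then mat 1 else 0)"
  and inv_fund_term_at_0: "inv_fund_term A k 0 = (if k = 0 then mat 1 else 0)"
  by (cases k; simp add: fund_term_def inv_fund_term_def)+

lemma fund_at_0: "fund A 0 = mat 1" and inv_fund_at_0: "inv_fund A 0 = mat 1"
proof -
  have "(\<Sum>k::nat. if k = 0 then mat 1 else 0) = (mat 1 :: complex^'n^'n)"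
    by (subst suminf_finite[of "{0}"]) auto
  then show "fund A 0 = mat 1" "inv_fund A 0 = mat 1"
    by (simp_all only: fund_def inv_fund_def fund_term_at_0 inv_fund_term_at_0)
qed

lemma fund_continuous: "continuous_on I01 (fund A)"
  by (rule continuous_on_vector_derivative) (rule fund_derivative)

lemma inv_fund_continuous: "continuous_on I01 (inv_fund A)"
  by (rule continuous_on_vector_derivative) (rule inv_fund_derivative)

text \<open>
  The product \<open>\<Psi> \<Phi>\<close> has derivative \<open>- \<Psi> A \<Phi> + \<Psi> A \<Phi> = 0\<close>, and a left inverse of a square matrix
  is a right inverse.
\<close>

lemma inv_fund_fund:
  assumes "t \<in> I01"
  shows "inv_fund A t ** fund A t = mat 1" and "fund A t ** inv_fund A t = mat 1"
proof -
  have "inv_fund A t ** fund A t = inv_fund A 0 ** fund A 0"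
  proof (rule zero_derivative_constant[where f = "\<lambda>t. inv_fund A t ** fund A t"])
    fix x :: real assume x: "x \<in> I01"
    show "((\<lambda>t. inv_fund A t ** fund A t) has_vector_derivative 0) (at x within I01)"
      using matrix_mult.has_vector_derivative[OF inv_fund_derivative[OF x] fund_derivative[OF x]]
      by (simp add: matrix_mul_assoc matrix_mult.minus_left)
  qed (use assms in auto)
  then show "inv_fund A t ** fund A t = mat 1" by (simp add: fund_at_0 inv_fund_at_0)
  then show "fund A t ** inv_fund A t = mat 1" by (simp add: matrix_left_right_inverse)
qed

text \<open>
  \<open>\<Psi> Z\<close> is constant, so a solution that vanishes somewhere vanishes everywhere.
\<close>

lemma fund_unique:
  fixes Z :: "real \<Rightarrow> complex^'n^'n"
  assumes J: "{a..b} \<subseteq> I01" "c \<in> {a..b}" and Zc: "Z c = 0"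
    and Z: "\<And>t. t \<in> {a..b} \<Longrightarrow> (Z has_vector_derivative A t ** Z t) (at t within {a..b})"
    and t: "t \<in> {a..b}"
  shows "Z t = 0"
proof -
  have "inv_fund A t ** Z t = inv_fund A c ** Z c"
  proof (rule zero_derivative_constant[where f = "\<lambda>t. inv_fund A t ** Z t"])
    fix x assume x: "x \<in> {a..b}"
    then have "x \<in> I01" using J by blast
    from matrix_mult.has_vector_derivative[OF has_vector_derivative_within_subset[OF inv_fund_derivative[OF this] J(1)] Z[OF x]]
    show "((\<lambda>t. inv_fund A t ** Z t) has_vector_derivative 0) (at x within {a..b})"
      by (simp add: matrix_mul_assoc matrix_mult.minus_left)
  qed (use t J in auto)
  then have "fund A t ** (inv_fund A t ** Z t) = 0" by (simp add: Zc matrix_mult.zero_right)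
  moreover have "t \<in> I01" using t J by blast
  ultimately show ?thesis by (simp add: matrix_mul_assoc inv_fund_fund)
qed

lemma inv_fund_unique:
  fixes Z :: "real \<Rightarrow> complex^'n^'n"
  assumes J: "{a..b} \<subseteq> I01" "c \<in> {a..b}" and Zc: "Z c = 0"
    and Z: "\<And>t. t \<in> {a..b} \<Longrightarrow> (Z has_vector_derivative - (Z t ** A t)) (at t within {a..b})"
    and t: "t \<in> {a..b}"
  shows "Z t = 0"
proof -
  have "Z t ** fund A t = Z c ** fund A c"
  proof (rule zero_derivative_constant[where f = "\<lambda>t. Z t ** fund A t"])
    fix x assume x: "x \<in> {a..b}"
    then have "x \<in> I01" using J by blast
    from matrix_mult.has_vector_derivative[OF Z[OF x] has_vector_derivative_within_subset[OF fund_derivative[OF this] J(1)]]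
    show "((\<lambda>t. Z t ** fund A t) has_vector_derivative 0) (at x within {a..b})"
      by (simp add: matrix_mul_assoc matrix_mult.minus_left)
  qed (use t J in auto)
  then have "(Z t ** fund A t) ** inv_fund A t = 0" by (simp add: Zc matrix_mult.zero_left)
  moreover have "t \<in> I01" using t J by blast
  ultimately show ?thesis by (simp add: matrix_mul_assoc[symmetric] inv_fund_fund)
qed

lemma propagator_derivative:
  assumes "t \<in> I01"
  shows "((\<lambda>t. propagator A t s) has_vector_derivative A t ** propagator A t s) (at t within I01)"
  using bounded_linear.has_vector_derivative[OF matrix_mult.bounded_linear_left fund_derivative[OF assms], of "inv_fund A s"]
  by (simp add: propagator_def matrix_mul_assoc)

lemma propagator_derivative_right:
  assumes "s \<in> I01"
  shows "((\<lambda>s. propagator A t s) has_vector_derivative - (propagator A t s ** A s)) (at s within I01)"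
  using bounded_linear.has_vector_derivative[OF matrix_mult.bounded_linear_right inv_fund_derivative[OF assms], of "fund A t"]
  by (simp add: propagator_def matrix_mul_assoc matrix_mult.minus_right)

lemma propagator_diagonal: "t \<in> I01 \<Longrightarrow> propagator A t t = mat 1"
  by (simp add: propagator_def inv_fund_fund)

lemma propagator_term_0: "propagator_term A 0 t s = mat 1"
  by (simp add: propagator_term_def fund_term_def inv_fund_term_def)

lemma propagator_term_Suc:
  "propagator_term A (Suc k) t s = inv_fund_term A (Suc k) s + (\<Sum>j\<le>k. fund_term A (Suc j) t ** inv_fund_term A (k - j) s)"
  unfolding propagator_term_def by (subst sum.atMost_Suc_shift) (simp add: fund_term_def)

lemma propagator_term_Suc_right:
  "propagator_term A (Suc k) t s = (\<Sum>j\<le>k. fund_term A j t ** inv_fund_term A (Suc (k - j)) s) + fund_term A (Suc k) t"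
proof -
  have "(\<Sum>j\<le>k. fund_term A j t ** inv_fund_term A (Suc k - j) s) = (\<Sum>j\<le>k. fund_term A j t ** inv_fund_term A (Suc (k - j)) s)"
    by (intro sum.cong) (auto simp: Suc_diff_le)
  then show ?thesis unfolding propagator_term_def by (simp add: inv_fund_term_def)
qed

lemma propagator_term_derivative:
  assumes t: "t \<in> I01"
  shows "((\<lambda>t. propagator_term A (Suc k) t s) has_vector_derivative A t ** propagator_term A k t s) (at t within I01)"
proof -
  have "((\<lambda>t. inv_fund_term A (Suc k) s + (\<Sum>j\<le>k. fund_term A (Suc j) t ** inv_fund_term A (k - j) s))
      has_vector_derivative 0 + (\<Sum>j\<le>k. (A t ** fund_term A j t) ** inv_fund_term A (k - j) s)) (at t within I01)"
    by (intro has_vector_derivative_add has_vector_derivative_const has_vector_derivative_sum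
        bounded_linear.has_vector_derivative[OF matrix_mult.bounded_linear_left] fund_term_derivative t)
  moreover have "A t ** propagator_term A k t s = (\<Sum>j\<le>k. (A t ** fund_term A j t) ** inv_fund_term A (k - j) s)"
    by (simp add: propagator_term_def matrix_mult.sum_right matrix_mul_assoc)
  ultimately show ?thesis by (simp only: propagator_term_Suc add_0)
qed

lemma propagator_term_derivative_right:
  assumes s: "s \<in> I01"
  shows "((\<lambda>s. propagator_term A (Suc k) t s) has_vector_derivative - (propagator_term A k t s ** A s)) (at s within I01)"
proof -
  have "((\<lambda>s. (\<Sum>j\<le>k. fund_term A j t ** inv_fund_term A (Suc (k - j)) s) + fund_term A (Suc k) t)
      has_vector_derivative (\<Sum>j\<le>k. fund_term A j t ** - (inv_fund_term A (k - j) s ** A s)) + 0) (at s within I01)"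
    by (intro has_vector_derivative_add has_vector_derivative_const has_vector_derivative_sum
        bounded_linear.has_vector_derivative[OF matrix_mult.bounded_linear_right] inv_fund_term_derivative s)
  moreover have "- (propagator_term A k t s ** A s) = (\<Sum>j\<le>k. fund_term A j t ** - (inv_fund_term A (k - j) s ** A s))"
    by (simp add: propagator_term_def matrix_mult.sum_left matrix_mul_assoc matrix_mult.minus_right sum_negf)
  ultimately show ?thesis by (simp only: propagator_term_Suc_right add_0_right)
qed

lemma fund_term_continuous: "continuous_on I01 (fund_term A k)"
  and inv_fund_term_continuous: "continuous_on I01 (inv_fund_term A k)"
  unfolding fund_term_def inv_fund_term_def
  by (intro picard_continuous[OF _ A] bounded_bilinear_matrix_mult bounded_bilinear_rev)+

lemma tensor_continuous:
  fixes f g :: "real \<Rightarrow> complex^'n^'n"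
  assumes "continuous_on I01 f" "continuous_on I01 g"
  shows "continuous_on (I01 \<times> I01) (\<lambda>(t, s). f t ** g s)"
proof -
  have "continuous_on (I01 \<times> I01) (\<lambda>z. f (fst z))" "continuous_on (I01 \<times> I01) (\<lambda>z. g (snd z))"
    by (auto intro!: continuous_on_compose2[OF assms(1)] continuous_on_compose2[OF assms(2)] continuous_intros)
  then show ?thesis unfolding case_prod_unfold by (rule matrix_mult.continuous_on)
qed

lemma propagator_term_continuous: "continuous_on (I01 \<times> I01) (\<lambda>(t, s). propagator_term A k t s)"
  unfolding propagator_term_def case_prod_unfold
  by (intro continuous_on_sum tensor_continuous[unfolded case_prod_unfold] fund_term_continuous inv_fund_term_continuous)

lemma propagator_continuous: "continuous_on (I01 \<times> I01) (\<lambda>(t, s). propagator A t s)"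
  unfolding propagator_def by (intro tensor_continuous fund_continuous inv_fund_continuous)

text \<open>
  The derivative of the diagonal of \<open>w\<^sub>k\<^sub>+\<^sub>1\<close> is the commutator of \<open>A\<close> with the diagonal of \<open>w\<^sub>k\<close>. It vanishes for
  \<open>k = 0\<close>, where \<open>w\<^sub>0 = I\<close>, and then inductively because the diagonal is 0. At the origin all terms of
  \<open>w\<^sub>k\<^sub>+\<^sub>1\<close> vanish.
\<close>

lemma propagator_term_diagonal: "t \<in> I01 \<Longrightarrow> propagator_term A (Suc k) t t = 0"
proof -
  have step: "propagator_term A (Suc k) t t = 0"
    if comm: "\<And>x. x \<in> I01 \<Longrightarrow> A x ** propagator_term A k x x = propagator_term A k x x ** A x"
      and t: "t \<in> I01" for k t
  proof -
    have cont: "continuous_on (I01 \<times> I01) (\<lambda>(t, s). - (propagator_term A k t s ** A s))"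
    proof -
      have "continuous_on (I01 \<times> I01) (\<lambda>z. A (snd z))"
        by (rule continuous_on_compose2[OF A]) (auto intro!: continuous_intros)
      from matrix_mult.continuous_on[OF propagator_term_continuous[of k, unfolded case_prod_unfold] this]
      show ?thesis unfolding case_prod_unfold by (rule continuous_on_minus)
    qed
    have "propagator_term A (Suc k) t t = propagator_term A (Suc k) 0 0"
    proof (rule zero_derivative_constant[where f = "\<lambda>t. propagator_term A (Suc k) t t"])
      fix x :: real assume x: "x \<in> I01"
      have "((\<lambda>t. propagator_term A (Suc k) t t) has_vector_derivative
          A x ** propagator_term A k x x + - (propagator_term A k x x ** A x)) (at x within I01)"
        by (rule diagonal_derivative[OF propagator_term_derivative[OF x] propagator_term_derivative_right cont x])
      then show "((\<lambda>t. propagator_term A (Suc k) t t) has_vector_derivative 0) (at x within I01)"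
        using comm[OF x] by simp
    qed (use t in auto)
    also have "\<dots> = 0"
      unfolding propagator_term_def fund_term_at_0 inv_fund_term_at_0
      by (intro sum.neutral) (auto simp: matrix_mult.zero_left matrix_mult.zero_right)
    finally show ?thesis .
  qed
  show "t \<in> I01 \<Longrightarrow> propagator_term A (Suc k) t t = 0"
    by (induction k arbitrary: t)
       (auto intro!: step simp: propagator_term_0 matrix_mult.zero_left matrix_mult.zero_right)
qed

text \<open>
  The terms of the propagator are those of the Cauchy product of the series for \<open>\<Phi>(t)\<close> and \<open>\<Psi>(s)\<close>.
\<close>

lemma propagator_series:
  assumes "t \<in> I01" "s \<in> I01"
  shows "(\<lambda>k. propagator_term A k t s) sums propagator A t s"
proof -
  obtain M where M: "\<And>k t. t \<in> I01 \<Longrightarrow> norm (fund_term A k t) \<le> norm (mat 1 :: complex^'n^'n) * M ^ k / fact k"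
    by (rule fund_term_bound; rule that; assumption)
  obtain N where N: "\<And>k t. t \<in> I01 \<Longrightarrow> norm (inv_fund_term A k t) \<le> norm (mat 1 :: complex^'n^'n) * N ^ k / fact k"
    by (rule inv_fund_term_bound; rule that; assumption)
  show ?thesis
    unfolding propagator_term_def propagator_def fund_def inv_fund_def
    by (rule Cauchy_product_bilinear[OF bounded_bilinear_matrix_mult exponential_series_convergent[OF M assms(1)]
        exponential_series_convergent[OF N assms(2)]])
qed

lemma propagator_term_bound:
  obtains B where "summable B" "\<And>k t s. t \<in> I01 \<Longrightarrow> s \<in> I01 \<Longrightarrow> norm (propagator_term A k t s) \<le> B k"
proof -
  obtain M where M0: "M \<ge> 0" and M: "\<And>k t. t \<in> I01 \<Longrightarrow> norm (fund_term A k t) \<le> norm (mat 1 :: complex^'n^'n) * M ^ k / fact k"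
    by (rule fund_term_bound; rule that; assumption)
  obtain N where N0: "N \<ge> 0" and N: "\<And>k t. t \<in> I01 \<Longrightarrow> norm (inv_fund_term A k t) \<le> norm (mat 1 :: complex^'n^'n) * N ^ k / fact k"
    by (rule inv_fund_term_bound; rule that; assumption)
  have "\<exists>K>0. \<forall>(X :: complex^'n^'n) (Y :: complex^'n^'n). norm (X ** Y) \<le> norm X * norm Y * K"
    by (rule matrix_mult.pos_bounded)
  then obtain K where K: "K > 0" "\<forall>(X :: complex^'n^'n) (Y :: complex^'n^'n). norm (X ** Y) \<le> norm X * norm Y * K"
    by (elim exE conjE)
  define f where "f k = norm (mat 1 :: complex^'n^'n) * M ^ k / fact k" for k
  define g where "g k = norm (mat 1 :: complex^'n^'n) * N ^ k / fact k" for k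
  have pos: "f k \<ge> 0" "g k \<ge> 0" for k using M0 N0 by (simp_all add: f_def g_def)
  have "summable f" "summable g"
    unfolding f_def[abs_def] g_def[abs_def] by (rule summable_power_div_fact)+
  then have "summable (\<lambda>k. norm (f k))" "summable (\<lambda>k. norm (g k))"
    by (simp_all add: pos)
  from summable_Cauchy_product[OF this] have "summable (\<lambda>k. (\<Sum>j\<le>k. f j * g (k - j)) * K)"
    by (rule summable_mult2)
  moreover have "norm (propagator_term A k t s) \<le> (\<Sum>j\<le>k. f j * g (k - j)) * K"
    if "t \<in> I01" "s \<in> I01" for k t s
    unfolding propagator_term_def sum_distrib_right
  proof (rule sum_norm_le)
    fix j
    have "norm (fund_term A j t) * norm (inv_fund_term A (k - j) s) * K \<le> f j * g (k - j) * K"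
      using M[OF that(1), of j] N[OF that(2), of "k - j"] K(1) pos
      by (intro mult_right_mono mult_mono) (auto simp: f_def g_def)
    then show "norm (fund_term A j t ** inv_fund_term A (k - j) s) \<le> f j * g (k - j) * K"
      by (rule order_trans[OF K(2)[rule_format]])
  qed
  ultimately show thesis by (rule that)
qed

end

context
  fixes A :: "real \<Rightarrow> complex^'n^'n"
  assumes an: "\<And>i j. analytic_I (\<lambda>t. A t $ i $ j)"
begin

lemma analytic_matrix_continuous: "continuous_on I01 A"
  by (intro continuous_on_matrixI analytic_I_continuous an)

lemma fund_analytic: "analytic_I (\<lambda>t. fund A t $ i $ j)"
proof (rule analytic_solution[OF bounded_bilinear_matrix_mult an fund_derivative[OF analytic_matrix_continuous]])
  fix a b c t and Z :: "real \<Rightarrow> complex^'n^'n"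
  assume "{a..b} \<subseteq> I01" "c \<in> {a..b}" "Z c = 0" "t \<in> {a..b}"
    "\<And>t. t \<in> {a..b} \<Longrightarrow> (Z has_vector_derivative A t ** Z t) (at t within {a..b})"
  then show "Z t = 0" by (intro fund_unique[OF analytic_matrix_continuous, of a b c Z t])
qed

lemma inv_fund_analytic: "analytic_I (\<lambda>t. inv_fund A t $ i $ j)"
proof (rule analytic_solution[OF bounded_bilinear_rev an inv_fund_derivative[OF analytic_matrix_continuous]])
  fix a b c t and Z :: "real \<Rightarrow> complex^'n^'n"
  assume "{a..b} \<subseteq> I01" "c \<in> {a..b}" "Z c = 0" "t \<in> {a..b}"
    "\<And>t. t \<in> {a..b} \<Longrightarrow> (Z has_vector_derivative - (Z t ** A t)) (at t within {a..b})"
  then show "Z t = 0" by (intro inv_fund_unique[OF analytic_matrix_continuous, of a b c Z t])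
qed

lemma fund_term_analytic: "analytic_I (\<lambda>t. fund_term A k t $ i $ j)"
proof (induction k arbitrary: i j)
  case 0
  then show ?case by (simp add: fund_term_def analytic_I_const)
next
  case (Suc k)
  show ?case
  proof (rule analytic_I_primitive)
    show "((\<lambda>t. fund_term A (Suc k) t $ i $ j) has_vector_derivative (A t ** fund_term A k t) $ i $ j) (at t within I01)"
      if "t \<in> I01" for t
      using fund_term_derivative(2)[OF analytic_matrix_continuous that] by (rule has_vector_derivative_entry)
    show "analytic_I (\<lambda>t. (A t ** fund_term A k t) $ i $ j)"
      by (simp add: matrix_matrix_mult_def) (intro analytic_I_sum analytic_I_mult an Suc)
  qed
qed

lemma inv_fund_term_analytic: "analytic_I (\<lambda>t. inv_fund_term A k t $ i $ j)"
proof (induction k arbitrary: i j)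
  case 0
  then show ?case by (simp add: inv_fund_term_def analytic_I_const)
next
  case (Suc k)
  show ?case
  proof (rule analytic_I_primitive)
    show "((\<lambda>t. inv_fund_term A (Suc k) t $ i $ j) has_vector_derivative (- (inv_fund_term A k t ** A t)) $ i $ j) (at t within I01)"
      if "t \<in> I01" for t
      using inv_fund_term_derivative(2)[OF analytic_matrix_continuous that] by (rule has_vector_derivative_entry)
    have "analytic_I (\<lambda>t. - 1 * (\<Sum>l\<in>UNIV. inv_fund_term A k t $ i $ l * A t $ l $ j))"
      by (intro analytic_I_sum analytic_I_mult an Suc analytic_I_const)
    then show "analytic_I (\<lambda>t. (- (inv_fund_term A k t ** A t)) $ i $ j)"
      by (simp add: matrix_matrix_mult_def)
  qed
qed

lemma tensor_analytic:
  fixes f g :: "real \<Rightarrow> complex^'n^'n"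
  assumes "\<And>i j. analytic_I (\<lambda>t. f t $ i $ j)" "\<And>i j. analytic_I (\<lambda>t. g t $ i $ j)"
  shows "analytic_II (\<lambda>t s. (f t ** g s) $ i $ j)"
  by (simp add: matrix_matrix_mult_def) (intro analytic_II_sum analytic_II_tensor assms)

lemma product_analytic:
  fixes f g :: "real \<Rightarrow> complex^'n^'n"
  assumes "\<And>i j. analytic_I (\<lambda>t. f t $ i $ j)" "\<And>i j. analytic_I (\<lambda>t. g t $ i $ j)"
  shows "analytic_I (\<lambda>t. (f t ** g t) $ i $ j)"
  by (simp add: matrix_matrix_mult_def) (intro analytic_I_sum analytic_I_mult assms)

lemma analytic_propagator_term: "analytic_II (\<lambda>t s. (A t ** propagator_term A k t s) $ i $ j)"
proof -
  have "analytic_II (\<lambda>t s. (\<Sum>l\<le>k. (A t ** fund_term A l t) ** inv_fund_term A (k - l) s) $ i $ j)"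
    by (simp add: sum_component) (intro analytic_II_sum tensor_analytic product_analytic an fund_term_analytic inv_fund_term_analytic)
  then show ?thesis
    by (simp add: propagator_term_def matrix_mult.sum_right matrix_mul_assoc)
qed

lemma analytic_propagator: "analytic_II (\<lambda>t s. (A t ** propagator A t s) $ i $ j)"
proof -
  have "analytic_II (\<lambda>t s. ((A t ** fund A t) ** inv_fund A s) $ i $ j)"
    by (intro tensor_analytic product_analytic an fund_analytic inv_fund_analytic)
  then show ?thesis by (simp add: propagator_def matrix_mul_assoc)
qed

end

section \<open>The resolvent\<close>

lemma theta_dist_cong:
  assumes "\<And>t s. t \<in> I01 \<Longrightarrow> s \<in> {0..t} \<Longrightarrow> f t s = g t s"
  shows "theta_dist f = theta_dist g"
proof (intro ext)
  fix \<phi> t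
  show "theta_dist f \<phi> t = theta_dist g \<phi> t"
  proof (cases "test_fun \<phi> \<and> t \<in> I01")
    case True
    then have "integral {0..t} (\<lambda>s. f t s * \<phi> s) = integral {0..t} (\<lambda>s. g t s * \<phi> s)"
      by (intro integral_cong) (simp add: assms)
    with True show ?thesis by (simp only: theta_dist_apply)
  qed (auto simp: theta_dist_outside)
qed

lemma theta_dist_left_constant:
  assumes "test_fun \<psi>" "t \<in> I01"
  shows "theta_dist (\<lambda>t s. g t) \<psi> t = g t * integral {0..t} \<psi>"
  using assms by (simp add: theta_dist_apply del: atLeastAtMost_iff)

lemma theta_dist_sum_scaled:
  assumes "\<And>k. k \<in> I \<Longrightarrow> continuous_on (I01 \<times> I01) (\<lambda>(t, s). F k t s)"
    and "test_fun \<phi>" "t \<in> I01" "finite I"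
  shows "theta_dist (\<lambda>t s. \<Sum>k\<in>I. c k t * F k t s) \<phi> t = (\<Sum>k\<in>I. c k t * theta_dist (F k) \<phi> t)"
proof -
  have "integral {0..t} (\<lambda>s. (\<Sum>k\<in>I. c k t * F k t s) * \<phi> s) = integral {0..t} (\<lambda>s. \<Sum>k\<in>I. c k t * (F k t s * \<phi> s))"
    by (simp add: sum_distrib_right mult.assoc)
  also have "\<dots> = (\<Sum>k\<in>I. integral {0..t} (\<lambda>s. c k t * (F k t s * \<phi> s)))"
    using assms theta_integrand_integrable[OF _ assms(2,3)]
    by (intro integral_sum integrable_on_mult_right) auto
  finally show ?thesis
    using assms(2,3) by (simp add: theta_dist_apply del: atLeastAtMost_iff)
qed

lemma theta_dist_diff:
  assumes "continuous_on (I01 \<times> I01) (\<lambda>(t, s). f t s)" "continuous_on (I01 \<times> I01) (\<lambda>(t, s). g t s)"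
  shows "theta_dist (\<lambda>t s. f t s - g t s) = theta_dist f - theta_dist g"
proof (intro ext)
  fix \<phi> t
  show "theta_dist (\<lambda>t s. f t s - g t s) \<phi> t = (theta_dist f - theta_dist g) \<phi> t"
  proof (cases "test_fun \<phi> \<and> t \<in> I01")
    case True
    then show ?thesis
      using integral_diff[OF theta_integrand_integrable[OF assms(1)] theta_integrand_integrable[OF assms(2)], of \<phi> t \<phi>]
      by (simp add: theta_dist_apply left_diff_distrib del: atLeastAtMost_iff)
  qed (auto simp: theta_dist_outside)
qed

lemma continuous_entry_pair:
  fixes F :: "real \<Rightarrow> real \<Rightarrow> complex^'n^'m"
  assumes "continuous_on (I01 \<times> I01) (\<lambda>(t, s). F t s)"
  shows "continuous_on (I01 \<times> I01) (\<lambda>(t, s). F t s $ i $ j)"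
  using continuous_on_entry[OF assms, of i j] by (simp add: case_prod_unfold)

lemma theta_dist_at_0: "theta_dist f \<phi> 0 = 0"
  by (cases "test_fun \<phi>") (simp_all add: theta_dist_apply theta_dist_outside)

lemma integral_theta_dist:
  assumes der: "\<And>t s. t \<in> I01 \<Longrightarrow> s \<in> I01 \<Longrightarrow> ((\<lambda>t. F t s) has_vector_derivative F1 t s) (at t within I01)"
    and F: "continuous_on (I01 \<times> I01) (\<lambda>(t, s). F t s)"
    and F1: "continuous_on (I01 \<times> I01) (\<lambda>(t, s). F1 t s)"
    and diag: "\<And>t. t \<in> I01 \<Longrightarrow> F t t = 0"
    and \<phi>: "test_fun \<phi>" and t: "t \<in> I01"
  shows "integral {0..t} (theta_dist F1 \<phi>) = theta_dist F \<phi> t"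
proof -
  have "(theta_dist F \<phi> has_vector_derivative theta_dist F1 \<phi> x) (at x within I01)" if "x \<in> I01" for x
    using theta_dist_derivative[OF der F F1 \<phi> that] diag[OF that] by simp
  from primitive_I01[OF this t] show ?thesis by (simp add: theta_dist_at_0)
qed

text \<open>
  The product with \<open>\<Theta>\<close> turns the kernel \<open>\<partial>\<^sub>t F\<close> into \<open>F\<close>, since the delta term of
  \<open>theta_dist_derivative\<close> carries the factor \<open>F(t,t) = 0\<close>; the coefficient \<open>A(t)\<close> is constant for the
  integration.
\<close>

lemma mstar_primitive:
  fixes A :: "real \<Rightarrow> complex^'n^'n"
  assumes der: "\<And>t s. t \<in> I01 \<Longrightarrow> s \<in> I01 \<Longrightarrow> ((\<lambda>t. F t s) has_vector_derivative F1 t s) (at t within I01)"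
    and F: "continuous_on (I01 \<times> I01) (\<lambda>(t, s). F t s)"
    and F1: "\<And>i j. analytic_II (\<lambda>t s. F1 t s $ i $ j)"
    and diag: "\<And>t. t \<in> I01 \<Longrightarrow> F t t = 0"
  shows "mtheta (\<lambda>t s. A t) \<star> mtheta F1 = mtheta (\<lambda>t s. A t ** F t s)"
proof -
  have "(\<Sum>k\<in>UNIV. theta_dist (\<lambda>t s. A t $ i $ k) (theta_dist (\<lambda>t s. F1 t s $ k $ j) \<phi>) t)
      = theta_dist (\<lambda>t s. (A t ** F t s) $ i $ j) \<phi> t" for i j \<phi> t
  proof (cases "test_fun \<phi> \<and> t \<in> I01")
    case True
    then have \<phi>: "test_fun \<phi>" and t: "t \<in> I01" by auto
    have "theta_dist (\<lambda>t s. A t $ i $ k) (theta_dist (\<lambda>t s. F1 t s $ k $ j) \<phi>) t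
        = A t $ i $ k * theta_dist (\<lambda>t s. F t s $ k $ j) \<phi> t" for k
    proof -
      have "integral {0..t} (theta_dist (\<lambda>t s. F1 t s $ k $ j) \<phi>) = theta_dist (\<lambda>t s. F t s $ k $ j) \<phi> t"
      proof (rule integral_theta_dist[OF _ continuous_entry_pair[OF F] analytic_II_continuous[OF F1] _ \<phi> t])
        show "((\<lambda>t. F t s $ k $ j) has_vector_derivative F1 t s $ k $ j) (at t within I01)"
          if "t \<in> I01" "s \<in> I01" for t s
          using der[OF that] by (rule has_vector_derivative_entry)
      qed (simp add: diag)
      then show ?thesis
        using theta_dist_left_constant[OF test_fun_theta_dist[OF F1 \<phi>] t] by simp
    qed
    then show ?thesis
      using theta_dist_sum_scaled[OF continuous_entry_pair[OF F] \<phi> t, where I = UNIV and i1 = "\<lambda>k. k"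
        and j1 = "\<lambda>_. j" and c = "\<lambda>k t. A t $ i $ k"]
      by (simp add: matrix_matrix_mult_def)
  next
    case False
    have "theta_dist (\<lambda>t s. A t $ i $ k) 0 t = 0" for k
      by (simp add: theta_dist_def)
    with False show ?thesis by (auto simp: theta_dist_outside)
  qed
  then show ?thesis by (simp add: vec_eq_iff mtheta_def mstar_nth fun_eq_iff sum_fun_apply)
qed

lemma mtheta_diff:
  fixes F G :: "real \<Rightarrow> real \<Rightarrow> complex^'n^'n"
  assumes "continuous_on (I01 \<times> I01) (\<lambda>(t, s). F t s)" "continuous_on (I01 \<times> I01) (\<lambda>(t, s). G t s)"
  shows "mtheta (\<lambda>t s. F t s - G t s) = mtheta F - mtheta G"
  using theta_dist_diff[OF continuous_entry_pair[OF assms(1)] continuous_entry_pair[OF assms(2)]]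
  by (simp add: mtheta_def vec_eq_iff)

context
  fixes A :: "real \<Rightarrow> complex^'n^'n"
  assumes an: "\<And>i j. analytic_I (\<lambda>t. A t $ i $ j)"
begin

lemma coefficient_continuous: "continuous_on (I01 \<times> I01) (\<lambda>(t, s). A t)"
  unfolding case_prod_unfold
  by (rule continuous_on_compose2[OF analytic_matrix_continuous[OF an]]) (auto intro!: continuous_intros)

lemma coefficient_analytic: "analytic_II (\<lambda>t s. A t $ i $ j)"
  using analytic_II_tensor[OF an analytic_I_const[of 1]] by simp

lemma kernel_continuous: "continuous_on (I01 \<times> I01) (\<lambda>(t, s). A t ** propagator A t s)"
  using matrix_mult.continuous_on[OF coefficient_continuous[unfolded case_prod_unfold] propagator_continuous[OF analytic_matrix_continuous[OF an], unfolded case_prod_unfold]]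
  by (simp add: case_prod_unfold)

text \<open>
  The kernel \<open>A w\<^sub>k\<close> is the derivative of \<open>w\<^sub>k\<^sub>+\<^sub>1\<close>, which vanishes on the diagonal, so \<open>mstar_primitive\<close>
  gives the induction step.
\<close>

lemma star_power:
  "mstar_pow (mtheta (\<lambda>t s. A t)) (Suc k) = mtheta (\<lambda>t s. A t ** propagator_term A k t s)"
proof (induction k)
  case 0
  have "mtheta (\<lambda>t s. A t) \<star> mone_star = mtheta (\<lambda>t s. A t)"
    by (intro mstar_one_right regular_imp_additive regular_mtheta coefficient_analytic)
  then show ?case by (simp add: propagator_term_0[OF analytic_matrix_continuous[OF an]])
next
  case (Suc k)
  have "mstar_pow (mtheta (\<lambda>t s. A t)) (Suc (Suc k)) = mtheta (\<lambda>t s. A t) \<star> mtheta (\<lambda>t s. A t ** propagator_term A k t s)"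
    using Suc by simp
  also have "\<dots> = mtheta (\<lambda>t s. A t ** propagator_term A (Suc k) t s)"
    by (rule mstar_primitive[OF propagator_term_derivative[OF analytic_matrix_continuous[OF an]] propagator_term_continuous[OF analytic_matrix_continuous[OF an]]
          analytic_propagator_term[OF an] propagator_term_diagonal[OF analytic_matrix_continuous[OF an]]])
  finally show ?case .
qed

text \<open>
  \<open>W - I\<close> vanishes on the diagonal and has the derivative \<open>A W\<close> in \<open>t\<close>.
\<close>

lemma star_kernel_left:
  "mtheta (\<lambda>t s. A t) \<star> mtheta (\<lambda>t s. A t ** propagator A t s)
    = mtheta (\<lambda>t s. A t ** propagator A t s) - mtheta (\<lambda>t s. A t)"
proof -
  have "mtheta (\<lambda>t s. A t) \<star> mtheta (\<lambda>t s. A t ** propagator A t s)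
    = mtheta (\<lambda>t s. A t ** (propagator A t s - mat 1))"
  proof (rule mstar_primitive)
    show "((\<lambda>t. propagator A t s - mat 1) has_vector_derivative A t ** propagator A t s) (at t within I01)"
      if "t \<in> I01" for t s
      using has_vector_derivative_diff[OF propagator_derivative[OF analytic_matrix_continuous[OF an] that] has_vector_derivative_const[of "mat 1"]] by simp
    show "continuous_on (I01 \<times> I01) (\<lambda>(t, s). propagator A t s - mat 1)"
      using propagator_continuous[OF analytic_matrix_continuous[OF an]] by (auto simp: case_prod_unfold intro!: continuous_intros)
  qed (use analytic_propagator[OF an] propagator_diagonal[OF analytic_matrix_continuous[OF an]] in auto)
  also have "\<dots> = mtheta (\<lambda>t s. A t ** propagator A t s - A t)"
    by (simp add: matrix_mult.diff_right)
  finally show ?thesis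
    using mtheta_diff[OF kernel_continuous coefficient_continuous] by simp
qed

text \<open>
  Integration by parts: if \<open>p\<close> is the primitive of \<open>\<phi>\<close>, the left-hand side integrates
  \<open>S(t,s) A(s) p(s)\<close> over \<open>s\<close>, and \<open>S(t,s) A(s)\<close> is minus the derivative of \<open>S(t,s)\<close> in \<open>s\<close>. The boundary
  term at \<open>s = t\<close> is \<open>A(t) p(t)\<close>, the pairing of \<open>A\<close> with \<open>\<phi>\<close>.
\<close>

lemma star_kernel_right:
  "mtheta (\<lambda>t s. A t ** propagator A t s) \<star> mtheta (\<lambda>t s. A t)
    = mtheta (\<lambda>t s. A t ** propagator A t s) - mtheta (\<lambda>t s. A t)"
proof -
  let ?S = "\<lambda>t s. A t ** propagator A t s"
  have "(\<Sum>k\<in>UNIV. theta_dist (\<lambda>t s. ?S t s $ i $ k) (theta_dist (\<lambda>t s. A t $ k $ j) \<phi>) t)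
      = theta_dist (\<lambda>t s. ?S t s $ i $ j) \<phi> t - theta_dist (\<lambda>t s. A t $ i $ j) \<phi> t" for i j \<phi> t
  proof (cases "test_fun \<phi> \<and> t \<in> I01")
    case True
    then have \<phi>: "test_fun \<phi>" and t: "t \<in> I01" by auto
    define p where "p x = integral {0..x} \<phi>" for x
    have p: "(p has_vector_derivative \<phi> x) (at x within I01)" if "x \<in> I01" for x
      unfolding p_def[abs_def] using integral_has_vector_derivative[OF test_fun_continuous[OF \<phi>] that] .
    have A\<phi>: "theta_dist (\<lambda>t s. A t $ k $ j) \<phi> x = A x $ k $ j * p x" if "x \<in> I01" for k x
      using theta_dist_left_constant[OF \<phi> that] by (simp add: p_def)
    have S_der: "((\<lambda>s. ?S t s $ i $ j) has_vector_derivative - (\<Sum>k\<in>UNIV. ?S t x $ i $ k * A x $ k $ j)) (at x within I01)"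
      if "x \<in> I01" for x
    proof -
      have "((\<lambda>s. ?S t s) has_vector_derivative A t ** - (propagator A t x ** A x)) (at x within I01)"
        by (rule bounded_linear.has_vector_derivative[OF matrix_mult.bounded_linear_right
              propagator_derivative_right[OF analytic_matrix_continuous[OF an] that]])
      from has_vector_derivative_entry[OF this, of i j] show ?thesis
        by (simp add: matrix_mult.minus_right matrix_mul_assoc) (simp add: matrix_matrix_mult_def)
    qed
    have int1: "(\<lambda>s. ?S t s $ i $ j * \<phi> s) integrable_on {0..t}"
      by (rule theta_integrand_integrable[OF continuous_entry_pair[OF kernel_continuous] \<phi> t])
    have int2: "(\<lambda>s. ?S t s $ i $ k * theta_dist (\<lambda>t s. A t $ k $ j) \<phi> s) integrable_on {0..t}" for k
      by (rule theta_integrand_integrable[OF continuous_entry_pair[OF kernel_continuous] test_fun_theta_dist[OF coefficient_analytic \<phi>] t])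
    have "((\<lambda>s. ?S t s $ i $ j * p s) has_vector_derivative
        ?S t x $ i $ j * \<phi> x - (\<Sum>k\<in>UNIV. ?S t x $ i $ k * theta_dist (\<lambda>t s. A t $ k $ j) \<phi> x)) (at x within I01)"
      if "x \<in> I01" for x
      using has_vector_derivative_mult[OF S_der[OF that] p[OF that]] A\<phi>[OF that]
      by (simp add: sum_distrib_right mult.assoc)
    from primitive_I01[OF this t]
    have "integral {0..t} (\<lambda>s. ?S t s $ i $ j * \<phi> s - (\<Sum>k\<in>UNIV. ?S t s $ i $ k * theta_dist (\<lambda>t s. A t $ k $ j) \<phi> s))
       = ?S t t $ i $ j * p t"
      by (simp add: p_def)
    moreover have "?S t t $ i $ j * p t = theta_dist (\<lambda>t s. A t $ i $ j) \<phi> t"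
      using A\<phi>[OF t, of i] propagator_diagonal[OF analytic_matrix_continuous[OF an] t] by (simp add: theta_dist_left_constant[OF \<phi> t] p_def)
    moreover have "integral {0..t} (\<lambda>s. ?S t s $ i $ j * \<phi> s - (\<Sum>k\<in>UNIV. ?S t s $ i $ k * theta_dist (\<lambda>t s. A t $ k $ j) \<phi> s))
       = theta_dist (\<lambda>t s. ?S t s $ i $ j) \<phi> t
         - (\<Sum>k\<in>UNIV. theta_dist (\<lambda>t s. ?S t s $ i $ k) (theta_dist (\<lambda>t s. A t $ k $ j) \<phi>) t)"
      unfolding theta_dist_apply[OF \<phi> t] theta_dist_apply[OF test_fun_theta_dist[OF coefficient_analytic \<phi>] t]
      by (subst integral_diff) (auto intro!: int1 int2 integrable_sum simp: integral_sum[OF _ int2])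
    ultimately show ?thesis by (simp add: algebra_simps)
  next
    case False
    have "theta_dist (\<lambda>t s. ?S t s $ i $ k) 0 t = 0" for k
      by (simp add: theta_dist_def)
    with False show ?thesis by (auto simp: theta_dist_outside)
  qed
  then show ?thesis by (simp add: vec_eq_iff mtheta_def mstar_nth fun_eq_iff sum_fun_apply)
qed

lemma resolvent_regular: "regular_mat (mone_star + mtheta (\<lambda>t s. A t ** propagator A t s))"
  by (intro regular_mat_add regular_mat_one regular_mtheta analytic_propagator[OF an])

lemma resolvent_DI: "(mone_star + mtheta (\<lambda>t s. A t ** propagator A t s)) $ i $ j \<in> DI"
proof -
  let ?g = "\<lambda>(t::real) (s::real). if i = j then 1 else 0 :: complex"
  have "(mone_star + mtheta (\<lambda>t s. A t ** propagator A t s)) $ i $ j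
      = theta_dist (\<lambda>t s. (A t ** propagator A t s) $ i $ j) + (\<Sum>l\<le>(0::nat). delta_dist l ((\<lambda>_. ?g) l))"
    by (auto simp: mone_star_def mtheta_def one_star_def delta_dist_def nderiv_0 fun_eq_iff)
  moreover have "analytic_II ?g" by (rule analytic_II_const)
  ultimately show ?thesis
    unfolding DI_def using analytic_propagator[OF an, of i j]
    by (intro CollectI exI[of _ "\<lambda>t s. (A t ** propagator A t s) $ i $ j"] exI[of _ 0] exI[of _ "\<lambda>_. ?g"]) simp
qed

lemma resolvent_inverse:
  "is_star_inverse (mone_star - mtheta (\<lambda>t s. A t)) (mone_star + mtheta (\<lambda>t s. A t ** propagator A t s))"
proof -
  let ?A = "mtheta (\<lambda>t s. A t)" and ?S = "mtheta (\<lambda>t s. A t ** propagator A t s)"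
  have rA: "regular_mat ?A" and rS: "regular_mat ?S"
    by (intro regular_mtheta coefficient_analytic analytic_propagator[OF an])+
  note reg = rA rS regular_mat_one regular_mat_add regular_imp_additive
  have "(mone_star - ?A) \<star> (mone_star + ?S) = mone_star + ?S - (?A + (?S - ?A))"
    by (simp add: mstar_diff_left mstar_add_right mstar_one_left mstar_one_right reg star_kernel_left)
  then have 1: "(mone_star - ?A) \<star> (mone_star + ?S) = mone_star" by (simp add: algebra_simps)
  have "(mone_star + ?S) \<star> (mone_star - ?A) = mone_star + ?S - (?A + (?S - ?A))"
    by (simp add: mstar_diff_right mstar_add_left mstar_one_left mstar_one_right reg star_kernel_right)
  then have 2: "(mone_star + ?S) \<star> (mone_star - ?A) = mone_star" by (simp add: algebra_simps)
  show ?thesis unfolding is_star_inverse_def using 1 2 resolvent_DI by blast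
qed

lemma power_bound:
  obtains B where "summable B"
    "\<And>k t s. t \<in> I01 \<Longrightarrow> s \<in> I01 \<Longrightarrow> norm (A t ** propagator_term A k t s) \<le> B k"
proof -
  obtain B where B: "summable B" "\<And>k t s. t \<in> I01 \<Longrightarrow> s \<in> I01 \<Longrightarrow> norm (propagator_term A k t s) \<le> B k"
    by (rule propagator_term_bound[OF analytic_matrix_continuous[OF an]]; rule that; assumption)
  have "\<exists>K>0. \<forall>(X :: complex^'n^'n) (Y :: complex^'n^'n). norm (X ** Y) \<le> norm X * norm Y * K"
    by (rule matrix_mult.pos_bounded)
  then obtain K where K: "K > 0" "\<forall>(X :: complex^'n^'n) (Y :: complex^'n^'n). norm (X ** Y) \<le> norm X * norm Y * K"
    by (elim exE conjE)
  obtain a where a: "a > 0" "\<And>t. t \<in> I01 \<Longrightarrow> norm (A t) \<le> a"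
    using compact_imp_bounded[OF compact_continuous_image[OF analytic_matrix_continuous[OF an]]] by (auto simp: bounded_pos)
  have "norm (A t ** propagator_term A k t s) \<le> a * B k * K" if "t \<in> I01" "s \<in> I01" for k t s
  proof -
    have "norm (A t) * norm (propagator_term A k t s) * K \<le> a * B k * K"
      using a that B(2)[OF that] K(1) by (intro mult_right_mono mult_mono) auto
    then show ?thesis by (rule order_trans[OF K(2)[rule_format]])
  qed
  moreover have "summable (\<lambda>k. a * B k * K)" by (intro summable_mult summable_mult2 B)
  ultimately show thesis by (intro that)
qed

lemma power_series:
  assumes "t \<in> I01" "s \<in> I01"
  shows "(\<lambda>k. A t ** propagator_term A k t s) sums (A t ** propagator A t s)"
  by (rule bounded_linear.sums[OF matrix_mult.bounded_linear_right propagator_series[OF analytic_matrix_continuous[OF an] assms]])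

lemma uniform_convergence:
  "uniform_limit (I01 \<times> I01)
     (\<lambda>n (t, s). \<Sum>k=1..n. Heaviside (t - s) *\<^sub>R (A t ** propagator_term A (k - 1) t s))
     (\<lambda>(t, s). Heaviside (t - s) *\<^sub>R (A t ** propagator A t s)) sequentially"
proof -
  obtain B where B: "summable B"
    "\<And>k t s. t \<in> I01 \<Longrightarrow> s \<in> I01 \<Longrightarrow> norm (A t ** propagator_term A k t s) \<le> B k"
    by (rule power_bound; rule that; assumption)
  let ?f = "\<lambda>k z. Heaviside (fst z - snd z) *\<^sub>R (A (fst z) ** propagator_term A k (fst z) (snd z))"
  have "uniform_limit (I01 \<times> I01) (\<lambda>n z. \<Sum>k<n. ?f k z) (\<lambda>z. \<Sum>k. ?f k z) sequentially"
  proof (rule Weierstrass_m_test[OF _ B(1)])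
    fix k and z :: "real \<times> real" assume "z \<in> I01 \<times> I01"
    then have "norm (A (fst z) ** propagator_term A k (fst z) (snd z)) \<le> B k" by (intro B) auto
    moreover from this have "0 \<le> B k" by (rule order_trans[OF norm_ge_zero])
    ultimately show "norm (?f k z) \<le> B k" by (simp add: Heaviside_def)
  qed
  then show ?thesis
  proof (rule uniform_limit_cong'[THEN iffD1, rotated -1])
    fix n and z :: "real \<times> real" assume "z \<in> I01 \<times> I01"
    have "(\<Sum>k<n. ?f k z) = (\<Sum>k=1..n. ?f (k - 1) z)"
      by (rule sum.reindex_bij_witness[of _ "\<lambda>k. k - 1" Suc]) auto
    then show "(\<Sum>k<n. ?f k z) = (case z of (t, s) \<Rightarrow> \<Sum>k=1..n. Heaviside (t - s) *\<^sub>R (A t ** propagator_term A (k - 1) t s))"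
      by (simp add: case_prod_unfold)
  next
    fix z :: "real \<times> real" assume "z \<in> I01 \<times> I01"
    then have "(\<lambda>k. ?f k z) sums (Heaviside (fst z - snd z) *\<^sub>R (A (fst z) ** propagator A (fst z) (snd z)))"
      by (intro sums_scaleR_right power_series) auto
    then show "(\<Sum>k. ?f k z) = (case z of (t, s) \<Rightarrow> Heaviside (t - s) *\<^sub>R (A t ** propagator A t s))"
      by (simp add: sums_iff case_prod_unfold)
  qed
qed

text \<open>
  The series of kernels converges uniformly on \<open>{0..t}\<close>, so it may be integrated termwise.
\<close>

lemma theta_dist_series:
  assumes "test_fun \<phi>" "t \<in> I01"
  shows "(\<lambda>k. theta_dist (\<lambda>t s. (A t ** propagator_term A k t s) $ i $ j) \<phi> t) sums
      theta_dist (\<lambda>t s. (A t ** propagator A t s) $ i $ j) \<phi> t"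
proof -
  obtain B where B: "summable B"
    "\<And>k t s. t \<in> I01 \<Longrightarrow> s \<in> I01 \<Longrightarrow> norm (A t ** propagator_term A k t s) \<le> B k"
    by (rule power_bound; rule that; assumption)
  obtain b where b: "b > 0" "\<And>s. s \<in> I01 \<Longrightarrow> norm (\<phi> s) \<le> b"
    using compact_imp_bounded[OF compact_continuous_image[OF test_fun_continuous[OF assms(1)]]] by (auto simp: bounded_pos)
  let ?f = "\<lambda>k s. (A t ** propagator_term A k t s) $ i $ j * \<phi> s"
  let ?g = "\<lambda>s. (A t ** propagator A t s) $ i $ j * \<phi> s"
  have sub: "s \<in> I01" if "s \<in> {0..t}" for s using that assms(2) by auto
  have "uniform_limit {0..t} (\<lambda>n s. \<Sum>k<n. ?f k s) (\<lambda>s. \<Sum>k. ?f k s) sequentially"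
  proof (rule Weierstrass_m_test)
    show "norm (?f k s) \<le> B k * b" if "s \<in> {0..t}" for k s
    proof -
      have "norm ((A t ** propagator_term A k t s) $ i $ j) \<le> norm (A t ** propagator_term A k t s)"
        by (rule order_trans[OF Finite_Cartesian_Product.norm_nth_le Finite_Cartesian_Product.norm_nth_le])
      also have "\<dots> \<le> B k" by (rule B(2)[OF assms(2) sub[OF that]])
      finally show ?thesis
        unfolding norm_mult using b(2)[OF sub[OF that]] by (intro mult_mono) (auto intro: order_trans[OF norm_ge_zero])
    qed
    show "summable (\<lambda>k. B k * b)" by (rule summable_mult2[OF B(1)])
  qed
  moreover have eq: "(\<Sum>k. ?f k s) = ?g s" if "s \<in> {0..t}" for s
    using sums_mult2[OF bounded_linear.sums[OF bounded_linear_entry power_series[OF assms(2) sub[OF that]]]]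
    by (simp add: sums_iff)
  ultimately have ul: "uniform_limit {0..t} (\<lambda>n s. \<Sum>k<n. ?f k s) ?g sequentially"
    using uniform_limit_cong'[of "{0..t}" "\<lambda>n s. \<Sum>k<n. ?f k s" "\<lambda>n s. \<Sum>k<n. ?f k s" "\<lambda>s. \<Sum>k. ?f k s" ?g sequentially] by blast
  have cont: "continuous_on {0..t} (?f k)" for k
    using slice_continuous[OF theta_integrand_continuous[OF analytic_II_continuous[OF analytic_propagator_term[OF an]] assms(1)] assms(2), of k i j]
    by (rule continuous_on_subset) (use assms(2) in auto)
  obtain I J where I: "\<And>n. ((\<lambda>s. \<Sum>k<n. ?f k s) has_integral I n) {0..t}" and J: "(?g has_integral J) {0..t}" "I \<longlonglongrightarrow> J"
    by (rule uniform_limit_integral[OF ul]) (auto intro!: continuous_on_sum cont)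
  have "I = (\<lambda>n. \<Sum>k<n. integral {0..t} (?f k))"
    using integral_unique[OF I] integrable_continuous_real[OF cont] by (simp add: integral_sum fun_eq_iff)
  then show ?thesis
    using J unfolding sums_def theta_dist_apply[OF assms] by (simp add: integral_unique)
qed

lemma star_resolvent_eq:
  "star_resolvent (mtheta (\<lambda>t s. A t)) = mone_star + mtheta (\<lambda>t s. A t ** propagator A t s)"
proof -
  have "(\<Sum>k. theta_dist (\<lambda>t s. (A t ** propagator_term A k t s) $ i $ j) \<phi> t)
      = theta_dist (\<lambda>t s. (A t ** propagator A t s) $ i $ j) \<phi> t" for i j \<phi> t
  proof (cases "test_fun \<phi> \<and> t \<in> I01")
    case True
    then show ?thesis using theta_dist_series by (simp add: sums_iff)
  qed (auto simp: theta_dist_outside)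
  then show ?thesis
    unfolding star_resolvent_def star_power by (simp add: mtheta_def vec_eq_iff)
qed

end

section \<open>Variation of constants\<close>

lemma swap_continuous:
  assumes "continuous_on (I01 \<times> I01) (\<lambda>(t, s). g t s)"
  shows "continuous_on (I01 \<times> I01) (\<lambda>(s, t). g t s)"
proof -
  have "continuous_on (I01 \<times> I01) (\<lambda>z. (\<lambda>(t, s). g t s) (snd z, fst z))"
    by (rule continuous_on_compose2[OF assms]) (auto intro!: continuous_intros)
  then show ?thesis by (simp add: case_prod_unfold)
qed

text \<open>
  The function is Lipschitz in \<open>t\<close> with a constant independent of \<open>s\<close>, and continuous in \<open>s\<close> for fixed \<open>t\<close>.
\<close>

lemma parametric_primitive_continuous:
  fixes g :: "real \<Rightarrow> real \<Rightarrow> 'a::banach"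
  assumes g: "continuous_on (I01 \<times> I01) (\<lambda>(t, s). g t s)"
  shows "continuous_on (I01 \<times> I01) (\<lambda>(t, s). integral {0..t} (\<lambda>\<tau>. g \<tau> s))"
proof -
  let ?H = "\<lambda>t s. integral {0..t} (\<lambda>\<tau>. g \<tau> s)"
  have swap: "continuous_on (I01 \<times> I01) (\<lambda>(s, t). g t s)"
    by (rule swap_continuous[OF g])
  have slice: "continuous_on I01 (\<lambda>t. g t s)" if "s \<in> I01" for s
    using slice_continuous[OF swap that] .
  obtain M where M: "M > 0" "\<And>t s. t \<in> I01 \<Longrightarrow> s \<in> I01 \<Longrightarrow> norm (g t s) \<le> M"
    using compact_imp_bounded[OF compact_continuous_image[OF g compact_Times]]
    by (fastforce simp: bounded_pos)
  have mono: "norm (?H b s - ?H a s) \<le> M * (b - a)" if "a \<in> I01" "b \<in> I01" "a \<le> b" "s \<in> I01" for a b s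
  proof -
    have c: "continuous_on {0..b} (\<lambda>\<tau>. g \<tau> s)" "continuous_on {a..b} (\<lambda>\<tau>. g \<tau> s)"
      using that by (auto intro!: continuous_on_subset[OF slice[OF that(4)]])
    have "?H a s + integral {a..b} (\<lambda>\<tau>. g \<tau> s) = ?H b s"
      using that c by (intro Henstock_Kurzweil_Integration.integral_combine integrable_continuous_real) auto
    then have "?H b s - ?H a s = integral {a..b} (\<lambda>\<tau>. g \<tau> s)" by (simp add: algebra_simps)
    also have "norm \<dots> \<le> M * (b - a)"
      using that c M(2) by (intro integral_bound) auto
    finally show ?thesis .
  qed
  have lip: "norm (?H t s - ?H t0 s) \<le> M * \<bar>t - t0\<bar>" if "t \<in> I01" "t0 \<in> I01" "s \<in> I01" for t t0 s
    using mono[of t t0 s] mono[of t0 t s] that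
    by (cases "t \<le> t0") (auto simp: norm_minus_commute)
  have "((\<lambda>(t, s). ?H t s) \<longlongrightarrow> ?H t0 s0) (at (t0, s0) within I01 \<times> I01)"
    if 0: "t0 \<in> I01" "s0 \<in> I01" for t0 s0
  proof -
    have fst: "((\<lambda>z. fst z) \<longlongrightarrow> t0) (at (t0, s0) within I01 \<times> I01)"
      and snd: "((\<lambda>z. snd z) \<longlongrightarrow> s0) (at (t0, s0) within I01 \<times> I01)"
      by (auto intro!: tendsto_eq_intros)
    have "continuous_on I01 (\<lambda>s. integral (cbox 0 t0) (\<lambda>\<tau>. g \<tau> s))"
      by (rule integral_continuous_on_param) (use 0 in \<open>auto intro: continuous_on_subset[OF swap]\<close>)
    then have "continuous_on (I01 \<times> I01) (\<lambda>z. ?H t0 (snd z))"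
      by (auto intro!: continuous_on_compose2[of I01 "\<lambda>s. ?H t0 s"] continuous_intros)
    then have 1: "((\<lambda>z. ?H t0 (snd z)) \<longlongrightarrow> ?H t0 s0) (at (t0, s0) within I01 \<times> I01)"
      using 0 by (auto simp: continuous_on_def)
    have "((\<lambda>z. M * \<bar>fst z - t0\<bar>) \<longlongrightarrow> M * \<bar>t0 - t0\<bar>) (at (t0, s0) within I01 \<times> I01)"
      by (intro tendsto_intros fst)
    then have "((\<lambda>z. M * \<bar>fst z - t0\<bar>) \<longlongrightarrow> 0) (at (t0, s0) within I01 \<times> I01)" by simp
    moreover have "\<forall>\<^sub>F z in at (t0, s0) within I01 \<times> I01. norm (?H (fst z) (snd z) - ?H t0 (snd z)) \<le> M * \<bar>fst z - t0\<bar>"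
      unfolding eventually_at_filter using lip 0 by (auto intro!: always_eventually)
    ultimately have 2: "((\<lambda>z. ?H (fst z) (snd z) - ?H t0 (snd z)) \<longlongrightarrow> 0) (at (t0, s0) within I01 \<times> I01)"
      by (rule Lim_null_comparison[rotated])
    from tendsto_add[OF 1 2] show ?thesis by (simp add: case_prod_unfold)
  qed
  then show ?thesis by (auto simp: continuous_on_def)
qed

text \<open>
  A solution of the initial value problem is given only for \<open>t \<ge> s\<close> and nothing is known about its
  dependence on \<open>s\<close>. It is replaced by
  \<open>V(t,s) = \<Phi>(t) (\<Psi>(s) + \<integral>\<^sub>s\<^sup>t \<Psi>(\<tau>) B(\<tau>,s) d\<tau>)\<close>, which is defined and jointly continuous on the whole
  square and agrees with the solution for \<open>t \<ge> s\<close> by uniqueness.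
\<close>

lemma variation_of_constants:
  fixes A :: "real \<Rightarrow> complex^'n^'n" and B U :: "real \<Rightarrow> real \<Rightarrow> complex^'n^'n"
  assumes A: "continuous_on I01 A"
    and B: "continuous_on (I01 \<times> I01) (\<lambda>(t, s). B t s)"
    and U: "\<And>t s. s \<in> I01 \<Longrightarrow> t \<in> {s..1} \<Longrightarrow>
      ((\<lambda>x. U x s) has_vector_derivative (A t ** U t s + B t s)) (at t within {s..1})"
    and U0: "\<And>s. s \<in> I01 \<Longrightarrow> U s s = mat 1"
  obtains V where "continuous_on (I01 \<times> I01) (\<lambda>(t, s). V t s)"
    "\<And>t s. t \<in> I01 \<Longrightarrow> s \<in> I01 \<Longrightarrow> ((\<lambda>t. V t s) has_vector_derivative (A t ** V t s + B t s)) (at t within I01)"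
    "\<And>s. s \<in> I01 \<Longrightarrow> V s s = mat 1"
    "\<And>t s. s \<in> I01 \<Longrightarrow> t \<in> {s..1} \<Longrightarrow> U t s = V t s"
proof -
  define g where "g \<tau> s = inv_fund A \<tau> ** B \<tau> s" for \<tau> s
  \<comment> \<open>the integral from \<open>s\<close> to \<open>t\<close> is written \<open>H t s - H s s\<close>, so that it is right for \<open>t < s\<close>, too\<close>
  define H where "H t s = integral {0..t} (\<lambda>\<tau>. g \<tau> s)" for t s
  define V where "V t s = fund A t ** (inv_fund A s + (H t s - H s s))" for t s
  have comp: "continuous_on (I01 \<times> I01) (\<lambda>z. f (fst z))" "continuous_on (I01 \<times> I01) (\<lambda>z. f (snd z))"
    if "continuous_on I01 f" for f :: "real \<Rightarrow> complex^'n^'n"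
    by (rule continuous_on_compose2[OF that]; auto intro!: continuous_intros)+
  have g: "continuous_on (I01 \<times> I01) (\<lambda>(t, s). g t s)"
    using matrix_mult.continuous_on[OF comp(1)[OF inv_fund_continuous[OF A]] B[unfolded case_prod_unfold]]
    by (simp add: g_def case_prod_unfold)
  have H: "continuous_on (I01 \<times> I01) (\<lambda>(t, s). H t s)"
    unfolding H_def by (rule parametric_primitive_continuous[OF g])
  have "continuous_on (I01 \<times> I01) (\<lambda>z. (\<lambda>(t, s). H t s) (snd z, snd z))"
    by (rule continuous_on_compose2[OF H]) (auto intro!: continuous_intros)
  then have "continuous_on (I01 \<times> I01) (\<lambda>z. inv_fund A (snd z) + (H (fst z) (snd z) - H (snd z) (snd z)))"
    using comp(2)[OF inv_fund_continuous[OF A]] H by (auto simp: case_prod_unfold intro!: continuous_intros)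
  from matrix_mult.continuous_on[OF comp(1)[OF fund_continuous[OF A]] this]
  have V: "continuous_on (I01 \<times> I01) (\<lambda>(t, s). V t s)"
    by (simp add: V_def case_prod_unfold)
  have der: "((\<lambda>t. V t s) has_vector_derivative (A t ** V t s + B t s)) (at t within I01)"
    if t: "t \<in> I01" and s: "s \<in> I01" for t s
  proof -
    have swap: "continuous_on (I01 \<times> I01) (\<lambda>(s, t). g t s)"
      by (rule swap_continuous[OF g])
    have "((\<lambda>t. H t s) has_vector_derivative g t s) (at t within I01)"
      unfolding H_def using slice_continuous[OF swap s] t by (rule integral_has_vector_derivative)
    then have "((\<lambda>t. inv_fund A s + (H t s - H s s)) has_vector_derivative g t s) (at t within I01)"
      by (auto intro!: derivative_eq_intros)
    from matrix_mult.has_vector_derivative[OF fund_derivative[OF A t] this]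
    show ?thesis
      by (simp add: V_def g_def matrix_mul_assoc inv_fund_fund[OF A t] add.commute)
  qed
  have diag: "V s s = mat 1" if "s \<in> I01" for s
    by (simp add: V_def inv_fund_fund[OF A that])
  have eq: "U t s = V t s" if s: "s \<in> I01" and t: "t \<in> {s..1}" for t s
  proof -
    have J: "{s..1} \<subseteq> I01" using s by auto
    have "U t s - V t s = 0"
    proof (rule fund_unique[OF A J, of s "\<lambda>t. U t s - V t s"])
      fix x assume x: "x \<in> {s..1}"
      then have "x \<in> I01" using J by blast
      from has_vector_derivative_diff[OF U[OF s x] has_vector_derivative_within_subset[OF der[OF this s] J]]
      show "((\<lambda>t. U t s - V t s) has_vector_derivative A x ** (U x s - V x s)) (at x within {s..1})"
        by (simp add: matrix_mult.diff_right)
    qed (use s t U0 diag in auto)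
    then show ?thesis by simp
  qed
  show thesis by (rule that[OF V der diag eq])
qed

lemma regular_imp_test: "regular_dist d \<Longrightarrow> test_fun (d \<phi>)"
  by (simp add: regular_dist_def)

lemma regular_outside: "regular_dist d \<Longrightarrow> \<not> test_fun \<phi> \<Longrightarrow> d \<phi> = 0"
  by (simp add: regular_dist_def additive_dist_def)

text \<open>
  Applied to a test function \<open>\<phi>\<close>, both sides are functions \<open>y\<close> of \<open>t\<close> with \<open>y(0) = 0\<close> and
  \<open>y' = A y + \<phi> + B \<phi>\<close>: the left one by differentiating the kernel \<open>V\<close>, the right one because
  \<open>W = R \<star> (I + B)\<close> satisfies \<open>W = I + B + A \<star> W\<close>.
\<close>

lemma solution_eq_star_product:
  fixes A :: "real \<Rightarrow> complex^'n^'n" and B V :: "real \<Rightarrow> real \<Rightarrow> complex^'n^'n"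
  assumes an: "\<And>i j. analytic_I (\<lambda>t. A t $ i $ j)"
    and Ban: "\<And>i j. analytic_II (\<lambda>t s. B t s $ i $ j)"
    and Vc: "continuous_on (I01 \<times> I01) (\<lambda>(t, s). V t s)"
    and Vd: "\<And>t s. t \<in> I01 \<Longrightarrow> s \<in> I01 \<Longrightarrow> ((\<lambda>t. V t s) has_vector_derivative (A t ** V t s + B t s)) (at t within I01)"
    and V1: "\<And>s. s \<in> I01 \<Longrightarrow> V s s = mat 1"
    and R: "is_star_inverse (mone_star - mtheta (\<lambda>t s. A t)) R" "regular_mat R"
  shows "mtheta V = smstar (theta_dist (\<lambda>t s. 1)) (R \<star> (mone_star + mtheta B))"
proof -
  let ?A = "mtheta (\<lambda>t s. A t)" and ?B = "mtheta B" and ?\<Theta> = "theta_dist (\<lambda>t s. 1)"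
  define W where "W = R \<star> (mone_star + ?B)"
  have rA: "regular_mat ?A" and rB: "regular_mat ?B"
    by (intro regular_mtheta coefficient_analytic[OF an] Ban)+
  have r1B: "regular_mat (mone_star + ?B)" by (intro regular_mat_add regular_mat_one rB)
  have rW: "regular_mat W" unfolding W_def by (intro regular_mat_mstar R r1B)
  have "(mone_star - ?A) \<star> W = ((mone_star - ?A) \<star> R) \<star> (mone_star + ?B)"
    unfolding W_def
    by (rule mstar_assoc[symmetric]) (intro regular_imp_additive regular_mat_diff regular_mat_one rA R r1B)+
  also have "\<dots> = mone_star + ?B"
    using R(1) r1B by (simp add: is_star_inverse_def mstar_one_left)
  finally have W: "W = mone_star + ?B + ?A \<star> W"
    using rW by (simp add: mstar_diff_left mstar_one_left algebra_simps)
  have "theta_dist (\<lambda>t s. V t s $ i $ j) \<phi> t = ?\<Theta> ((W $ i $ j) \<phi>) t" for i j \<phi> t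
  proof (cases "test_fun \<phi> \<and> t \<in> I01")
    case True
    then have \<phi>: "test_fun \<phi>" and t: "t \<in> I01" by auto
    have test: "test_fun ((W $ i $ j) \<phi>)" for i j
      using rW by (auto simp: regular_mat_def intro: regular_imp_test)
    define v where "v t = (\<chi> i j. theta_dist (\<lambda>t s. V t s $ i $ j) \<phi> t)" for t
    define w where "w t = (\<chi> i j. ?\<Theta> ((W $ i $ j) \<phi>) t)" for t
    define \<psi> where "\<psi> t = (\<chi> i j. (if i = j then \<phi> t else 0) + theta_dist (\<lambda>t s. B t s $ i $ j) \<phi> t)" for t
    have Bc: "continuous_on (I01 \<times> I01) (\<lambda>(t, s). B t s)"
      using analytic_II_continuous[OF Ban] by (intro continuous_on_matrixI) (simp add: case_prod_unfold)
    have AVc: "continuous_on (I01 \<times> I01) (\<lambda>(t, s). A t ** V t s + B t s)"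
      using continuous_on_add[OF matrix_mult.continuous_on[OF coefficient_continuous[OF an, unfolded case_prod_unfold]
          Vc[unfolded case_prod_unfold]] Bc[unfolded case_prod_unfold]]
      by (simp add: case_prod_unfold)
    have v: "(v has_vector_derivative A x ** v x + \<psi> x) (at x within I01)" if x: "x \<in> I01" for x
    proof (rule has_vector_derivative_matrixI)
      fix i j
      have "theta_dist (\<lambda>t s. (A t ** V t s + B t s) $ i $ j) \<phi> x
          = (\<Sum>k\<in>UNIV. A x $ i $ k * theta_dist (\<lambda>t s. V t s $ k $ j) \<phi> x) + theta_dist (\<lambda>t s. B t s $ i $ j) \<phi> x"
      proof -
        have d1: "theta_dist (\<lambda>t s. (A t ** V t s + B t s) $ i $ j - B t s $ i $ j) \<phi> x
            = theta_dist (\<lambda>t s. (A t ** V t s + B t s) $ i $ j) \<phi> x - theta_dist (\<lambda>t s. B t s $ i $ j) \<phi> x"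
          by (simp only: theta_dist_diff[OF continuous_entry_pair[OF AVc] continuous_entry_pair[OF Bc]] minus_apply)
        have d2: "theta_dist (\<lambda>t s. (A t ** V t s + B t s) $ i $ j - B t s $ i $ j) \<phi> x
            = (\<Sum>k\<in>UNIV. A x $ i $ k * theta_dist (\<lambda>t s. V t s $ k $ j) \<phi> x)"
          using theta_dist_sum_scaled[OF continuous_entry_pair[OF Vc] \<phi> x, where I = UNIV and i1 = "\<lambda>k. k"
              and j1 = "\<lambda>_. j" and c = "\<lambda>k t. A t $ i $ k"]
          by (simp add: matrix_matrix_mult_def)
        show ?thesis by (rule diff_eq_eq[THEN iffD1, OF trans[OF d1[symmetric] d2]])
      qed
      moreover have "(theta_dist (\<lambda>t s. V t s $ i $ j) \<phi> has_vector_derivative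
          V x x $ i $ j * \<phi> x + theta_dist (\<lambda>t s. (A t ** V t s + B t s) $ i $ j) \<phi> x) (at x within I01)"
        by (rule theta_dist_derivative[OF has_vector_derivative_entry[OF Vd] continuous_entry_pair[OF Vc]
              continuous_entry_pair[OF AVc] \<phi> x])
      ultimately show "((\<lambda>t. v t $ i $ j) has_vector_derivative (A x ** v x + \<psi> x) $ i $ j) (at x within I01)"
        using V1[OF x] by (cases "i = j") (simp_all add: v_def \<psi>_def matrix_matrix_mult_def mat_def algebra_simps)
    qed
    have \<Theta>: "?\<Theta> f x = integral {0..x} f" if "test_fun f" "x \<in> I01" for f x
      using theta_dist_left_constant[OF that, of "\<lambda>_. 1"] by simp
    have w: "(w has_vector_derivative A x ** w x + \<psi> x) (at x within I01)" if x: "x \<in> I01" for x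
    proof (rule has_vector_derivative_matrixI)
      fix i j
      have "(W $ i $ j) \<phi> = ((mone_star + ?B + ?A \<star> W) $ i $ j) \<phi>" using W by simp
      then have "(W $ i $ j) \<phi> x = (if i = j then \<phi> x else 0) + theta_dist (\<lambda>t s. B t s $ i $ j) \<phi> x
          + (\<Sum>k\<in>UNIV. theta_dist (\<lambda>t s. A t $ i $ k) ((W $ k $ j) \<phi>) x)"
        using \<phi> by (simp add: mone_star_def one_star_apply mtheta_def mstar_nth sum_fun_apply)
      also have "\<dots> = (A x ** w x + \<psi> x) $ i $ j"
        by (simp add: w_def \<psi>_def matrix_matrix_mult_def \<Theta>[OF test x] theta_dist_left_constant[OF test x])
      finally have Wx: "(W $ i $ j) \<phi> x = (A x ** w x + \<psi> x) $ i $ j" .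
      have "((\<lambda>t. integral {0..t} ((W $ i $ j) \<phi>)) has_vector_derivative (W $ i $ j) \<phi> x) (at x within I01)"
        by (rule integral_has_vector_derivative[OF test_fun_continuous[OF test] x])
      then have "((\<lambda>t. integral {0..t} ((W $ i $ j) \<phi>)) has_vector_derivative (A x ** w x + \<psi> x) $ i $ j) (at x within I01)"
        unfolding Wx .
      then show "((\<lambda>t. w t $ i $ j) has_vector_derivative (A x ** w x + \<psi> x) $ i $ j) (at x within I01)"
        by (rule has_vector_derivative_transform[OF x, rotated]) (simp add: w_def \<Theta>[OF test])
    qed
    have "v t - w t = 0"
    proof (rule fund_unique[OF analytic_matrix_continuous[OF an], of 0 1 0 "\<lambda>t. v t - w t"])
      show "((\<lambda>t. v t - w t) has_vector_derivative A x ** (v x - w x)) (at x within I01)" if "x \<in> I01" for x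
        using has_vector_derivative_diff[OF v[OF that] w[OF that]] by (simp add: matrix_mult.diff_right)
    qed (use t in \<open>auto simp: v_def w_def theta_dist_at_0 vec_eq_iff\<close>)
    then show ?thesis by (simp add: v_def w_def vec_eq_iff)
  next
    case False
    moreover have "(W $ i $ j) \<phi> = 0" if "\<not> test_fun \<phi>"
      using rW that by (auto simp: regular_mat_def intro: regular_outside)
    moreover have "?\<Theta> 0 t = 0" by (simp add: theta_dist_def)
    ultimately show ?thesis by (auto simp: theta_dist_outside)
  qed
  then show ?thesis
    unfolding W_def[symmetric] by (simp add: mtheta_def smstar_def star_def vec_eq_iff fun_eq_iff)
qed

theorem mainTheorem1:
  fixes At :: "real \<Rightarrow> complex^'n^'n"
    and Bt Ut :: "real \<Rightarrow> real \<Rightarrow> complex^'n^'n"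
    and A B U :: "dist^'n^'n"
  assumes At_analytic: "\<And>i j. analytic_I (\<lambda>t. At t $ i $ j)"
    and Bt_analytic: "\<And>i j. analytic_II (\<lambda>t s. Bt t s $ i $ j)"
    and Ut_ode: "\<And>t s. s \<in> I01 \<Longrightarrow> t \<in> {s..1} \<Longrightarrow>
      ((\<lambda>x. Ut x s) has_vector_derivative (At t ** Ut t s + Bt t s)) (at t within {s..1})"
    and Ut_init: "\<And>s. s \<in> I01 \<Longrightarrow> Ut s s = mat 1"
    and U_eq: "U = mtheta Ut"
    and A_eq: "A = mtheta (\<lambda>t s. At t)"
    and B_eq: "B = mtheta Bt"
  shows "(\<exists>a S. (\<forall>k\<ge>1. (\<forall>i j. analytic_II (\<lambda>t s. a k t s $ i $ j)) \<and> mstar_pow A k = mtheta (a k)) \<and>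
           uniform_limit (I01 \<times> I01)
             (\<lambda>n (t, s). \<Sum>k=1..n. Heaviside (t - s) *\<^sub>R a k t s)
             (\<lambda>(t, s). Heaviside (t - s) *\<^sub>R S t s) sequentially \<and>
           star_resolvent A = mone_star + mtheta S)
       \<and> is_star_inverse (mone_star - A) (star_resolvent A)
       \<and> star_resolvent A = star_inv (mone_star - A)
       \<and> U = smstar (theta_dist (\<lambda>t s. 1)) (star_inv (mone_star - A) \<star> (mone_star + B))"
proof (intro conjI)
  let ?a = "\<lambda>k t s. At t ** propagator_term At (k - 1) t s"
  let ?S = "\<lambda>t s. At t ** propagator At t s"
  note an = At_analytic
  have cont: "continuous_on I01 At" by (rule analytic_matrix_continuous[OF an])
  have "(\<forall>i j. analytic_II (\<lambda>t s. ?a k t s $ i $ j)) \<and> mstar_pow A k = mtheta (?a k)" if "k \<ge> 1" for k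
    using star_power[OF an, of "k - 1"] that analytic_propagator_term[OF an] by (simp add: A_eq)
  then show "\<exists>a S. (\<forall>k\<ge>1. (\<forall>i j. analytic_II (\<lambda>t s. a k t s $ i $ j)) \<and> mstar_pow A k = mtheta (a k)) \<and>
           uniform_limit (I01 \<times> I01)
             (\<lambda>n (t, s). \<Sum>k=1..n. Heaviside (t - s) *\<^sub>R a k t s)
             (\<lambda>(t, s). Heaviside (t - s) *\<^sub>R S t s) sequentially \<and>
           star_resolvent A = mone_star + mtheta S"
    using uniform_convergence[OF an] star_resolvent_eq[OF an] unfolding A_eq
    by (intro exI[of _ ?a] exI[of _ ?S]) simp
  have res: "star_resolvent A = mone_star + mtheta ?S" unfolding A_eq by (rule star_resolvent_eq[OF an])
  show inv: "is_star_inverse (mone_star - A) (star_resolvent A)"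
    unfolding res unfolding A_eq by (rule resolvent_inverse[OF an])
  have reg: "regular_mat (star_resolvent A)" unfolding res by (rule resolvent_regular[OF an])
  have "regular_mat (mone_star - A)"
    unfolding A_eq by (intro regular_mat_diff regular_mat_one regular_mtheta coefficient_analytic[OF an])
  from star_inv_eqI[OF this inv reg]
  show eq: "star_resolvent A = star_inv (mone_star - A)" by simp
  have Bc: "continuous_on (I01 \<times> I01) (\<lambda>(t, s). Bt t s)"
    using analytic_II_continuous[OF Bt_analytic] by (intro continuous_on_matrixI) (simp add: case_prod_unfold)
  obtain V where V: "continuous_on (I01 \<times> I01) (\<lambda>(t, s). V t s)"
    "\<And>t s. t \<in> I01 \<Longrightarrow> s \<in> I01 \<Longrightarrow> ((\<lambda>t. V t s) has_vector_derivative (At t ** V t s + Bt t s)) (at t within I01)"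
    "\<And>s. s \<in> I01 \<Longrightarrow> V s s = mat 1"
    and UV: "\<And>t s. s \<in> I01 \<Longrightarrow> t \<in> {s..1} \<Longrightarrow> Ut t s = V t s"
    by (rule variation_of_constants[OF cont Bc Ut_ode Ut_init]; (rule that)?; assumption)
  have "U = mtheta V"
    unfolding U_eq mtheta_def by (intro vec_eq_iff[THEN iffD2] allI) (auto intro!: theta_dist_cong simp: UV)
  also have "\<dots> = smstar (theta_dist (\<lambda>t s. 1)) (star_resolvent A \<star> (mone_star + B))"
    unfolding B_eq
    by (rule solution_eq_star_product[OF an Bt_analytic V inv[unfolded A_eq] reg[unfolded A_eq], folded A_eq])
  finally show "U = smstar (theta_dist (\<lambda>t s. 1)) (star_inv (mone_star - A) \<star> (mone_star + B))"
    unfolding eq .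
qed

end
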